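(* For every integer $n\ge 1$, $$\sum_{M\in\mathcal{M}_n(P_1)}x^{\mathrm{mcr}(M)}=\sum_{M\in\mathcal{M}_n(P_2)}x^{\mathrm{mcr}(M)}=\sum_{M\in\mathcal{M}_n(P_2)}x^{\mathrm{nr}(M)}=\sum_{P\in\mathcal{P}_n(\mathbf{3+1})}x^{\mathrm{mag}(P)}=\sum_{P\in\mathcal{P}_n(\mathbf{N})}x^{\mathrm{mag}(P)}$$ $$=\sum_{P\in\mathcal{P}_n(\mathbf{N})}x^{\mathrm{h}(P)}=\sum_{\alpha\in\mathcal{A}_n(101)}x^{\mathrm{lmax}(\alpha)}=\sum_{\pi\in\mathcal{F}_n(3142)}x^{\mathrm{rmin}(\pi)}=N_n(x),$$ where $N_n(x)=\sum_{k=1}^{n}\frac1n\binom nk\binom n{k-1}x^k$ is the Narayana polynomial.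
   Context: Matchings. A matching of length $n$ is a partition of $\{1,2,\ldots,2n\}$ into blocks of size 2, called arcs, written $[a,b]$ with $a<b$ ($a$ the opener, $b$ the closer). A matching is a Stoimenow matching if it contains neither a pair of arcs $[i,\ell],[i+1,k]$ with $i+1<k<\ell$ nor a pair of arcs $[k,j+1],[\ell,j]$ with $k<\ell<j$. $\mathcal{M}_n$ is the set of Stoimenow matchings of length $n$. A matching contains a pattern (another matching) if, after removing some (possibly no) arcs and relabelling the remaining endpoints increasingly by $1,2,\ldots$, one obtains that pattern; otherwise it avoids it. $\mathcal{M}_n(P_i)$ is the set of matchings in $\mathcal{M}_n$ avoiding $P_i$, where $P_1=\{[1,3],[2,7],[4,5],[6,8]\}$ and $P_2=\{[1,3],[2,5],[4,7],[6,8]\}$. A $k$-crossing ($k\ge1$) in $M$ is a set of $k$ arcs of $M$ with $a_{i_1}<\cdots<a_{i_k}<b_{i_1}<\cdots<b_{i_k}$ (a single arc is a 1-crossing); $\mathrm{mcr}(M)$ is the number of maximal (with respect to inclusion) crossings in $M$. A $k$-noncrossing is a set of $k$ arcs with $a_{i_1}<b_{i_1}<a_{i_2}<b_{i_2}<\cdots<a_{i_k}<b_{i_k}$; $\mathrm{nr}(M)$ is the largest $k$ such that $M$ contains a $k$-noncrossing. Posets. Posets are unlabelled (up to isomorphism). $\mathcal{P}_n$ is the set of $n$-element posets with no induced subposet isomorphic to $\mathbf{2+2}$ (disjoint union of two 2-element chains). $\mathbf{3+1}$ is the disjoint union of a 3-element chain and a 1-element chain; $\mathbf{N}$ is the poset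 on $\{a,b,c,d\}$ whose strict relations are exactly $a<c$, $a<d$, $b<d$. $\mathcal{P}_n(X)$ is the set of posets in $\mathcal{P}_n$ with no induced subposet isomorphic to $X$. $\mathrm{mag}(P)$ is the number of distinct strict down-sets $D(x)=\{y: y<x\}$, $x\in P$ (equivalently, for such posets, the number of maximal antichains). $\mathrm{h}(P)$ is the maximum size of a chain. Ascent sequences. An index $i$ is an ascent of an integer sequence if its $i$-th entry is less than its $(i+1)$-st; $\mathrm{asc}$ is the number of ascents. $\mathcal{A}_n$ is the set of integer sequences $(\alpha_1,\ldots,\alpha_n)$ with $\alpha_1=0$ and $0\le\alpha_i\le 1+\mathrm{asc}(\alpha_1,\ldots,\alpha_{i-1})$ for $2\le i\le n$. $\mathcal{A}_n(101)$ is the subset of those having no $i<j<k$ with $\alpha_i=\alpha_k>\alpha_j$. $\mathrm{lmax}(\alpha)=\#\{i:\alpha_i>\alpha_j\text{ for all }j<i\}$. Permutations. $\mathcal{F}_n$ is the set of permutations $\pi$ of $\{1,\ldots,n\}$ (Fishburn permutations) for which there are no $i,j$ with $j>i+1$ and $\pi_j+1=\pi_i<\pi_{i+1}$. $\mathcal{F}_n(3142)$ is the subset avoiding the classical pattern $3142$. $\mathrm{rmin}(\pi)=\#\{i:\pi_i<\pi_j\text{ for all }j>i\}$. *)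

theory Defs
  imports
    "HOL-Combinatorics.Combinatorics"
    "HOL-Computational_Algebra.Polynomial"
    "HOL-Library.Disjoint_Sets"
begin

section \<open>Stoimenow matchings\<close>

text \<open>An arc \<open>[a,b]\<close> is the pair \<open>(a, b)\<close> with opener \<open>a < b\<close>, so a matching is a set of such pairs
  whose underlying two-element blocks partition \<open>{1..2n}\<close>.\<close>

type_synonym arc = "nat \<times> nat"

definition matching :: "nat \<Rightarrow> arc set \<Rightarrow> bool" where
  "matching n M \<longleftrightarrow>
     (\<forall>(a, b) \<in> M. a < b) \<and> partition_on {1..2 * n} ((\<lambda>(a, b). {a, b}) ` M)"

definition stoimenow :: "arc set \<Rightarrow> bool" where
  "stoimenow M \<longleftrightarrow>
     \<not> (\<exists>i k l. (i, l) \<in> M \<and> (i + 1, k) \<in> M \<and> i + 1 < k \<and> k < l) \<and>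
     \<not> (\<exists>j k l. (k, j + 1) \<in> M \<and> (l, j) \<in> M \<and> k < l \<and> l < j)"

definition endpoints :: "arc set \<Rightarrow> nat set" where
  "endpoints S = fst ` S \<union> snd ` S"

definition relabel :: "arc set \<Rightarrow> arc set" where
  "relabel S = (let rank = (\<lambda>x. card {y \<in> endpoints S. y \<le> x})
                in (\<lambda>(a, b). (rank a, rank b)) ` S)"

definition contains_matching :: "arc set \<Rightarrow> arc set \<Rightarrow> bool" where
  "contains_matching M P \<longleftrightarrow> (\<exists>S \<subseteq> M. relabel S = P)"

definition stoimenow_matchings :: "nat \<Rightarrow> arc set set" where
  "stoimenow_matchings n = {M. matching n M \<and> stoimenow M}"

definition stoimenow_matchings_avoiding :: "nat \<Rightarrow> arc set \<Rightarrow> arc set set" where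
  "stoimenow_matchings_avoiding n P =
     {M \<in> stoimenow_matchings n. \<not> contains_matching M P}"

definition pattern_P1 :: "arc set" where
  "pattern_P1 = {(1, 3), (2, 7), (4, 5), (6, 8)}"

definition pattern_P2 :: "arc set" where
  "pattern_P2 = {(1, 3), (2, 5), (4, 7), (6, 8)}"

text \<open>The list \<open>xs\<close> enumerates the arcs \<open>(a\<^sub>1, b\<^sub>1), \<dots>, (a\<^sub>k, b\<^sub>k)\<close> of the set. The sorted list is
  \<open>a\<^sub>1, \<dots>, a\<^sub>k, b\<^sub>1, \<dots>, b\<^sub>k\<close> for a crossing and \<open>a\<^sub>1, b\<^sub>1, \<dots>, a\<^sub>k, b\<^sub>k\<close> for a noncrossing.\<close>

definition crossing :: "arc set \<Rightarrow> arc set \<Rightarrow> bool" where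
  "crossing M S \<longleftrightarrow> S \<subseteq> M \<and> S \<noteq> {} \<and>
     (\<exists>xs. set xs = S \<and> sorted_wrt (<) (map fst xs @ map snd xs))"

definition noncrossing :: "arc set \<Rightarrow> arc set \<Rightarrow> bool" where
  "noncrossing M S \<longleftrightarrow> S \<subseteq> M \<and>
     (\<exists>xs. set xs = S \<and> sorted_wrt (<) (concat (map (\<lambda>(a, b). [a, b]) xs)))"

definition mcr :: "arc set \<Rightarrow> nat" where
  "mcr M = card {S. crossing M S \<and> (\<forall>T. crossing M T \<and> S \<subseteq> T \<longrightarrow> T = S)}"

definition nr :: "arc set \<Rightarrow> nat" where
  "nr M = Max {card S | S. noncrossing M S}"


section \<open>Unlabelled posets\<close>

text \<open>A poset is given by its reflexive order relation, whose \<^const>\<open>Field\<close> is the ground set.\<close>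

definition poset_iso :: "'a rel \<Rightarrow> 'b rel \<Rightarrow> bool" where
  "poset_iso r s \<longleftrightarrow>
     (\<exists>f. bij_betw f (Field r) (Field s) \<and>
          (\<forall>x \<in> Field r. \<forall>y \<in> Field r. (x, y) \<in> r \<longleftrightarrow> (f x, f y) \<in> s))"

definition contains_poset :: "'a rel \<Rightarrow> 'b rel \<Rightarrow> bool" where
  "contains_poset r s \<longleftrightarrow> (\<exists>B \<subseteq> Field r. poset_iso (r \<inter> B \<times> B) s)"

text \<open>An unlabelled \<open>n\<close>-element poset is an isomorphism class of partial orders on \<open>{1..n}\<close>.\<close>

definition labelled_posets :: "nat \<Rightarrow> nat rel set" where
  "labelled_posets n = {r. partial_order_on {1..n} r}"

definition unlabelled_posets :: "nat \<Rightarrow> nat rel set set" where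
  "unlabelled_posets n =
     labelled_posets n // {(r, s) \<in> labelled_posets n \<times> labelled_posets n. poset_iso r s}"

definition two_plus_two :: "nat rel" where
  "two_plus_two = Id_on {1, 2, 3, 4} \<union> {(1, 2), (3, 4)}"

definition three_plus_one :: "nat rel" where
  "three_plus_one = Id_on {1, 2, 3, 4} \<union> {(1, 2), (2, 3), (1, 3)}"

definition poset_N :: "nat rel" where
  "poset_N = Id_on {1, 2, 3, 4} \<union> {(1, 3), (1, 4), (2, 4)}"

definition two_plus_two_free_posets :: "nat \<Rightarrow> nat rel set set" where
  "two_plus_two_free_posets n =
     {P \<in> unlabelled_posets n. \<forall>r \<in> P. \<not> contains_poset r two_plus_two}"

definition two_plus_two_free_posets_avoiding :: "nat \<Rightarrow> nat rel \<Rightarrow> nat rel set set" where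
  "two_plus_two_free_posets_avoiding n X =
     {P \<in> two_plus_two_free_posets n. \<forall>r \<in> P. \<not> contains_poset r X}"

text \<open>\<^term>\<open>underS r x\<close> is the strict down-set \<open>{y. y < x}\<close>.\<close>

definition labelled_mag :: "'a rel \<Rightarrow> nat" where
  "labelled_mag r = card (underS r ` Field r)"

definition labelled_height :: "'a rel \<Rightarrow> nat" where
  "labelled_height r = Max (card ` Chains r)"

text \<open>Both statistics are isomorphism invariant, so on an isomorphism class \<open>P\<close> they take a single
  value, which \<^const>\<open>the_elem\<close> extracts.\<close>

definition mag :: "'a rel set \<Rightarrow> nat" where
  "mag P = the_elem (labelled_mag ` P)"

definition height :: "'a rel set \<Rightarrow> nat" where
  "height P = the_elem (labelled_height ` P)"


section \<open>Ascent sequences\<close>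

text \<open>Sequences are lists, indexed from \<open>0\<close>. Entries of ascent sequences are nonnegative, hence of
  type \<^typ>\<open>nat\<close>; \<^term>\<open>take i xs\<close> consists of the entries before \<^term>\<open>xs ! i\<close>.\<close>

definition asc :: "nat list \<Rightarrow> nat" where
  "asc xs = card {i. i + 1 < length xs \<and> xs ! i < xs ! (i + 1)}"

definition ascent_sequences :: "nat \<Rightarrow> nat list set" where
  "ascent_sequences n =
     {xs. length xs = n \<and> (0 < n \<longrightarrow> xs ! 0 = 0) \<and>
          (\<forall>i. 1 \<le> i \<and> i < n \<longrightarrow> xs ! i \<le> 1 + asc (take i xs))}"

definition ascent_sequences_avoiding_101 :: "nat \<Rightarrow> nat list set" where
  "ascent_sequences_avoiding_101 n =
     {xs \<in> ascent_sequences n.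
        \<not> (\<exists>i j k. i < j \<and> j < k \<and> k < n \<and> xs ! i = xs ! k \<and> xs ! k > xs ! j)}"

definition lmax :: "nat list \<Rightarrow> nat" where
  "lmax xs = card {i. i < length xs \<and> (\<forall>j < i. xs ! i > xs ! j)}"


section \<open>Fishburn permutations\<close>

text \<open>Permutations of \<open>{1..n}\<close> are in one-line notation, with positions counted from \<open>0\<close>.\<close>

definition fishburn_permutations :: "nat \<Rightarrow> nat list set" where
  "fishburn_permutations n =
     {p \<in> permutations_of_set {1..n}.
        \<not> (\<exists>i j. i + 1 < j \<and> j < n \<and> p ! j + 1 = p ! i \<and> p ! i < p ! (i + 1))}"

definition contains_pattern :: "nat list \<Rightarrow> nat list \<Rightarrow> bool" where
  "contains_pattern p q \<longleftrightarrow>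
     (\<exists>ys \<in> set (subseqs p). length ys = length q \<and>
        (\<forall>i < length q. \<forall>j < length q. ys ! i < ys ! j \<longleftrightarrow> q ! i < q ! j))"

definition fishburn_permutations_avoiding :: "nat \<Rightarrow> nat list \<Rightarrow> nat list set" where
  "fishburn_permutations_avoiding n q =
     {p \<in> fishburn_permutations n. \<not> contains_pattern p q}"

definition rmin :: "nat list \<Rightarrow> nat" where
  "rmin p = card {i. i < length p \<and> (\<forall>j. i < j \<and> j < length p \<longrightarrow> p ! i < p ! j)}"


section \<open>Narayana polynomials\<close>

definition narayana_poly :: "nat \<Rightarrow> rat poly" where
  "narayana_poly n =
     (\<Sum>k = 1..n. monom (1 / of_nat n * of_nat (n choose k) * of_nat (n choose (k - 1))) k)"

end

theory Submission
  imports Defs "HOL-Library.Sublist" "HOL-Library.Multiset" "HOL-Library.Product_Lexorder"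
begin

text \<open>An interval order is determined up to isomorphism by the multiset of cells \<open>(l, u)\<close> of its canonical
  representation (\<open>x < y\<close> iff \<open>u x < l y\<close>, where every endpoint below the magnitude \<open>k\<close> occurs both as some
  \<open>l\<close> and as some \<open>u\<close>), and a Stoimenow matching is determined by the same data, with \<open>l\<close> and \<open>u\<close> counting
  the runs of openers and closers. Both \<open>P\<^sub>1\<close> and \<open>3+1\<close> become the condition that no cell is strictly nested
  in another, both \<open>P\<^sub>2\<close> and \<open>N\<close> the condition that no two cells cross (\<open>l < l' \<le> u < u'\<close>), and in each case
  all the statistics equal \<open>k\<close>; without crossings this is because every diagonal cell \<open>(i, i)\<close> must occur.

  Sorting non-nested cells gives pairs of lattice paths, counted by a two-by-two determinant of binomial
  coefficients. Reading uncrossed cells column by column, from the diagonal upwards, gives the restricted growth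
  functions avoiding 101, which are the ascent sequences avoiding 101. These and the 231-avoiding permutations
  (the Fishburn permutations avoiding 3142) grow along the same Catalan generating tree.\<close>

section \<open>The Narayana numbers and a Catalan generating tree\<close>

text \<open>A structure is tied to its cells by one relation alone: \<open>u x < l y\<close> in a
  poset, closer before opener in a matching. The endpoints can be recovered from that relation by
  counting distinct down-sets, and this is why they have to fill \<open>{..<k}\<close> without gaps.
  The same surjectivity supplies the two outer elements, or outer arcs, by which a nested or crossed
  pair is completed to a forbidden pattern with four elements. In a matching the Stoimenow condition
  forces the order inside every run, so the cells leave nothing to choose.

  No bijection links the unnested with the uncrossed multisets. They are counted independently, by a
  determinant and by a tree, and the two counts meet in the integer formula \<open>narayana\<close>;
  division by \<open>n\<close> enters only when integers are compared with the coefficients of the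
  polynomial. Weight alone does not satisfy a recursion in the tree, hence the refinement by the
  number of sites and the need for a closed form in three parameters.\<close>

text \<open>The number of objects with label \<open>s\<close> and weight \<open>k\<close> at level \<open>n\<close> of the Catalan tree below. It equals
  \<open>s / n\<close> times \<open>(n choose k) (n - s - 1 choose k - s)\<close>; the difference form also covers \<open>s = n\<close>, where
  \<open>n - s - 1\<close> is truncated.\<close>

definition ballot :: "nat \<Rightarrow> nat \<Rightarrow> nat \<Rightarrow> int" where
  "ballot n s k = (if s \<le> n \<and> s \<le> k
     then int (n choose k) * int ((n - s - 1) choose (k - s)) - int ((n - 1) choose k) * int ((n - s) choose (k - s))
     else 0)"

lemma ballot_0 [simp]: "ballot n 0 k = 0"
  by (simp add: ballot_def)

text \<open>Pascal's rule, with level and weight written as \<open>s\<close> plus an offset so that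
  the truncated differences inside \<open>ballot\<close> cancel. Small offsets are separated because
  Pascal's rule needs successors in both arguments.\<close>

lemma ballot_rec_aux:
  assumes "1 \<le> s + q"
  shows "ballot (Suc (s + q)) (Suc s) (Suc (s + j)) - ballot (Suc (s + q)) (Suc (Suc s)) (Suc (s + j))
   = ballot (s + q) s (s + j) - ballot (s + q) (Suc s) (s + j) + ballot (s + q) (Suc s) (Suc (s + j))"
proof (cases q)
  case 0
  then show ?thesis
    using assms by (cases j) (auto simp: ballot_def binomial_eq_0)
next
  case (Suc p)
  show ?thesis
  proof (cases p)
    case 0
    with Suc show ?thesis
      by (cases j) (auto simp: ballot_def binomial_eq_0 algebra_simps)
  next
    case p: (Suc p')
    show ?thesis
    proof (cases j)
      case 0
      then show ?thesis using Suc p by (auto simp: ballot_def algebra_simps)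
    next
      case (Suc i)
      then show ?thesis using \<open>q = Suc p\<close> p
        by (auto simp: ballot_def algebra_simps)
    qed
  qed
qed

text \<open>The production rule of the tree for label \<open>s\<close>, from which the rule for
  label \<open>s + 1\<close> has been subtracted; telescoping over \<open>s\<close> restores the
  rule itself.\<close>

lemma ballot_rec:
  assumes "1 \<le> n" "1 \<le> s"
  shows "ballot (Suc n) s k = ballot (Suc n) (Suc s) k
     + (if 1 \<le> k then ballot n (s - 1) (k - 1) - ballot n s (k - 1) else 0) + ballot n s k"
proof (cases "s - 1 \<le> n \<and> s \<le> k")
  case True
  define t where "t = s - 1"
  obtain q where q: "n = t + q" using True t_def le_iff_add by blast
  obtain j where j: "k - 1 = t + j" using True assms t_def le_iff_add diff_le_mono by metis
  have "s = Suc t" "k = Suc (t + j)" "1 \<le> t + q" using assms True t_def q j by auto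
  then show ?thesis using ballot_rec_aux[of t q j] q by simp
next
  case False
  have 0: "ballot m t i = 0" if "m < t \<or> i < t" for m t i using that by (auto simp: ballot_def)
  from False have "Suc n < s \<or> k < s" by linarith
  then have "ballot (Suc n) s k = 0" "ballot (Suc n) (Suc s) k = 0" "ballot n s k = 0" "ballot n s (k - 1) = 0"
    by (auto intro!: 0)
  moreover have "ballot n (s - 1) (k - 1) = 0" if "1 \<le> k"
    using \<open>Suc n < s \<or> k < s\<close> that by (intro 0) linarith
  ultimately show ?thesis by simp
qed

text \<open>An object of label \<open>s\<close> is either the last child of a parent of label
  \<open>s - 1\<close>, which raises the weight, or an earlier child of a parent of label at least
  \<open>s\<close>, which does not.\<close>

lemma ballot_rec_sum:
  assumes "1 \<le> n" "1 \<le> s"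
  shows "ballot (Suc n) s k = (if 1 \<le> k then ballot n (s - 1) (k - 1) else 0) + (\<Sum>t = s..n. ballot n t k)"
proof (cases "s \<le> Suc n")
  case True
  then show ?thesis using assms(2)
  proof (induction s rule: inc_induct)
    case base
    then show ?case using ballot_rec[OF assms(1), of "Suc n" k] by (simp add: ballot_def)
  next
    case (step s)
    have "(\<Sum>t = s..n. ballot n t k) = ballot n s k + (\<Sum>t = Suc s..n. ballot n t k)"
      using step by (simp add: sum.atLeast_Suc_atMost)
    then show ?case using ballot_rec[OF assms(1) step.prems, of k] step by (auto split: if_splits)
  qed
next
  case False
  then show ?thesis by (auto simp: ballot_def)
qed

text \<open>Every object has exactly one child of label 1, and as labels are positive this child is
  not the last one and keeps the weight. So label 1 on the next level counts all objects of the
  present level.\<close>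

lemma ballot_sum: "1 \<le> n \<Longrightarrow> (\<Sum>t = 1..n. ballot n t k) = ballot (Suc n) 1 k"
  using ballot_rec_sum[of n 1 k] by simp

text \<open>The Narayana number as a two-by-two determinant of binomials, over \<open>int\<close> so
  that the difference is not truncated. The guard at \<open>k = 1\<close> matters: there
  \<open>k - 2\<close> would be 0 and contribute a spurious product.\<close>

definition narayana :: "nat \<Rightarrow> nat \<Rightarrow> int" where
  "narayana n k = (if k = 0 then 0 else int ((n - 1) choose (k - 1)) * int ((n - 1) choose (k - 1))
     - (if k = 1 then 0 else int ((n - 1) choose k) * int ((n - 1) choose (k - 2))))"

lemma ballot_1_narayana: "1 \<le> n \<Longrightarrow> ballot (Suc n) 1 k = narayana n k"
proof -
  assume "1 \<le> n"
  then obtain m where n: "n = Suc m" by (cases n) auto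
  show ?thesis
  proof (cases k)
    case 0
    then show ?thesis by (simp add: narayana_def ballot_def)
  next
    case (Suc i)
    then show ?thesis using n
      by (cases i) (auto simp: narayana_def ballot_def algebra_simps)
  qed
qed

text \<open>After multiplication by \<open>k\<close> the absorption identities turn the two products
  of the difference into \<open>n + 1\<close> times and \<open>n\<close> times the same product of
  binomials, so exactly one copy remains.\<close>

lemma narayana_formula:
  assumes "1 \<le> n" "1 \<le> k"
  shows "int n * narayana n k = int (n choose k) * int (n choose (k - 1))"
proof -
  obtain m where n: "n = Suc m" using assms by (cases n) auto
  obtain i where k: "k = Suc i" using assms by (cases k) auto
  have a: "Suc i * (Suc (Suc m) choose Suc i) = Suc (Suc m) * (Suc m choose i)"
    by (rule Suc_times_binomial)
  have b: "Suc i * (Suc m choose Suc i) = Suc m * (m choose i)"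
    by (rule Suc_times_binomial)
  \<comment> \<open>The form \<open>ballot (n + 1) 1 k\<close> of the Narayana number suits
    absorption better than the determinant.\<close>
  have e: "narayana n k = int (Suc (Suc m) choose Suc i) * int (m choose i) - int (Suc m choose Suc i) * int (Suc m choose i)"
    using ballot_1_narayana[of n k] n k assms by (simp add: ballot_def del: binomial_Suc_Suc)
  have "int (Suc i) * (int n * narayana n k) = int (Suc i) * (int (n choose k) * int (n choose (k - 1)))"
  proof -
    have "int (Suc i) * (int (Suc m) * (int (Suc (Suc m) choose Suc i) * int (m choose i)))
       = int (Suc (Suc m)) * int (Suc m choose i) * (int (Suc i) * int (Suc m choose Suc i))"
      using arg_cong[OF a, of int] arg_cong[OF b, of int] unfolding of_nat_mult
      by (metis (no_types, lifting) mult.assoc mult.left_commute)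
    then show ?thesis unfolding e unfolding n k
      by (simp add: right_diff_distrib algebra_simps del: binomial_Suc_Suc of_nat_Suc)
        (simp add: algebra_simps del: binomial_Suc_Suc)
  qed
  then show ?thesis by simp
qed

lemma narayana_eq_0: "1 \<le> n \<Longrightarrow> k = 0 \<or> n < k \<Longrightarrow> narayana n k = 0"
  by (auto simp: narayana_def binomial_eq_0)

text \<open>The only passage from integer counts to rational coefficients; outside
  \<open>1..n\<close> both sides vanish.\<close>

lemma sum_monom_eq_narayana_poly:
  assumes n: "1 \<le> n" and fin: "finite X" and c: "\<And>k. int (card {x \<in> X. f x = k}) = narayana n k"
  shows "(\<Sum>x\<in>X. monom 1 (f x)) = narayana_poly n"
proof (rule poly_eqI)
  fix k
  have "coeff (\<Sum>x\<in>X. monom (1::rat) (f x)) k = (\<Sum>x\<in>X. if f x = k then 1 else 0)"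
    by (simp add: coeff_sum)
  also have "\<dots> = of_nat (card {x \<in> X. f x = k})"
    using fin by (simp add: sum.If_cases Int_def)
  also have "\<dots> = of_int (narayana n k)" by (metis c of_int_of_nat_eq)
  also have "\<dots> = coeff (narayana_poly n) k"
  proof -
    have *: "coeff (narayana_poly n) k = (if k \<in> {1..n} then 1 / of_nat n * of_nat (n choose k) * of_nat (n choose (k - 1)) else 0)"
      by (simp add: narayana_poly_def coeff_sum)
    show ?thesis
    proof (cases "k \<in> {1..n}")
      case True
      then have "int n * narayana n k = int (n choose k) * int (n choose (k - 1))"
        using n by (intro narayana_formula) auto
      then have "(of_nat n * of_int (narayana n k) :: rat) = of_nat (n choose k) * of_nat (n choose (k - 1))"
        by (metis of_int_mult of_int_of_nat_eq)
      then show ?thesis using True n unfolding * by (simp add: field_simps)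
    next
      case False
      then show ?thesis using * narayana_eq_0[OF n] by auto
    qed
  qed
  finally show "coeff (\<Sum>x\<in>X. monom (1::rat) (f x)) k = coeff (narayana_poly n) k" .
qed

section \<open>The weighted Catalan generating tree\<close>

lemma bij_betw_rank:
  fixes A :: "nat set"
  assumes "finite A"
  shows "bij_betw (\<lambda>v. card {a \<in> A. a \<le> v}) A {1..card A}"
proof -
  have inj: "inj_on (\<lambda>v. card {a \<in> A. a \<le> v}) A"
  proof (rule linorder_inj_onI)
    fix v w assume "v < w" "v \<in> A" "w \<in> A"
    then have "{a \<in> A. a \<le> v} \<subseteq> {a \<in> A. a \<le> w}" "w \<in> {a \<in> A. a \<le> w} - {a \<in> A. a \<le> v}" by auto
    then have "{a \<in> A. a \<le> v} \<subset> {a \<in> A. a \<le> w}" by blast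
    then show "card {a \<in> A. a \<le> v} \<noteq> card {a \<in> A. a \<le> w}"
      using assms by (simp add: psubset_card_mono less_imp_neq)
  qed auto
  moreover have "(\<lambda>v. card {a \<in> A. a \<le> v}) ` A \<subseteq> {1..card A}"
    using assms by (auto simp: Suc_le_eq card_gt_0_iff intro!: card_mono)
  ultimately show ?thesis
    using assms by (simp add: bij_betw_def card_image card_subset_eq)
qed

text \<open>The Catalan generating tree: an object \<open>y\<close> with label \<open>card (V y) - 1\<close> has one child for each of its
  sites \<open>v \<in> V y\<close>, whose label is the rank of \<open>v\<close>, and only the child at the last site has a larger weight.\<close>

lemma catalan_tree:
  fixes X :: "nat \<Rightarrow> 'a set" and V :: "'a \<Rightarrow> nat set" and wt :: "'a \<Rightarrow> nat"
  assumes X1: "X 1 = {r}" "card (V r) = 2" "wt r = 1"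
    and V: "\<And>n y. 1 \<le> n \<Longrightarrow> y \<in> X n \<Longrightarrow> finite (V y) \<and> V y \<noteq> {}"
    and ch: "\<And>n. 1 \<le> n \<Longrightarrow> bij_betw (\<lambda>(y, v). ch y v) (SIGMA y:X n. V y) (X (Suc n))"
    and st: "\<And>n y v. 1 \<le> n \<Longrightarrow> y \<in> X n \<Longrightarrow> v \<in> V y \<Longrightarrow> card (V (ch y v)) = Suc (card {a \<in> V y. a \<le> v})"
    and wt: "\<And>n y v. 1 \<le> n \<Longrightarrow> y \<in> X n \<Longrightarrow> v \<in> V y \<Longrightarrow>
      wt (ch y v) = (if v = Max (V y) then Suc (wt y) else wt y)"
    and n: "1 \<le> n"
  shows "finite (X n) \<and> (\<forall>k. int (card {x \<in> X n. wt x = k}) = narayana n k)"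
proof -
  define rk where "rk y v = card {a \<in> V y. a \<le> v}" for y v
  define lab where "lab y = card (V y) - 1" for y
  \<comment> \<open>The recursion preserves only the joint distribution of label and weight, so both
    are carried through the induction.\<close>
  have main: "finite (X n) \<and> (\<forall>x\<in>X n. lab x \<in> {1..n}) \<and>
      (\<forall>s k. 1 \<le> s \<longrightarrow> int (card {x \<in> X n. lab x = s \<and> wt x = k}) = ballot n s k)"
    using n
  proof (induction n rule: dec_induct)
    case base
    have "{x \<in> X 1. lab x = s \<and> wt x = k} = (if s = 1 \<and> k = 1 then {r} else {})" for s k
      using X1 by (auto simp: lab_def)
    moreover have "ballot 1 s k = (if s = 1 \<and> k = 1 then 1 else 0)" if "1 \<le> s" for s k
      using that by (auto simp: ballot_def binomial_eq_0)
    ultimately show ?case using X1 by (auto simp: lab_def)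
  next
    case (step n)
    note V = V[OF step.hyps(1)] and bij = ch[OF step.hyps(1)]
    have fin: "finite (X n)" and labn: "\<And>x. x \<in> X n \<Longrightarrow> 1 \<le> lab x \<and> lab x \<le> n"
      and IH: "\<And>s k. 1 \<le> s \<Longrightarrow> int (card {x \<in> X n. lab x = s \<and> wt x = k}) = ballot n s k"
      using step.IH by auto
    have finX: "finite (X (Suc n))" using bij_betw_finite[OF bij] fin V by auto
    have img: "\<exists>y v. y \<in> X n \<and> v \<in> V y \<and> x = ch y v" if "x \<in> X (Suc n)" for x
    proof -
      have "x \<in> (\<lambda>(y, v). ch y v) ` (SIGMA y:X n. V y)" using bij that unfolding bij_betw_def by blast
      then show ?thesis by auto
    qed
    have card_V: "card (V y) = Suc (lab y)" if "y \<in> X n" for y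
      using V[OF that] by (auto simp: lab_def card_gt_0_iff)
    have rk: "bij_betw (rk y) (V y) {1..Suc (lab y)}" if "y \<in> X n" for y
      using bij_betw_rank[of "V y"] V[OF that] unfolding rk_def card_V[OF that] by blast
    have lab_ch: "lab (ch y v) = rk y v" if "y \<in> X n" "v \<in> V y" for y v
      using st[OF step.hyps(1) that] by (simp add: lab_def rk_def)
    have wt_ch: "wt (ch y v) = (if rk y v = Suc (lab y) then Suc (wt y) else wt y)" if "y \<in> X n" "v \<in> V y" for y v
    proof -
      have "rk y (Max (V y)) = Suc (lab y)"
        using V[OF that(1)] unfolding rk_def card_V[OF that(1), symmetric] by (intro arg_cong[of _ _ card]) auto
      then have "v = Max (V y) \<longleftrightarrow> rk y v = Suc (lab y)"
        using V[OF that(1)] bij_betw_imp_inj_on[OF rk[OF that(1)]] that(2) by (metis Max_in inj_onD)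
      then show ?thesis using wt[OF step.hyps(1) that] by simp
    qed
    have "int (card {x \<in> X (Suc n). lab x = s \<and> wt x = k}) = ballot (Suc n) s k" (is "int (card ?L) = _")
      if s: "1 \<le> s" for s k
    proof -
      \<comment> \<open>The parents of objects with label \<open>s\<close>: in \<open>?A\<close>
        rank \<open>s\<close> belongs to the last site, so the weight has just grown; in
        \<open>?B\<close> it belongs to an earlier one.\<close>
      let ?A = "{y \<in> X n. lab y = s - 1 \<and> Suc (wt y) = k}"
      let ?B = "\<Union>t\<in>{s..n}. {y \<in> X n. lab y = t \<and> wt y = k}"
      \<comment> \<open>Ranks are a bijection on the sites, so each of these parents has exactly one
        child of label \<open>s\<close>.\<close>
      define iv where "iv y = inv_into (V y) (rk y) s" for y
      have iv: "iv y \<in> V y" "rk y (iv y) = s" if "y \<in> ?A \<union> ?B" for y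
      proof -
        have "s \<in> rk y ` V y" using that s rk[of y] by (auto simp: bij_betw_def)
        then show "iv y \<in> V y" "rk y (iv y) = s" unfolding iv_def by (rule inv_into_into f_inv_into_f)+
      qed
      have "?L = (\<lambda>y. ch y (iv y)) ` (?A \<union> ?B)"
      proof (intro equalityI subsetI)
        fix x assume x: "x \<in> ?L"
        then obtain y v where y: "y \<in> X n" "v \<in> V y" "x = ch y v" using img by blast
        then have r: "rk y v = s" "wt x = (if s = Suc (lab y) then Suc (wt y) else wt y)"
          using lab_ch[OF y(1,2)] wt_ch[OF y(1,2)] x by auto
        have "s \<le> Suc (lab y)" using r(1) y(2) bij_betwE[OF rk[OF y(1)]] by auto
        then have "y \<in> ?A \<union> ?B" using r(2) x y(1) labn[OF y(1)] by (cases "s = Suc (lab y)") auto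
        moreover have "v = iv y"
          unfolding iv_def r(1)[symmetric] by (rule inv_into_f_f[OF bij_betw_imp_inj_on[OF rk[OF y(1)]] y(2), symmetric])
        ultimately show "x \<in> (\<lambda>y. ch y (iv y)) ` (?A \<union> ?B)" using y(3) by blast
      next
        fix x assume "x \<in> (\<lambda>y. ch y (iv y)) ` (?A \<union> ?B)"
        then obtain y where y: "x = ch y (iv y)" "y \<in> ?A \<union> ?B" by blast
        then have y': "y \<in> X n" "iv y \<in> V y" "rk y (iv y) = s" using iv by auto
        then have "x \<in> X (Suc n)" using bij_betwE[OF bij] y(1) by auto
        then show "x \<in> ?L" using lab_ch[OF y'(1,2)] wt_ch[OF y'(1,2)] y y'(3) s by auto
      qed
      moreover have "inj_on (\<lambda>y. ch y (iv y)) (?A \<union> ?B)"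
      proof (rule inj_onI)
        fix y z assume yz: "y \<in> ?A \<union> ?B" "z \<in> ?A \<union> ?B" "ch y (iv y) = ch z (iv z)"
        then have "(y, iv y) \<in> (SIGMA y:X n. V y)" "(z, iv z) \<in> (SIGMA y:X n. V y)" using iv by auto
        then show "y = z" using inj_onD[OF bij_betw_imp_inj_on[OF bij]] yz(3) by fastforce
      qed
      ultimately have "card ?L = card (?A \<union> ?B)" by (simp add: card_image)
      also have "\<dots> = card ?A + card ?B" using fin s by (intro card_Un_disjoint) auto
      also have "card ?B = (\<Sum>t = s..n. card {y \<in> X n. lab y = t \<and> wt y = k})"
        using fin by (intro card_UN_disjoint) auto
      finally have "int (card ?L) = int (card ?A) + (\<Sum>t = s..n. int (card {y \<in> X n. lab y = t \<and> wt y = k}))"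
        by simp
      moreover have "(\<Sum>t = s..n. int (card {y \<in> X n. lab y = t \<and> wt y = k})) = (\<Sum>t = s..n. ballot n t k)"
        using s by (intro sum.cong) (auto simp: IH)
      moreover have "int (card ?A) = (if 1 \<le> k then ballot n (s - 1) (k - 1) else 0)"
      proof (cases "1 \<le> k \<and> 2 \<le> s")
        case True
        then have "?A = {y \<in> X n. lab y = s - 1 \<and> wt y = k - 1}" by auto
        then show ?thesis using True IH[of "s - 1" "k - 1"] by auto
      next
        case False
        have A: "?A = {}" using False s labn by fastforce
        have "s = 1" if "k \<ge> 1" using False s that by auto
        then show ?thesis unfolding A by auto
      qed
      ultimately show ?thesis using ballot_rec_sum[OF step.hyps(1) s] by simp
    qed
    moreover have "lab x \<in> {1..Suc n}" if x: "x \<in> X (Suc n)" for x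
    proof -
      obtain y v where y: "y \<in> X n" "v \<in> V y" "x = ch y v" using img[OF x] by blast
      then show ?thesis using lab_ch[OF y(1,2)] bij_betwE[OF rk[OF y(1)]] labn[OF y(1)] by fastforce
    qed
    ultimately show ?case using finX by auto
  qed
  show ?thesis
  proof (intro conjI allI)
    show fin: "finite (X n)" using main by simp
    fix k
    have "{x \<in> X n. wt x = k} = (\<Union>s\<in>{1..n}. {x \<in> X n. lab x = s \<and> wt x = k})" using main by auto
    then have "card {x \<in> X n. wt x = k} = (\<Sum>s = 1..n. card {x \<in> X n. lab x = s \<and> wt x = k})"
      using fin by (simp only:) (intro card_UN_disjoint, auto)
    then have "int (card {x \<in> X n. wt x = k}) = (\<Sum>s = 1..n. ballot n s k)" using main by simp
    then show "int (card {x \<in> X n. wt x = k}) = narayana n k"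
      using ballot_sum[OF n] ballot_1_narayana[OF n] by simp
  qed
qed

section \<open>Ascent sequences avoiding 101\<close>

definition rgf :: "nat list \<Rightarrow> bool" where
  "rgf w \<longleftrightarrow> (\<forall>i < length w. {..<w ! i} \<subseteq> set (take i w))"

definition avoids_101 :: "nat list \<Rightarrow> bool" where
  "avoids_101 w \<longleftrightarrow> (\<forall>k < length w. \<forall>j < k. \<forall>i < j. w ! i = w ! k \<longrightarrow> w ! k \<le> w ! j)"

definition rgf_101 :: "nat \<Rightarrow> nat list set" where
  "rgf_101 n = {w. length w = n \<and> rgf w \<and> avoids_101 w}"

definition reusable :: "nat list \<Rightarrow> nat set" where
  "reusable w = {v \<in> set w. \<forall>j < length w. \<forall>i < j. w ! i = v \<longrightarrow> v \<le> w ! j}"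

lemma rgf_snoc: "rgf (y @ [v]) \<longleftrightarrow> rgf y \<and> {..<v} \<subseteq> set y"
  by (auto simp: rgf_def nth_append less_Suc_eq)

lemma avoids_101_snoc:
  "avoids_101 (y @ [v]) \<longleftrightarrow> avoids_101 y \<and> (v \<in> set y \<longrightarrow> v \<in> reusable y)"
proof -
  have "avoids_101 (y @ [v]) \<longleftrightarrow> avoids_101 y \<and> (\<forall>j < length y. \<forall>i < j. y ! i = v \<longrightarrow> v \<le> y ! j)"
    by (simp add: avoids_101_def nth_append All_less_Suc) blast
  moreover have "y ! i \<noteq> v" if "v \<notin> set y" "i < j" "j < length y" for i j
    using that nth_mem[of i y] by auto
  ultimately show ?thesis unfolding reusable_def by blast
qed

text \<open>A new last letter \<open>v\<close> is a smaller letter behind every occurrence of a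
  larger one, so precisely the letters above \<open>v\<close> are lost.\<close>

lemma reusable_snoc:
  assumes "v \<in> set y \<longrightarrow> v \<in> reusable y"
  shows "reusable (y @ [v]) = {a \<in> reusable y. a \<le> v} \<union> {v}"
proof -
  have v: "\<forall>j < length y. \<forall>i < j. y ! i = v \<longrightarrow> v \<le> y ! j"
  proof (cases "v \<in> set y")
    case True
    then show ?thesis using assms by (simp add: reusable_def)
  next
    case False
    then show ?thesis using nth_mem[of _ y] by (metis less_trans)
  qed
  have "a \<in> reusable (y @ [v]) \<longleftrightarrow> a = v \<or> a \<in> reusable y \<and> a \<le> v" for a
  proof (cases "a = v")
    case True
    then show ?thesis using v by (simp add: reusable_def nth_append All_less_Suc)
  next
    case False
    then have "(\<forall>i < length y. y ! i = a \<longrightarrow> a \<le> v) \<longleftrightarrow> a \<le> v" if "a \<in> set y"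
      using that by (auto simp: in_set_conv_nth)
    then show ?thesis using False by (auto simp: reusable_def nth_append All_less_Suc)
  qed
  then show ?thesis by blast
qed

lemma reusable_subset: "reusable w \<subseteq> set w" by (auto simp: reusable_def)

lemma lessThan_card_eq:
  fixes A :: "nat set"
  assumes "finite A" "\<And>a b. a \<in> A \<Longrightarrow> b < a \<Longrightarrow> b \<in> A"
  shows "A = {..<card A}"
proof (cases "A = {}")
  case False
  have "A = {..Max A}"
  proof (intro equalityI subsetI)
    fix b assume "b \<in> {..Max A}"
    then show "b \<in> A" using assms(2)[OF Max_in[OF assms(1) False], of b] Max_in[OF assms(1) False]
      by (cases "b = Max A") auto
  qed (use assms(1) in auto)
  then have "A = {..<Suc (Max A)}" by (simp add: lessThan_Suc_atMost)
  then show ?thesis by (metis card_lessThan)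
qed simp

lemma rgf_set: "rgf w \<Longrightarrow> set w = {..<card (set w)}"
proof (rule lessThan_card_eq)
  fix a b assume "rgf w" "a \<in> set w" "b < a"
  then show "b \<in> set w" unfolding rgf_def
    by (metis in_set_conv_nth in_set_takeD lessThan_iff subsetD)
qed simp

lemma rgf_101_snoc_iff:
  "y @ [v] \<in> rgf_101 (Suc n) \<longleftrightarrow> y \<in> rgf_101 n \<and> v \<in> insert (card (set y)) (reusable y)"
proof -
  have "{..<v} \<subseteq> set y \<and> (v \<in> set y \<longrightarrow> v \<in> reusable y) \<longleftrightarrow> v \<in> insert (card (set y)) (reusable y)"
    if "rgf y"
  proof -
    have s: "set y = {..<card (set y)}" by (rule rgf_set[OF that])
    have "{..<v} \<subseteq> set y \<longleftrightarrow> v \<le> card (set y)" by (subst s) auto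
    moreover have "v \<in> set y \<longleftrightarrow> v < card (set y)" by (subst s) auto
    ultimately show ?thesis using reusable_subset[of y] by auto
  qed
  then show ?thesis by (auto simp: rgf_101_def rgf_snoc avoids_101_snoc)
qed

lemma rgf_101_card:
  assumes "1 \<le> n"
  shows "finite (rgf_101 n) \<and> (\<forall>k. int (card {w \<in> rgf_101 n. card (set w) = k}) = narayana n k)"
proof (rule catalan_tree[where X = rgf_101 and V = "\<lambda>y. insert (card (set y)) (reusable y)"
      and ch = "\<lambda>y v. y @ [v]" and r = "[0]"])
  have "x \<in> rgf_101 0 \<longleftrightarrow> x = []" for x by (auto simp: rgf_101_def rgf_def avoids_101_def)
  moreover have "x \<in> rgf_101 (Suc 0) \<longleftrightarrow> x = [0]" for x
  proof (cases x rule: rev_cases)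
    case (snoc y v)
    then show ?thesis using rgf_101_snoc_iff[of y v 0] calculation[of y] by (auto simp: reusable_def)
  qed (auto simp: rgf_101_def)
  ultimately show "rgf_101 1 = {[0]}" by auto
  have "reusable [0] = {0}" by (auto simp: reusable_def)
  then show "card (insert (card (set [0])) (reusable [0])) = 2" by simp
next
  fix n y assume "1 \<le> n" "y \<in> rgf_101 n"
  show "finite (insert (card (set y)) (reusable y)) \<and> insert (card (set y)) (reusable y) \<noteq> {}"
    using finite_subset[OF reusable_subset] by auto
next
  fix n :: nat
  let ?S = "SIGMA y:rgf_101 n. insert (card (set y)) (reusable y)"
  have "x \<in> (\<lambda>(y, v). y @ [v]) ` ?S \<longleftrightarrow> x \<in> rgf_101 (Suc n)" for x
  proof (cases x rule: rev_cases)
    case (snoc y v)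
    have "x \<in> (\<lambda>(y, v). y @ [v]) ` ?S \<longleftrightarrow> (y, v) \<in> ?S" unfolding snoc by auto
    also have "\<dots> \<longleftrightarrow> x \<in> rgf_101 (Suc n)" unfolding snoc rgf_101_snoc_iff by simp
    finally show ?thesis .
  qed (auto simp: rgf_101_def)
  then have "(\<lambda>(y, v). y @ [v]) ` ?S = rgf_101 (Suc n)" by (rule set_eqI)
  then show "bij_betw (\<lambda>(y, v). y @ [v]) ?S (rgf_101 (Suc n))"
    by (simp add: bij_betw_def inj_on_def)
next
  fix n y v assume "y \<in> rgf_101 n" and v: "v \<in> insert (card (set y)) (reusable y)"
  then have "rgf y" by (simp add: rgf_101_def)
  then have s: "set y = {..<card (set y)}" by (rule rgf_set)
  then have lt: "a < card (set y)" if "a \<in> reusable y" for a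
    using reusable_subset that by blast
  have fin: "finite (reusable y)" using finite_subset[OF reusable_subset] by auto
  define m where "m = card (set y)"
  have sm: "set y = {..<m}" unfolding m_def by (rule s)
  have rv: "v \<in> set y \<longrightarrow> v \<in> reusable y" using v sm unfolding m_def[symmetric] by auto
  show "card (insert (card (set (y @ [v]))) (reusable (y @ [v])))
    = Suc (card {a \<in> insert (card (set y)) (reusable y). a \<le> v})"
  proof (cases "v = m")
    case True
    then have e: "{a \<in> reusable y. a \<le> v} = reusable y" using lt m_def by (auto intro: less_imp_le)
    have "insert (card (set (y @ [v]))) (reusable (y @ [v])) = insert (Suc m) (insert m (reusable y))"
      unfolding reusable_snoc[OF rv] e using True sm by (auto simp: card_insert_if)
    moreover have "{a \<in> insert (card (set y)) (reusable y). a \<le> v} = insert m (reusable y)"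
      using e True m_def by auto
    moreover have "m \<notin> reusable y" "Suc m \<notin> reusable y" using lt[of m] lt[of "Suc m"] m_def by auto
    ultimately show ?thesis using fin by (simp add: card_insert_if)
  next
    case False
    then have v': "v \<in> reusable y" using v m_def by simp
    then have "v < m" using lt m_def by simp
    then have "insert (card (set (y @ [v]))) (reusable (y @ [v])) = insert m {a \<in> reusable y. a \<le> v}"
      unfolding reusable_snoc[OF rv] using sm v' by (auto simp: insert_absorb)
    moreover have "{a \<in> insert (card (set y)) (reusable y). a \<le> v} = {a \<in> reusable y. a \<le> v}"
      using \<open>v < m\<close> m_def by auto
    ultimately show ?thesis using fin lt m_def by (auto simp: card_insert_if)
  qed
  have "Max (insert m (reusable y)) = m" using fin lt m_def
    by (intro Max_eqI) (auto intro: less_imp_le)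
  moreover have "v < m" if "v \<noteq> m" using that v lt m_def by auto
  ultimately show "card (set (y @ [v])) = (if v = Max (insert (card (set y)) (reusable y)) then Suc (card (set y)) else card (set y))"
    using sm unfolding m_def[symmetric] by (auto simp: insert_absorb)
qed (use assms in auto)

text \<open>A repeated letter cannot exceed its predecessor: an earlier occurrence, the predecessor
  and the repetition would form 101. So the ascents are exactly the appearances of new letters after
  the first one, and in a restricted growth function a new letter is a left-to-right
  maximum.\<close>

lemma rgf_101_lmax_asc:
  assumes "w \<in> rgf_101 n"
  shows "lmax w = card (set w) \<and> (w \<noteq> [] \<longrightarrow> Suc (asc w) = card (set w))"
  using assms
proof (induction w arbitrary: n rule: rev_induct)
  case Nil
  then show ?case by (simp add: lmax_def)
next
  case (snoc v y)
  then obtain m where "n = Suc m" by (cases n) (auto simp: rgf_101_def)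
  then have y: "y \<in> rgf_101 m" and v: "v \<in> insert (card (set y)) (reusable y)"
    using snoc rgf_101_snoc_iff by auto
  note IH = snoc.IH[OF y]
  have "rgf y" using y by (simp add: rgf_101_def)
  note s = rgf_set[OF this]
  let ?N = "\<forall>j<length y. y ! j < v"
  have l: "lmax (y @ [v]) = (if ?N then Suc (lmax y) else lmax y)"
  proof -
    have "{i. i < length (y @ [v]) \<and> (\<forall>j < i. (y @ [v]) ! i > (y @ [v]) ! j)}
      = {i. i < length y \<and> (\<forall>j < i. y ! i > y ! j)} \<union> (if ?N then {length y} else {})"
      by (auto simp: nth_append less_Suc_eq split: if_splits)
    then show ?thesis unfolding lmax_def by (auto simp: card_insert_if)
  qed
  have a: "asc (y @ [v]) = (if last y < v then Suc (asc y) else asc y)" if "y \<noteq> []"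
  proof -
    have "{i. i + 1 < length (y @ [v]) \<and> (y @ [v]) ! i < (y @ [v]) ! (i + 1)}
      = {i. i + 1 < length y \<and> y ! i < y ! (i + 1)} \<union> (if last y < v then {length y - 1} else {})"
    proof (rule set_eqI)
      fix i
      have "length y \<noteq> 0" using that by simp
      then consider "i + 1 < length y" | "i + 1 = length y" | "length y \<le> i" by linarith
      then show "i \<in> {i. i + 1 < length (y @ [v]) \<and> (y @ [v]) ! i < (y @ [v]) ! (i + 1)} \<longleftrightarrow>
        i \<in> {i. i + 1 < length y \<and> y ! i < y ! (i + 1)} \<union> (if last y < v then {length y - 1} else {})"
      proof cases
        case 1 then show ?thesis by (auto simp: nth_append)
      next
        case 2
        then have "i = length y - 1" by simp
        then show ?thesis using 2 that by (simp add: nth_append last_conv_nth)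
      next
        case 3
        then have "i \<noteq> length y - 1" using \<open>length y \<noteq> 0\<close> by linarith
        with 3 show ?thesis by (auto split: if_splits)
      qed
    qed
    moreover have "finite {i. i + 1 < length y \<and> y ! i < y ! (i + 1)}"
      by (rule finite_subset[of _ "{..<length y}"]) auto
    ultimately show ?thesis unfolding asc_def using that by (auto simp: card_insert_if)
  qed
  have "asc [v] = 0" by (simp add: asc_def)
  show ?case
  proof (cases "v = card (set y)")
    case True
    then have "\<forall>x\<in>set y. x < v" using s by blast
    moreover have "v \<notin> set y" using True s by blast
    ultimately show ?thesis using IH l a \<open>asc [v] = 0\<close> by (cases "y = []") (auto simp: card_insert_if)
  next
    case False
    then have r: "v \<in> reusable y" using v by simp
    then have vy: "v \<in> set y" using reusable_subset by blast
    then have "y \<noteq> []" by auto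
    obtain i where i: "i < length y" "y ! i = v" using vy in_set_conv_nth by metis
    have "v \<le> last y"
    proof (cases "i = length y - 1")
      case True then show ?thesis using i \<open>y \<noteq> []\<close> by (simp add: last_conv_nth)
    next
      case False
      then have "i < length y - 1" "length y - 1 < length y" using i by auto
      then show ?thesis using r i \<open>y \<noteq> []\<close> unfolding reusable_def by (auto simp: last_conv_nth)
    qed
    moreover have "\<not> ?N" using i by auto
    ultimately show ?thesis using IH l a \<open>y \<noteq> []\<close> vy by (auto simp: insert_absorb)
  qed
qed

section \<open>Comparison with ascent sequences\<close>

lemma ascent_sequences_snoc:
  assumes "1 \<le> n"
  shows "y @ [v] \<in> ascent_sequences (Suc n) \<longleftrightarrow> y \<in> ascent_sequences n \<and> v \<le> Suc (asc y)"
  using assms by (auto simp: ascent_sequences_def nth_append less_Suc_eq split: if_splits)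

text \<open>Along the induction the prefix is a restricted growth function without 101, so the bound
  \<open>1 + asc\<close> equals the number of letters used so far and the two growth rules admit the
  same next letters.\<close>

lemma ascent_sequences_avoiding_101_eq:
  assumes "1 \<le> n"
  shows "ascent_sequences_avoiding_101 n = rgf_101 n"
proof -
  have e: "ascent_sequences_avoiding_101 n = {w \<in> ascent_sequences n. avoids_101 w}" for n
    unfolding ascent_sequences_avoiding_101_def avoids_101_def ascent_sequences_def
    by (auto simp: not_less[symmetric])
  have "w \<in> ascent_sequences n \<and> avoids_101 w \<longleftrightarrow> w \<in> rgf_101 n" for w
    using assms
  proof (induction n arbitrary: w rule: dec_induct)
    case base
    have a: "x \<in> rgf_101 (Suc 0) \<longleftrightarrow> x = [0]" for x
      by (cases x) (auto simp: rgf_101_def rgf_def avoids_101_def)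
    have b: "x \<in> ascent_sequences (Suc 0) \<longleftrightarrow> x = [0]" for x
      by (cases x) (auto simp: ascent_sequences_def)
    have "avoids_101 [0]" by (simp add: avoids_101_def)
    then show ?case unfolding One_nat_def a b by blast
  next
    case (step n)
    show ?case
    proof (cases w rule: rev_cases)
      case Nil
      then show ?thesis by (simp add: ascent_sequences_def rgf_101_def)
    next
      case (snoc y v)
      have *: "v \<le> Suc (asc y) \<and> (v \<in> set y \<longrightarrow> v \<in> reusable y) \<longleftrightarrow> v \<in> insert (card (set y)) (reusable y)"
        if y: "y \<in> rgf_101 n"
      proof -
        have "y \<noteq> []" using y step by (auto simp: rgf_101_def)
        then have a: "Suc (asc y) = card (set y)" using rgf_101_lmax_asc[OF y] by simp
        have s: "set y = {..<card (set y)}" using y rgf_set by (simp add: rgf_101_def)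
        have iff: "x \<in> set y \<longleftrightarrow> x < card (set y)" for x by (subst s) auto
        then have "v \<le> Suc (asc y) \<longleftrightarrow> v = card (set y) \<or> v \<in> set y" using a iff[of v] by linarith
        moreover have "card (set y) \<notin> set y" by (simp only: iff less_irrefl not_False_eq_True)
        ultimately show ?thesis using reusable_subset[of y] by blast
      qed
      show ?thesis unfolding snoc rgf_101_snoc_iff ascent_sequences_snoc[OF step.hyps(1)] avoids_101_snoc
        using * step.IH[of y] by blast
    qed
  qed
  then show ?thesis unfolding e by auto
qed

lemma ascent_narayana:
  assumes "1 \<le> n"
  shows "(\<Sum>w\<in>ascent_sequences_avoiding_101 n. monom 1 (lmax w)) = narayana_poly n"
proof -
  have "(\<Sum>w\<in>rgf_101 n. monom 1 (lmax w)) = (\<Sum>w\<in>rgf_101 n. monom (1 :: rat) (card (set w)))"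
    using rgf_101_lmax_asc by (intro sum.cong) auto
  also have "\<dots> = narayana_poly n"
    using rgf_101_card[OF assms] by (intro sum_monom_eq_narayana_poly[OF assms]) auto
  finally show ?thesis unfolding ascent_sequences_avoiding_101_eq[OF assms] .
qed

section \<open>Fishburn permutations avoiding 3142\<close>

definition contains_231 :: "nat list \<Rightarrow> bool" where
  "contains_231 w \<longleftrightarrow> (\<exists>a b c. a < b \<and> b < c \<and> subseq [b, c, a] w)"

definition perms_231 :: "nat \<Rightarrow> nat list set" where
  "perms_231 n = {w \<in> permutations_of_set {1..n}. \<not> contains_231 w}"

text \<open>The admissible places for a new maximum. It would act as the 3 of a 231 as soon as some
  entry before it exceeded some entry after it.\<close>

definition sites :: "nat list \<Rightarrow> nat set" where
  "sites y = {p. p \<le> length y \<and> (\<forall>a \<in> set (take p y). \<forall>b \<in> set (drop p y). a < b)}"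

lemma subseq_imp_set_subset: "subseq xs ys \<Longrightarrow> set xs \<subseteq> set ys"
  by (auto elim: list_emb_set)

text \<open>In an occurrence of 231 that uses the maximum \<open>N\<close>, this entry can only be
  the 3, so the 2 and the 1 lie on its two sides.\<close>

lemma contains_231_insert_max:
  assumes "\<forall>a\<in>set (xs @ ys). a < N"
  shows "contains_231 (xs @ N # ys) \<longleftrightarrow> contains_231 (xs @ ys) \<or> (\<exists>b\<in>set xs. \<exists>a\<in>set ys. a < b)"
proof
  assume "contains_231 (xs @ N # ys)"
  then obtain a b c where abc: "a < b" "b < c" and s: "subseq [b, c, a] (xs @ N # ys)"
    unfolding contains_231_def by blast
  have mem: "set [b, c, a] \<subseteq> set (xs @ N # ys)" using s by (rule subseq_imp_set_subset)
  have N: "N \<notin> set xs" "N \<notin> set ys" using assms by auto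
  have f: "filter (\<lambda>x. x \<noteq> N) (xs @ N # ys) = xs @ ys"
  proof -
    have "filter (\<lambda>x. x \<noteq> N) xs = xs" "filter (\<lambda>x. x \<noteq> N) ys = ys"
      using N by (auto simp: filter_id_conv)
    then show ?thesis by simp
  qed
  show "contains_231 (xs @ ys) \<or> (\<exists>b\<in>set xs. \<exists>a\<in>set ys. a < b)"
  proof (cases "c = N")
    case False
    have "c < N" using mem assms False by auto
    then have "filter (\<lambda>x. x \<noteq> N) [b, c, a] = [b, c, a]" using abc by simp
    then have "subseq [b, c, a] (xs @ ys)" using subseq_filter[OF s, of "\<lambda>x. x \<noteq> N"] f by simp
    then show ?thesis using abc unfolding contains_231_def by blast
  next
    case True
    \<comment> \<open>Since \<open>N\<close> is absent from \<open>xs\<close>, this division of the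
      occurrence falls before \<open>N\<close>.\<close>
    obtain us vs where uv: "[b, N, a] = us @ vs" "subseq us xs" "subseq vs (N # ys)"
      using s True by (auto elim: subseq_appendE)
    have "N \<notin> set us" using subseq_imp_set_subset[OF uv(2)] N by auto
    then consider "us = []" "vs = [b, N, a]" | "us = [b]" "vs = [N, a]"
      using uv(1) by (cases us; cases "tl us") auto
    then show ?thesis
    proof cases
      case 1
      then have "subseq [N, a] ys" using uv(3) abc True by (auto split: if_splits dest: subseq_Cons')
      then show ?thesis using N subseq_imp_set_subset by fastforce
    next
      case 2
      then have "subseq [a] ys" "subseq [b] xs" using uv by auto
      then show ?thesis using abc by (auto simp: subseq_singleton_left)
    qed
  qed
next
  assume "contains_231 (xs @ ys) \<or> (\<exists>b\<in>set xs. \<exists>a\<in>set ys. a < b)"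
  then show "contains_231 (xs @ N # ys)"
  proof
    assume "contains_231 (xs @ ys)"
    moreover have "subseq (xs @ ys) (xs @ N # ys)" by (intro list_emb_append_mono) auto
    ultimately show ?thesis unfolding contains_231_def using subseq_order.trans by blast
  next
    assume "\<exists>b\<in>set xs. \<exists>a\<in>set ys. a < b"
    then obtain a b where "b \<in> set xs" "a \<in> set ys" "a < b" by blast
    moreover have "subseq ([b] @ [N, a]) (xs @ N # ys)"
      using calculation by (intro list_emb_append_mono) (auto simp: subseq_singleton_left)
    ultimately show ?thesis unfolding contains_231_def by (metis Un_iff append_Cons append_Nil assms set_append)
  qed
qed

lemma rmin_Cons: "rmin (x # xs) = (if \<forall>y\<in>set xs. x < y then Suc (rmin xs) else rmin xs)"
proof -
  let ?P = "\<lambda>w i. i < length w \<and> (\<forall>j. i < j \<and> j < length w \<longrightarrow> w ! i < w ! j)"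
  have S: "?P (x # xs) (Suc i) = ?P xs i" for i
  proof -
    have "(\<forall>j. Suc i < j \<and> j < length (x # xs) \<longrightarrow> (x # xs) ! Suc i < (x # xs) ! j) \<longleftrightarrow>
      (\<forall>j. i < j \<and> j < length xs \<longrightarrow> xs ! i < xs ! j)" (is "?L \<longleftrightarrow> ?R")
    proof
      assume L: ?L
      show ?R
      proof (intro allI impI)
        fix j assume "i < j \<and> j < length xs"
        then show "xs ! i < xs ! j" using L[rule_format, of "Suc j"] by simp
      qed
    next
      assume R: ?R
      show ?L
      proof (intro allI impI)
        fix j assume "Suc i < j \<and> j < length (x # xs)"
        then show "(x # xs) ! Suc i < (x # xs) ! j" using R[rule_format, of "j - 1"] by (cases j) auto
      qed
    qed
    then show ?thesis by simp
  qed
  have Z: "?P (x # xs) 0 \<longleftrightarrow> (\<forall>y\<in>set xs. x < y)"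
    by (auto simp: all_set_conv_all_nth nth_Cons split: nat.splits)
  have "{i. ?P (x # xs) i} = (if \<forall>y\<in>set xs. x < y then {0} else {}) \<union> Suc ` {i. ?P xs i}"
  proof (rule set_eqI)
    fix i show "i \<in> {i. ?P (x # xs) i} \<longleftrightarrow> i \<in> (if \<forall>y\<in>set xs. x < y then {0} else {}) \<union> Suc ` {i. ?P xs i}"
    proof (cases i)
      case 0 then show ?thesis using Z by auto
    next
      case (Suc j) then show ?thesis using S[of j] by auto
    qed
  qed
  moreover have "card (Suc ` {i. ?P xs i}) = rmin xs" unfolding rmin_def by (simp add: card_image)
  moreover have "finite (Suc ` {i. ?P xs i})" by simp
  ultimately show ?thesis unfolding rmin_def by (auto simp: card_insert_if)
qed

text \<open>A maximum never spoils another right-to-left minimum, and it is one itself only in the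
  last place.\<close>

lemma rmin_insert_max:
  "\<forall>a\<in>set (xs @ ys). a < N \<Longrightarrow> rmin (xs @ N # ys) = (if ys = [] then Suc (rmin xs) else rmin (xs @ ys))"
proof (induction xs)
  case Nil
  have "rmin [] = 0" by (simp add: rmin_def)
  with Nil show ?case by (cases ys) (auto simp: rmin_Cons)
next
  case (Cons x xs)
  then show ?case by (auto simp: rmin_Cons)
qed

text \<open>At a place up to \<open>p\<close> the new maximum stands on the right and restricts
  nothing. At a later place other than the end it stands on the left of the smaller last entry, so
  that place is lost.\<close>

lemma sites_insert_max:
  assumes "\<forall>a\<in>set y. a < N" "p \<le> length y"
  shows "sites (take p y @ N # drop p y) = insert (Suc (length y)) {q \<in> sites y. q \<le> p}"
proof (rule set_eqI)
  fix q
  let ?w = "take p y @ N # drop p y"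
  have len: "length ?w = Suc (length y)" using assms(2) by simp
  consider "q \<le> p" | "p < q" "q \<le> length y" | "q = Suc (length y)" | "q > Suc (length y)" by linarith
  then show "q \<in> sites ?w \<longleftrightarrow> q \<in> insert (Suc (length y)) {q \<in> sites y. q \<le> p}"
  proof cases
    case 1
    then have t: "take q ?w = take q y" using assms(2) by (simp add: min_def)
    have "set (drop q ?w) = insert N (set (drop q y))"
    proof -
      have "drop q y = drop q (take p y @ drop p y)" by simp
      also have "\<dots> = drop q (take p y) @ drop p y" using 1 assms(2) by (subst drop_append) simp
      finally show ?thesis using 1 assms(2) by (simp add: drop_append)
    qed
    moreover have "\<forall>a\<in>set (take q y). a < N" using assms(1) by (meson in_set_takeD)
    ultimately show ?thesis using 1 assms(2) t unfolding sites_def len by auto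
  next
    case 2
    then obtain r where r: "q - p = Suc r" by (metis Suc_diff_Suc)
    have "N \<in> set (take q ?w)" using 2 assms(2) r by simp
    moreover have "drop q y \<noteq> []" if "q < length y" using that by simp
    moreover have "last y \<in> set (drop q ?w)"
    proof -
      have "drop q ?w = drop r (drop p y)" using 2 assms(2) r by simp
      also have "\<dots> = drop (q - 1) y"
      proof -
        have "r + p = q - 1" using r 2 by simp
        then show ?thesis by (simp only: drop_drop)
      qed
      finally have e: "drop q ?w = drop (q - 1) y" .
      have "drop (q - 1) y \<noteq> []" using 2 by auto
      then show ?thesis unfolding e by (metis last_drop last_in_set length_drop length_greater_0_conv zero_less_diff)
    qed
    moreover have "last y < N" using assms(1) 2 by (cases y) auto
    ultimately have "q \<notin> sites ?w" unfolding sites_def by (blast dest: less_asym)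
    then show ?thesis using 2 by auto
  next
    case 3
    then show ?thesis unfolding sites_def using assms(2) by auto
  next
    case 4
    then show ?thesis unfolding sites_def using assms(2) by auto
  qed
qed

lemma perms_231_card:
  assumes "1 \<le> n"
  shows "finite (perms_231 n) \<and> (\<forall>k. int (card {w \<in> perms_231 n. rmin w = k}) = narayana n k)"
proof (rule catalan_tree[where X = perms_231 and V = sites
      and ch = "\<lambda>y p. take p y @ Suc (length y) # drop p y" and r = "[1]"])
  have "permutations_of_set {1::nat..1} = {[1]}" by (simp add: permutations_of_set_singleton)
  moreover have "\<not> contains_231 [1]" by (auto simp: contains_231_def)
  ultimately show "perms_231 1 = {[1]}" unfolding perms_231_def by auto
  have "sites [1] = {0, 1}" unfolding sites_def by (auto simp: le_Suc_eq)
  then show "card (sites [1]) = 2" by simp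
  show "rmin [1] = 1" by (simp add: rmin_def)
next
  fix n y
  show "finite (sites y) \<and> sites y \<noteq> {}"
    using finite_subset[of "sites y" "{..length y}"] by (auto simp: sites_def)
next
  fix n y v
  assume y: "y \<in> perms_231 n" and v: "v \<in> sites y"
  have le: "v \<le> length y" using v by (simp add: sites_def)
  have mx: "\<forall>a\<in>set y. a < Suc (length y)"
    using y by (auto simp: perms_231_def permutations_of_set_def distinct_card[symmetric])
  have fin: "finite (sites y)" using finite_subset[of "sites y" "{..length y}"] by (auto simp: sites_def)
  have "Suc (length y) \<notin> sites y" by (simp add: sites_def)
  then show "card (sites (take v y @ Suc (length y) # drop v y)) = Suc (card {a \<in> sites y. a \<le> v})"
    using fin sites_insert_max[OF mx le] by simp
  have "Max (sites y) = length y" using fin by (intro Max_eqI) (auto simp: sites_def)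
  then show "rmin (take v y @ Suc (length y) # drop v y) = (if v = Max (sites y) then Suc (rmin y) else rmin y)"
    using le mx rmin_insert_max[of "take v y" "drop v y" "Suc (length y)"] by auto
next
  fix n :: nat
  let ?S = "SIGMA y:perms_231 n. sites y" and ?f = "\<lambda>(y, p). take p y @ Suc (length y) # drop p y"
  have len: "length y = n" if "y \<in> perms_231 n" for y n
    using that by (auto simp: perms_231_def permutations_of_set_def distinct_card[symmetric])
  have inj: "inj_on ?f ?S"
  proof (rule inj_onI)
    fix z z' assume z: "z \<in> ?S" "z' \<in> ?S" "?f z = ?f z'"
    obtain y p y' p' where e: "z = (y, p)" "z' = (y', p')" by fastforce
    have y: "y \<in> perms_231 n" "y' \<in> perms_231 n" "p \<le> length y" "p' \<le> length y'"
      using z e by (auto simp: sites_def)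
    have N: "Suc n \<notin> set y" "Suc n \<notin> set y'"
      using y by (auto simp: perms_231_def permutations_of_set_def)
    have e': "take p y @ Suc n # drop p y = take p' y' @ Suc n # drop p' y'" using z(3) e y len by simp
    have "Suc n \<notin> set (take p y)" "Suc n \<notin> set (take p' y')" using N by (meson in_set_takeD)+
    then have "take p y = take p' y' \<and> drop p y = drop p' y'"
      using e' by (metis append_Cons_eq_iff N in_set_dropD)
    moreover have "p = p'" using y calculation by (metis length_take min.absorb2)
    ultimately have "y = y'" by (metis append_take_drop_id)
    then show "z = z'" using e \<open>p = p'\<close> by simp
  qed
  moreover have "?f ` ?S = perms_231 (Suc n)"
  proof (intro equalityI subsetI)
    fix x assume "x \<in> ?f ` ?S"
    then obtain y p where yp: "y \<in> perms_231 n" "p \<in> sites y" "x = take p y @ Suc n # drop p y" using len by auto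
    have y: "set y = {1..n}" "distinct y" "\<not> contains_231 y" using yp(1) by (auto simp: perms_231_def permutations_of_set_def)
    have "set x = insert (Suc n) (set (take p y @ drop p y))"
      unfolding yp(3) set_append list.set by blast
    then have "set x = {1..Suc n}" using y by auto
    moreover have "distinct x"
      using y distinct_append[of "take p y" "drop p y"] unfolding yp(3)
      by (auto dest: in_set_takeD in_set_dropD)
    moreover have "\<not> contains_231 x"
    proof -
      have "\<forall>a\<in>set (take p y @ drop p y). a < Suc n" using y by auto
      moreover have "\<forall>a\<in>set (take p y). \<forall>b\<in>set (drop p y). a < b" using yp(2) by (simp add: sites_def)
      then have "\<not> (\<exists>b\<in>set (take p y). \<exists>a\<in>set (drop p y). a < b)" by (blast dest: less_asym)
      ultimately show ?thesis
        using contains_231_insert_max[of "take p y" "drop p y" "Suc n"] y(3) unfolding yp(3) append_take_drop_id by blast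
    qed
    ultimately show "x \<in> perms_231 (Suc n)" by (simp add: perms_231_def permutations_of_set_def)
  next
    fix x assume "x \<in> perms_231 (Suc n)"
    then have x: "set x = {1..Suc n}" "distinct x" "\<not> contains_231 x"
      by (auto simp: perms_231_def permutations_of_set_def)
    then have "Suc n \<in> set x" by simp
    then obtain xs ys where s: "x = xs @ Suc n # ys" using split_list by metis
    have d: "distinct (xs @ ys)" "Suc n \<notin> set (xs @ ys)" using x(2) s by auto
    have "set (xs @ ys) = {1..Suc n} - {Suc n}" using x(1) d unfolding s by auto
    also have "{1..Suc n} - {Suc n} = {1..n}" by auto
    finally have st: "set (xs @ ys) = {1..n}" .
    then have "\<forall>a\<in>set (xs @ ys). a < Suc n" by auto
    from contains_231_insert_max[OF this] have c: "\<not> contains_231 (xs @ ys)" "\<forall>a\<in>set xs. \<forall>b\<in>set ys. a \<le> b"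
      using x(3) unfolding s by (auto simp: not_less)
    have "\<forall>a\<in>set xs. \<forall>b\<in>set ys. a < b" using c(2) d(1) by (auto simp: le_less)
    then have "length xs \<in> sites (xs @ ys)" by (simp add: sites_def)
    moreover have p: "xs @ ys \<in> perms_231 n" using st d c by (simp add: perms_231_def permutations_of_set_def)
    moreover have "?f (xs @ ys, length xs) = x" using len[OF p] s by simp
    ultimately show "x \<in> ?f ` ?S" by force
  qed
  ultimately show "bij_betw ?f ?S (perms_231 (Suc n))" by (simp add: bij_betw_def)
qed (use assms in auto)

section \<open>Fishburn permutations without 3142 and permutations without 231\<close>

lemma subseq_nth:
  assumes "subseq ys xs"
  shows "\<exists>f. (\<forall>i<length ys. f i < length xs \<and> xs ! f i = ys ! i) \<and> (\<forall>j<length ys. \<forall>i<j. f i < (f j :: nat))"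
  using assms
proof (induction rule: list_emb.induct)
  case (list_emb_Nil ys)
  then show ?case by simp
next
  case (list_emb_Cons ys xs x)
  then obtain f where "\<forall>i<length ys. f i < length xs \<and> xs ! f i = ys ! i" "\<forall>j<length ys. \<forall>i<j. f i < (f j :: nat)"
    by blast
  then show ?case by (intro exI[of _ "\<lambda>i. Suc (f i)"]) auto
next
  case (list_emb_Cons2 y x ys xs)
  then obtain f where f: "\<forall>i<length ys. f i < length xs \<and> xs ! f i = ys ! i" "\<forall>j<length ys. \<forall>i<j. f i < (f j :: nat)"
    by blast
  then show ?case using list_emb_Cons2
    by (intro exI[of _ "\<lambda>i. case i of 0 \<Rightarrow> 0 | Suc i \<Rightarrow> Suc (f i)"]) (auto simp: less_Suc_eq_0_disj)
qed

lemma nth_subseq: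
  assumes "sorted_wrt (<) is" "\<forall>i\<in>set is. i < length xs"
  shows "subseq (map ((!) xs) is) xs"
proof -
  have "is = filter (\<lambda>i. i \<in> set is) [0..<length xs]"
    by (rule sorted_distinct_set_unique) (use assms in \<open>auto simp: strict_sorted_iff sorted_wrt_filter\<close>)
  then have "subseq is [0..<length xs]" by (metis subseq_filter_left)
  then show ?thesis using subseq_map[of "is" "[0..<length xs]" "(!) xs"] by (simp add: map_nth)
qed

lemma contains_231_nth:
  "contains_231 w \<longleftrightarrow> (\<exists>i j k. i < j \<and> j < k \<and> k < length w \<and> w ! k < w ! i \<and> w ! i < w ! j)"
proof
  assume "contains_231 w"
  then obtain a b c where abc: "a < b" "b < c" "subseq [b, c, a] w" by (auto simp: contains_231_def)
  obtain f where f: "\<forall>i<length [b, c, a]. f i < length w \<and> w ! f i = [b, c, a] ! i"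
    "\<forall>j<length [b, c, a]. \<forall>i<j. f i < (f j :: nat)"
    using subseq_nth[OF abc(3)] by blast
  have "w ! f 0 = b" "w ! f 1 = c" "w ! f 2 = a" "f 2 < length w" using f(1) by auto
  moreover have "f 0 < f 1" "f 1 < f 2" using f(2) by auto
  ultimately show "\<exists>i j k. i < j \<and> j < k \<and> k < length w \<and> w ! k < w ! i \<and> w ! i < w ! j"
    using abc by blast
next
  assume "\<exists>i j k. i < j \<and> j < k \<and> k < length w \<and> w ! k < w ! i \<and> w ! i < w ! j"
  then obtain i j k where "i < j" "j < k" "k < length w" "w ! k < w ! i" "w ! i < w ! j" by blast
  then show "contains_231 w" using nth_subseq[of "[i, j, k]" w] by (auto simp: contains_231_def)
qed

lemma contains_3142_nth:
  "contains_pattern w [3, 1, 4, 2] \<longleftrightarrow>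
    (\<exists>a b c d. a < b \<and> b < c \<and> c < d \<and> d < length w \<and> w ! b < w ! d \<and> w ! d < w ! a \<and> w ! a < w ! c)"
proof
  assume "contains_pattern w [3, 1, 4, 2]"
  then obtain ys where ys: "subseq ys w" "length ys = 4"
    "\<And>i j. i < 4 \<Longrightarrow> j < 4 \<Longrightarrow> ys ! i < ys ! j \<longleftrightarrow> [3, 1, 4, 2::nat] ! i < [3, 1, 4, 2] ! j"
    unfolding contains_pattern_def by auto
  obtain f where f: "\<forall>i<length ys. f i < length w \<and> w ! f i = ys ! i" "\<forall>j<length ys. \<forall>i<j. f i < (f j :: nat)"
    using subseq_nth[OF ys(1)] by blast
  have "w ! f 0 = ys ! 0" "w ! f 1 = ys ! 1" "w ! f 2 = ys ! 2" "w ! f 3 = ys ! 3" "f 3 < length w"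
    using f(1) ys(2) by auto
  moreover have "f 0 < f 1" "f 1 < f 2" "f 2 < f 3" using f(2) ys(2) by auto
  moreover have "ys ! 1 < ys ! 3" "ys ! 3 < ys ! 0" "ys ! 0 < ys ! 2"
    using ys(3)[of 1 3] ys(3)[of 3 0] ys(3)[of 0 2] by auto
  ultimately have "f 0 < f 1 \<and> f 1 < f 2 \<and> f 2 < f 3 \<and> f 3 < length w \<and>
      w ! f 1 < w ! f 3 \<and> w ! f 3 < w ! f 0 \<and> w ! f 0 < w ! f 2" by simp
  then show "\<exists>a b c d. a < b \<and> b < c \<and> c < d \<and> d < length w \<and> w ! b < w ! d \<and> w ! d < w ! a \<and> w ! a < w ! c"
    by blast
next
  assume "\<exists>a b c d. a < b \<and> b < c \<and> c < d \<and> d < length w \<and> w ! b < w ! d \<and> w ! d < w ! a \<and> w ! a < w ! c"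
  then obtain a b c d where *: "a < b" "b < c" "c < d" "d < length w" "w ! b < w ! d" "w ! d < w ! a" "w ! a < w ! c"
    by blast
  have "subseq (map ((!) w) [a, b, c, d]) w" using * by (intro nth_subseq) auto
  moreover have "\<forall>i<4. \<forall>j<4. map ((!) w) [a, b, c, d] ! i < map ((!) w) [a, b, c, d] ! j
      \<longleftrightarrow> [3, 1, 4, 2::nat] ! i < [3, 1, 4, 2] ! j"
    using * by (simp add: All_less_Suc eval_nat_numeral)
  ultimately show "contains_pattern w [3, 1, 4, 2]" unfolding contains_pattern_def
    by (intro bexI[of _ "map ((!) w) [a, b, c, d]"]) (auto simp: eval_nat_numeral)
qed

text \<open>In a 231 at positions \<open>i\<close>, \<open>j\<close>, \<open>k\<close>, replace the
  2 by the least value \<open>v\<close> above \<open>w ! k\<close> that occurs before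
  \<open>j\<close>; then \<open>v - 1\<close> occurs after \<open>j\<close>. The nearest larger
  entry to the right of \<open>v\<close> either is adjacent to it, which gives the Fishburn pattern,
  or is preceded by an entry below \<open>v - 1\<close>, which gives 3142.\<close>

lemma contains_231_imp:
  assumes w: "w \<in> permutations_of_set {1..n}" and c: "contains_231 w"
  shows "(\<exists>i j. i + 1 < j \<and> j < n \<and> w ! j + 1 = w ! i \<and> w ! i < w ! (i + 1)) \<or> contains_pattern w [3, 1, 4, 2]"
proof -
  have sw: "set w = {1..n}" "distinct w" using w by (auto simp: permutations_of_set_def)
  then have len: "length w = n" using distinct_card[of w] by simp
  note inj = nth_eq_iff_index_eq[OF sw(2)]
  obtain i j k where ijk: "i < j" "j < k" "k < n" "w ! k < w ! i" "w ! i < w ! j"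
    using c contains_231_nth len by metis
  define P where "P v \<longleftrightarrow> w ! k < v \<and> (\<exists>q<j. w ! q = v)" for v
  define v where "v = (LEAST v. P v)"
  have "P (w ! i)" using ijk by (auto simp: P_def)
  then have v: "P v" "v \<le> w ! i" unfolding v_def by (auto intro: LeastI Least_le)
  then obtain q where q: "q < j" "w ! q = v" "w ! k < v" unfolding P_def by blast
  \<comment> \<open>Minimality of \<open>v\<close> excludes a place of \<open>v - 1\<close> before
    \<open>j\<close>, and the entry at \<open>j\<close> itself is larger than
    \<open>v\<close>.\<close>
  have "\<exists>k'>j. k' < n \<and> w ! k' = v - 1"
  proof (cases "v - 1 = w ! k")
    case True
    then show ?thesis using ijk by auto
  next
    case False
    have "v \<in> {1..n}" using q ijk len nth_mem[of q w] sw by auto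
    then have "v - 1 \<in> set w" using False q(3) sw by auto
    then obtain k' where k': "k' < n" "w ! k' = v - 1" using len by (auto simp: in_set_conv_nth)
    have "\<not> P (v - 1)" using q(3) not_less_Least[of "v - 1" P] unfolding v_def[symmetric] by auto
    then have "\<not> k' < j" using k' False q(3) by (auto simp: P_def)
    moreover have "k' \<noteq> j" using k' v(2) ijk by auto
    ultimately show ?thesis using k' by (intro exI[of _ k']) auto
  qed
  then obtain k' where k': "j < k'" "k' < n" "w ! k' + 1 = w ! q" using q by auto
  define m where "m = (LEAST m. q < m \<and> w ! q < w ! m)"
  have *: "q < j \<and> w ! q < w ! j" using q v ijk by simp
  have m: "q < m" "w ! q < w ! m" "m \<le> j"
    using LeastI[of "\<lambda>m. q < m \<and> w ! q < w ! m", OF *] Least_le[of "\<lambda>m. q < m \<and> w ! q < w ! m", OF *]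
    unfolding m_def by auto
  show ?thesis
  proof (cases "m = q + 1")
    case True
    then have "q + 1 < k' \<and> k' < n \<and> w ! k' + 1 = w ! q \<and> w ! q < w ! (q + 1)" using m k' by auto
    then show ?thesis by blast
  next
    case False
    then have "q < m - 1" using m by simp
    then have "\<not> w ! q < w ! (m - 1)"
      using not_less_Least[of "m - 1" "\<lambda>m. q < m \<and> w ! q < w ! m"] unfolding m_def[symmetric] by auto
    \<comment> \<open>The entry before \<open>m\<close> does not exceed \<open>v\<close>; being
      neither \<open>v\<close> nor \<open>v - 1\<close>, it lies below \<open>v - 1\<close>.\<close>
    moreover have "w ! (m - 1) \<noteq> w ! q" "w ! (m - 1) \<noteq> w ! k'"
      using \<open>q < m - 1\<close> m k' len by (auto simp: inj)
    ultimately have "w ! (m - 1) < w ! k'" using k' by simp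
    moreover have "q < m - 1" "m - 1 < m" "m < k'" using \<open>q < m - 1\<close> m k' by auto
    ultimately have "q < m - 1 \<and> m - 1 < m \<and> m < k' \<and> k' < length w \<and>
        w ! (m - 1) < w ! k' \<and> w ! k' < w ! q \<and> w ! q < w ! m" using m k' len by simp
    then have "contains_pattern w [3, 1, 4, 2]" unfolding contains_3142_nth by blast
    then show ?thesis ..
  qed
qed

text \<open>For the converse, both forbidden shapes contain 231: the Fishburn pattern as it stands,
  and 3142 in its letters 3, 4, 2.\<close>

lemma fishburn_permutations_avoiding_3142:
  "fishburn_permutations_avoiding n [3, 1, 4, 2] = perms_231 n"
proof (intro equalityI subsetI)
  fix w assume "w \<in> fishburn_permutations_avoiding n [3, 1, 4, 2]"
  then show "w \<in> perms_231 n"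
    using contains_231_imp unfolding fishburn_permutations_avoiding_def fishburn_permutations_def perms_231_def by blast
next
  fix w assume "w \<in> perms_231 n"
  then have w: "w \<in> permutations_of_set {1..n}" and c: "\<not> contains_231 w" by (auto simp: perms_231_def)
  then have len: "length w = n" by (auto simp: permutations_of_set_def distinct_card[symmetric])
  have "\<not> (\<exists>i j. i + 1 < j \<and> j < n \<and> w ! j + 1 = w ! i \<and> w ! i < w ! (i + 1))"
  proof (intro notI, elim exE conjE)
    fix i j assume a: "i + 1 < j" "j < n" "w ! j + 1 = w ! i" "w ! i < w ! (i + 1)"
    then have "i < i + 1" "w ! j < w ! i" "j < length w" using len by auto
    then show False using c a unfolding contains_231_nth by blast
  qed
  moreover have "\<not> contains_pattern w [3, 1, 4, 2]"
    using c less_trans unfolding contains_3142_nth contains_231_nth by blast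
  ultimately show "w \<in> fishburn_permutations_avoiding n [3, 1, 4, 2]"
    using w unfolding fishburn_permutations_avoiding_def fishburn_permutations_def by blast
qed

lemma fishburn_permutations_narayana:
  assumes "1 \<le> n"
  shows "(\<Sum>w\<in>fishburn_permutations_avoiding n [3, 1, 4, 2]. monom 1 (rmin w)) = narayana_poly n"
  unfolding fishburn_permutations_avoiding_3142
  using perms_231_card[OF assms] by (intro sum_monom_eq_narayana_poly[OF assms]) auto

section \<open>Multisets of cells\<close>

definition cells :: "nat \<Rightarrow> nat \<Rightarrow> (nat \<times> nat) multiset set" where
  "cells n k = {A. size A = n \<and> (\<forall>(l, u) \<in># A. l \<le> u) \<and> fst ` set_mset A = {..<k} \<and> snd ` set_mset A = {..<k}}"

definition nested :: "(nat \<times> nat) set \<Rightarrow> bool" where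
  "nested S \<longleftrightarrow> (\<exists>(l, u) \<in> S. \<exists>(l', u') \<in> S. l < l' \<and> u' < u)"

definition crossed :: "(nat \<times> nat) set \<Rightarrow> bool" where
  "crossed S \<longleftrightarrow> (\<exists>(l, u) \<in> S. \<exists>(l', u') \<in> S. l < l' \<and> l' \<le> u \<and> u < u')"

abbreviation cells_without :: "((nat \<times> nat) set \<Rightarrow> bool) \<Rightarrow> nat \<Rightarrow> nat \<Rightarrow> (nat \<times> nat) multiset set" where
  "cells_without bad n k \<equiv> {A \<in> cells n k. \<not> bad (set_mset A)}"

section \<open>Sorted listings of multisets\<close>

lemma sorted_wrt_mset_unique:
  assumes "sorted_wrt R xs" "sorted_wrt R ys" "mset xs = mset ys" "\<And>x y. R x y \<Longrightarrow> R y x \<Longrightarrow> x = y"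
  shows "xs = ys"
  using assms(1-3)
proof (induction xs arbitrary: ys)
  case (Cons x xs)
  then obtain y zs where ys: "ys = y # zs" by (cases ys) auto
  have "x \<in> set (y # zs)" "y \<in> set (x # xs)"
    using Cons.prems(3) ys by (metis list.set_intros(1) set_mset_mset)+
  then have "x = y" using Cons.prems(1,2) ys assms(4) by auto
  then show ?case using Cons.IH[of zs] Cons.prems ys by auto
qed simp

lemma sorted_map_mset_unique:
  assumes "sorted (map f xs)" "sorted (map f ys)" "mset xs = mset ys" "inj f"
  shows "xs = ys"
  using assms(1-3) by (intro sorted_wrt_mset_unique[of "\<lambda>x y. f x \<le> f y"])
    (auto simp: sorted_map dest: injD[OF assms(4)] antisym)

lemma ex_sorted_map_mset: "\<exists>xs. mset xs = A \<and> sorted (map f xs)"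
  by (metis ex_mset mset_sort sorted_sort_key)

subsection \<open>Cells without nesting\<close>

text \<open>Steps of 0 or 1 express at once that a coordinate weakly increases and that it skips no
  value; this is how the surjectivity conditions on cells become a condition on paths.\<close>

definition unit_step :: "nat \<Rightarrow> nat \<Rightarrow> bool" where
  "unit_step a b \<longleftrightarrow> b = a \<or> b = Suc a"

lemma unit_steps_imp:
  assumes "a \<noteq> []" "hd a = 0" "successively unit_step a"
  shows "sorted a \<and> set a = {..last a}"
  using assms
proof (induction a rule: rev_nonempty_induct)
  case (single x)
  then show ?case by simp
next
  case (snoc x xs)
  then have *: "sorted xs" "set xs = {..last xs}" "unit_step (last xs) x"
    by (auto simp: successively_append_iff)
  define t where "t = last xs"
  have a: "sorted xs" and b: "set xs = {..t}" and c: "x = t \<or> x = Suc t"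
    using * unfolding t_def[symmetric] unit_step_def by blast+
  have "set (xs @ [x]) = {..x}" using c unfolding set_append b by auto
  moreover have "sorted (xs @ [x])" using a c unfolding sorted_append b by auto
  ultimately show ?case by simp
qed

lemma imp_unit_steps:
  assumes "a \<noteq> []" "sorted a" "set a = {..<k}"
  shows "hd a = 0 \<and> successively unit_step a \<and> k = Suc (last a)"
  using assms
proof (induction a arbitrary: k rule: rev_nonempty_induct)
  case (single x)
  have e: "{..<k} = {x}" using single(2) by simp
  then have "x \<in> {..<k}" by blast
  then have "0 \<in> {..<k}" by simp
  then have x: "x = 0" unfolding e by simp
  have "card {..<k} = 1" unfolding e by simp
  then have "k = Suc 0" by simp
  then show ?case using x by simp
next
  case (snoc x xs)
  have le: "\<forall>y\<in>set xs. y \<le> x" and s: "sorted xs" using snoc.prems by (auto simp: sorted_append)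
  show ?case
  proof (cases "x \<in> set xs")
    case True
    then have "set xs = {..<k}" using snoc.prems(2) by (simp add: insert_absorb)
    from snoc.IH[OF s this] have IH: "hd xs = 0" "successively unit_step xs" "k = Suc (last xs)" by auto
    have "x < k" using snoc.prems by auto
    moreover have "last xs \<le> x" using le snoc.hyps by simp
    ultimately show ?thesis using IH snoc.hyps by (auto simp: successively_append_iff unit_step_def)
  next
    case False
    have "x < k" using snoc.prems by auto
    moreover have "y \<le> x" if "y < k" for y using that snoc.prems(2) le by auto
    ultimately have k: "k = Suc x" by (metis Suc_lessI lessI not_less)
    have "set xs = set (xs @ [x]) - {x}" using False by simp
    also have "\<dots> = {..<x}" unfolding snoc.prems(2) k by auto
    finally have "set xs = {..<x}" .
    from snoc.IH[OF s this] show ?thesis using k snoc.hyps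
      by (auto simp: successively_append_iff unit_step_def)
  qed
qed

text \<open>The two coordinates are 0-1 lattice paths run in parallel, and \<open>a \<le> b\<close>
  says that the first never overtakes the second: the noncrossing condition that the determinant
  counts.\<close>

definition paths :: "nat \<Rightarrow> nat \<Rightarrow> nat \<Rightarrow> (nat \<times> nat) list set" where
  "paths m l u = {xs. length xs = Suc m \<and> hd xs = (0, 0) \<and> last xs = (l, u) \<and> (\<forall>(a, b) \<in> set xs. a \<le> b) \<and>
     successively unit_step (map fst xs) \<and> successively unit_step (map snd xs)}"

definition preds :: "nat \<Rightarrow> nat set" where
  "preds l = {l'. unit_step l' l}"

lemma preds_simps: "preds 0 = {0}" "preds (Suc l) = {Suc l, l}"
  by (auto simp: preds_def unit_step_def)

lemma paths_Suc:
  "paths (Suc m) l u = (if l \<le> u then (\<lambda>xs. xs @ [(l, u)]) ` (\<Union>(l', u')\<in>preds l \<times> preds u. paths m l' u') else {})"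
proof (rule set_eqI)
  fix ys
  show "ys \<in> paths (Suc m) l u \<longleftrightarrow> ys \<in> (if l \<le> u then (\<lambda>xs. xs @ [(l, u)]) ` (\<Union>(l', u')\<in>preds l \<times> preds u. paths m l' u') else {})"
  proof (cases ys rule: rev_cases)
    case Nil
    then show ?thesis by (auto simp: paths_def)
  next
    case (snoc xs x)
    have "ys \<in> paths (Suc m) l u \<longleftrightarrow> x = (l, u) \<and> l \<le> u \<and> (\<exists>l' u'. l' \<in> preds l \<and> u' \<in> preds u \<and> xs \<in> paths m l' u')"
    proof (cases "xs = []")
      case True
      then show ?thesis unfolding snoc by (simp add: paths_def)
    next
      case False
      then show ?thesis unfolding snoc paths_def preds_def
        by (cases "last xs") (auto simp: successively_append_iff last_map)
    qed
    then show ?thesis unfolding snoc by auto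
  qed
qed

text \<open>The Lindstroem-Gessel-Viennot determinant for the two coordinates of the path.\<close>

definition path_count :: "nat \<Rightarrow> nat \<Rightarrow> nat \<Rightarrow> int" where
  "path_count m l u = int (m choose u) * int (m choose l)
     - (if l = 0 then 0 else int (m choose Suc u) * int (m choose (l - 1)))"

text \<open>Pascal's rule in every entry, so the determinant obeys the recursion of unconstrained
  pairs of paths. With \<open>l \<le> u\<close>, the case \<open>u = 0\<close> forces
  \<open>l = 0\<close>, and there the missing predecessor of 0 does no harm.\<close>

lemma path_count_Suc: "l \<le> u \<Longrightarrow> path_count (Suc m) l u = (\<Sum>l'\<in>preds l. \<Sum>u'\<in>preds u. path_count m l' u')"
proof -
  assume "l \<le> u"
  consider "l = 0" | "l = 1" | l' where "l = Suc (Suc l')" by (metis One_nat_def not0_implies_Suc)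
  then show ?thesis
  proof cases
    case 1
    then show ?thesis using \<open>l \<le> u\<close> by (cases u) (auto simp: path_count_def preds_simps algebra_simps)
  next
    case 2
    then show ?thesis using \<open>l \<le> u\<close> by (cases u) (auto simp: path_count_def preds_simps algebra_simps)
  next
    case 3
    then show ?thesis using \<open>l \<le> u\<close> by (cases u) (auto simp: path_count_def preds_simps algebra_simps)
  qed
qed

text \<open>A step into \<open>l \<le> u\<close> comes from \<open>l' \<le> u' + 1\<close>. On the
  forbidden line \<open>l' = u' + 1\<close> the two products of the determinant coincide, so it
  vanishes there just as the number of paths does, and recursion and boundary values agree.\<close>

lemma card_paths: "finite (paths m l u) \<and> int (card (paths m l u)) = (if l \<le> u then path_count m l u else 0)"
proof (induction m arbitrary: l u)
  case 0
  have "paths 0 l u = (if l = 0 \<and> u = 0 then {[(0, 0)]} else {})"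
    by (auto simp: paths_def length_Suc_conv)
  then show ?case by (auto simp: path_count_def)
next
  case (Suc m)
  show ?case
  proof (cases "l \<le> u")
    case False
    then show ?thesis by (simp add: paths_Suc)
  next
    case True
    have fp: "finite (preds l \<times> preds u)" by (cases l; cases u; simp add: preds_simps)
    let ?U = "\<Union>(l', u')\<in>preds l \<times> preds u. paths m l' u'"
    have fU: "finite ?U" using fp Suc by auto
    have "card (paths (Suc m) l u) = card ?U"
      using True by (simp add: paths_Suc card_image inj_on_def)
    also have "\<dots> = (\<Sum>(l', u')\<in>preds l \<times> preds u. card (paths m l' u'))"
      using fp Suc by (subst card_UN_disjoint) (auto simp: paths_def case_prod_unfold)
    finally have "int (card (paths (Suc m) l u)) = (\<Sum>(l', u')\<in>preds l \<times> preds u. int (card (paths m l' u')))"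
      by (simp add: case_prod_unfold)
    also have "\<dots> = (\<Sum>(l', u')\<in>preds l \<times> preds u. path_count m l' u')"
    proof (rule sum.cong[OF refl], clarify)
      fix l' u' assume "l' \<in> preds l" "u' \<in> preds u"
      then have "l' \<le> Suc u'" using True by (auto simp: preds_def unit_step_def)
      moreover have "path_count m (Suc u') u' = 0" by (simp add: path_count_def)
      ultimately show "int (card (paths m l' u')) = path_count m l' u'" using Suc[of l' u'] by (auto simp: le_Suc_eq)
    qed
    also have "\<dots> = path_count (Suc m) l u" using True by (simp add: path_count_Suc sum.cartesian_product)
    finally show ?thesis using True fU by (simp add: paths_Suc)
  qed
qed

text \<open>In lexicographic order, cells without nesting increase weakly in both coordinates
  simultaneously; conversely two monotone coordinates exclude a nested pair.\<close>

lemma bij_betw_paths_cells: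
  "bij_betw mset (paths m j j) (cells_without nested (Suc m) (Suc j))"
  unfolding bij_betw_def
proof
  have props: "sorted (map fst xs)" "sorted (map snd xs)" "set (map fst xs) = {..j}" "set (map snd xs) = {..j}"
    if "xs \<in> paths m j j" for xs
  proof -
    have "xs \<noteq> []" using that by (auto simp: paths_def)
    then show "sorted (map fst xs)" "sorted (map snd xs)" "set (map fst xs) = {..j}" "set (map snd xs) = {..j}"
      using unit_steps_imp[of "map fst xs"] unit_steps_imp[of "map snd xs"] that
      by (auto simp: paths_def hd_map last_map)
  qed
  have srt: "sorted xs" if "xs \<in> paths m j j" for xs
    using props(1,2)[OF that] by (auto simp: sorted_wrt_iff_nth_less less_eq_prod_def)
  show "inj_on mset (paths m j j)"
    by (rule inj_onI) (metis srt inj_on_id2 list.map_ident sorted_map_mset_unique)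
  show "mset ` paths m j j = cells_without nested (Suc m) (Suc j)"
  proof (intro equalityI subsetI)
    fix A assume "A \<in> mset ` paths m j j"
    then obtain xs where xs: "xs \<in> paths m j j" "A = mset xs" by blast
    have "\<not> nested (set xs)"
    proof
      assume "nested (set xs)"
      then obtain x y where xy: "x \<in> set xs" "y \<in> set xs" "fst x < fst y" "snd y < snd x"
        unfolding nested_def by fastforce
      then obtain p q where pq: "p < length xs" "q < length xs" "x = xs ! p" "y = xs ! q" by (auto simp: in_set_conv_nth)
      show False
      proof (cases "p \<le> q")
        case True
        then show False using sorted_nth_mono[OF props(2)[OF xs(1)], of p q] pq xy by simp
      next
        case False
        then show False using sorted_nth_mono[OF props(1)[OF xs(1)], of q p] pq xy by simp
      qed
    qed
    moreover have "fst ` set xs = {..<Suc j}" "snd ` set xs = {..<Suc j}"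
      using props(3,4)[OF xs(1)] by (simp_all add: lessThan_Suc_atMost)
    moreover have "length xs = Suc m" "\<forall>(l, u)\<in>set xs. l \<le> u" using xs(1) by (simp_all add: paths_def)
    ultimately show "A \<in> cells_without nested (Suc m) (Suc j)"
      using xs(2) by (simp add: cells_def)
  next
    fix A assume "A \<in> cells_without nested (Suc m) (Suc j)"
    then have A: "size A = Suc m" "\<forall>(l, u)\<in>#A. l \<le> u" "fst ` set_mset A = {..<Suc j}" "snd ` set_mset A = {..<Suc j}"
      "\<not> nested (set_mset A)" by (auto simp: cells_def)
    obtain xs where xs: "mset xs = A" "sorted (map id xs)" using ex_sorted_map_mset by blast
    have len: "length xs = Suc m" and ne: "xs \<noteq> []" using A(1) xs(1) by auto
    \<comment> \<open>Lexicographic order lets the second coordinate drop only where the first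
      rises, and that would be a nesting.\<close>
    have "fst (xs ! p) \<le> fst (xs ! q) \<and> snd (xs ! p) \<le> snd (xs ! q)" if "p < q" "q < length xs" for p q
    proof -
      have "xs ! p \<le> xs ! q" using xs(2) that by (simp add: sorted_wrt_iff_nth_less)
      moreover have "xs ! p \<in># A" "xs ! q \<in># A" using that xs(1) by auto
      then have "\<not> (fst (xs ! p) < fst (xs ! q) \<and> snd (xs ! q) < snd (xs ! p))"
        using A(5) unfolding nested_def by (auto simp: case_prod_unfold)
      ultimately show ?thesis by (auto simp: less_eq_prod_def)
    qed
    then have s: "sorted (map fst xs)" "sorted (map snd xs)" by (auto simp: sorted_wrt_iff_nth_less)
    have "hd (map fst xs) = 0 \<and> successively unit_step (map fst xs) \<and> Suc j = Suc (last (map fst xs))"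
      by (rule imp_unit_steps) (use s ne A(3) in \<open>simp_all flip: xs(1)\<close>)
    moreover have "hd (map snd xs) = 0 \<and> successively unit_step (map snd xs) \<and> Suc j = Suc (last (map snd xs))"
      by (rule imp_unit_steps) (use s ne A(4) in \<open>simp_all flip: xs(1)\<close>)
    moreover have "\<forall>(a, b)\<in>set xs. a \<le> b" using A(2) xs(1) by auto
    ultimately have "xs \<in> paths m j j"
      using ne len unfolding paths_def by (auto simp: hd_map last_map prod_eq_iff)
    then show "A \<in> mset ` paths m j j" using xs(1) by auto
  qed
qed

lemma cells_0: "1 \<le> n \<Longrightarrow> cells n 0 = {}"
  by (auto simp: cells_def)

lemma card_nonnested_cells:
  assumes "1 \<le> n"
  shows "int (card (cells_without nested n k)) = narayana n k"
proof (cases k)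
  case 0
  then show ?thesis using cells_0[OF assms] assms by (simp add: narayana_eq_0)
next
  case (Suc j)
  obtain m where n: "n = Suc m" using assms by (cases n) auto
  have "card (paths m j j) = card (cells_without nested n k)"
    using bij_betw_same_card[OF bij_betw_paths_cells] unfolding n Suc .
  \<comment> \<open>With \<open>m = n - 1\<close> and \<open>j = k - 1\<close> the path determinant
    is literally the one in \<open>narayana\<close>.\<close>
  moreover have "path_count m j j = narayana n k"
    unfolding n Suc by (cases j) (auto simp: path_count_def narayana_def)
  ultimately show ?thesis using card_paths[of m j j] by simp
qed

subsection \<open>Cells without crossing\<close>

text \<open>Some cell starts at \<open>i\<close> and some cell ends at \<open>i\<close>. If neither
  is \<open>(i, i)\<close>, these two cross, with \<open>i\<close> as the shared value.\<close>

lemma diagonal_cell: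
  assumes "A \<in> cells n k" "\<not> crossed (set_mset A)" "i < k"
  shows "(i, i) \<in># A"
proof -
  have A: "\<forall>(l, u)\<in>#A. l \<le> u" "i \<in> fst ` set_mset A" "i \<in> snd ` set_mset A" using assms by (auto simp: cells_def)
  then obtain l u where lu: "(i, u) \<in># A" "(l, i) \<in># A" by force
  then have "l \<le> i" "i \<le> u" using A by auto
  moreover have "\<not> (l < i \<and> i < u)" using assms(2) lu unfolding crossed_def by fastforce
  ultimately show ?thesis using lu by (auto simp: le_less)
qed

text \<open>Each letter of the word becomes a cell in the column of the largest letter so far.\<close>

definition word_cells :: "nat list \<Rightarrow> (nat \<times> nat) list" where
  "word_cells w = map (\<lambda>i. (w ! i, card (set (take (Suc i) w)) - 1)) [0..<length w]"

text \<open>The negated row makes an ascending sort begin each column at its largest possible row,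
  the diagonal one.\<close>

definition column_key :: "nat \<times> nat \<Rightarrow> nat \<times> int" where
  "column_key = (\<lambda>(l, u). (u, - int l))"

lemma inj_column_key: "inj column_key"
  by (auto simp: inj_def column_key_def)

lemma word_cells_snoc: "word_cells (y @ [v]) = word_cells y @ [(v, card (set (y @ [v])) - 1)]"
  by (auto simp: word_cells_def nth_append)

lemma set_word_cells:
  assumes "rgf w"
  shows "fst ` set (word_cells w) = {..<card (set w)} \<and> snd ` set (word_cells w) = {..<card (set w)}
    \<and> (\<forall>(l, u)\<in>set (word_cells w). l \<le> u)"
  using assms
proof (induction w rule: rev_induct)
  case Nil
  then show ?case by (simp add: word_cells_def)
next
  case (snoc v y)
  then have y: "rgf y" by (simp add: rgf_snoc)
  note IH = snoc.IH[OF y]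
  have s: "set (y @ [v]) = {..<card (set (y @ [v]))}" "set y = {..<card (set y)}"
    using rgf_set[OF snoc.prems] rgf_set[OF y] by blast+
  have "fst ` set (word_cells (y @ [v])) = insert v (fst ` set (word_cells y))" by (simp add: word_cells_snoc)
  also have "fst ` set (word_cells y) = set y" using IH s(2) by metis
  also have "insert v (set y) = {..<card (set (y @ [v]))}" using s(1) by (metis list.simps(15) set_append Un_insert_right list.set(1) sup_bot.right_neutral)
  finally have 1: "fst ` set (word_cells (y @ [v])) = {..<card (set (y @ [v]))}" .
  have "card (set (y @ [v])) = (if v \<in> set y then card (set y) else Suc (card (set y)))" by (simp add: card_insert_if)
  moreover have "card (set y) > 0" if "v \<in> set y" using that by (auto simp: card_gt_0_iff)
  ultimately have 2: "snd ` set (word_cells (y @ [v])) = {..<card (set (y @ [v]))}"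
    using IH by (auto simp: word_cells_snoc)
  have "v < card (set (y @ [v]))" using s(1) by (metis lessThan_iff in_set_conv_decomp)
  then show ?case using 1 2 IH by (auto simp: word_cells_snoc)
qed

lemma nth_word_cells: "i < length w \<Longrightarrow> word_cells w ! i = (w ! i, card (set (take (Suc i) w)) - 1)"
  by (simp add: word_cells_def)

lemma set_take_mono: "i \<le> j \<Longrightarrow> set (take i w) \<subseteq> set (take j w)"
  by (rule set_take_subset_set_take)

text \<open>A letter seen by position \<open>i\<close> that returned later above
  \<open>w ! i\<close> would form 101 around \<open>w ! i\<close>.\<close>

lemma word_cells_occurs_before:
  assumes "rgf w" "avoids_101 w" "i < j" "j < length w" "w ! j \<in> set (take (Suc i) w)"
  shows "w ! j \<le> w ! i"
proof -
  obtain p where p: "p < Suc i" "w ! p = w ! j" using assms by (auto simp: in_set_conv_nth)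
  show ?thesis
  proof (cases "p = i")
    case False
    then show ?thesis using assms p unfolding avoids_101_def by (metis less_SucE not_less)
  qed (use p in simp)
qed

text \<open>After the letter that opens a column, all further letters of the column are repetitions,
  and a repetition cannot exceed the letters standing between it and an earlier occurrence.\<close>

lemma sorted_word_cells:
  assumes "rgf w" "avoids_101 w"
  shows "sorted (map column_key (word_cells w))"
proof -
  have "column_key (word_cells w ! i) \<le> column_key (word_cells w ! j)" if ij: "i < j" "j < length w" for i j
  proof -
    have sub: "set (take (Suc i) w) \<subseteq> set (take (Suc j) w)" using ij by (intro set_take_mono) simp
    have le: "card (set (take (Suc i) w)) \<le> card (set (take (Suc j) w))" by (rule card_mono[OF _ sub]) simp
    have pos: "card (set (take (Suc i) w)) > 0" using ij by (auto simp: card_gt_0_iff)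
    have "w ! j \<le> w ! i" if "card (set (take (Suc i) w)) = card (set (take (Suc j) w))"
    proof -
      have "set (take (Suc i) w) = set (take (Suc j) w)" using sub that by (simp add: card_subset_eq)
      moreover have "w ! j \<in> set (take (Suc j) w)" using ij by (simp add: take_Suc_conv_app_nth)
      ultimately show ?thesis using word_cells_occurs_before[OF assms ij] by simp
    qed
    then show ?thesis using le pos ij
      by (auto simp: nth_word_cells column_key_def less_eq_prod_def)
  qed
  then show ?thesis by (simp add: sorted_wrt_iff_nth_less word_cells_def)
qed

text \<open>If \<open>(l, u)\<close> and \<open>(l', u')\<close> crossed, \<open>l' \<le> u\<close>
  would say that \<open>l'\<close> has already occurred when \<open>l\<close> is written; with the
  smaller \<open>l\<close> between, its return is a 101.\<close>

lemma not_crossed_word_cells: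
  assumes "rgf w" "avoids_101 w"
  shows "\<not> crossed (set (word_cells w))"
proof
  assume "crossed (set (word_cells w))"
  then obtain x y where xy: "x \<in> set (word_cells w)" "y \<in> set (word_cells w)"
    "fst x < fst y" "fst y \<le> snd x" "snd x < snd y" unfolding crossed_def by fastforce
  have "length (word_cells w) = length w" by (simp add: word_cells_def)
  with xy(1,2) obtain i j where ij: "i < length w" "j < length w" "x = word_cells w ! i" "y = word_cells w ! j"
    by (auto simp: in_set_conv_nth)
  have "i < j"
  proof (rule ccontr)
    assume "\<not> i < j"
    then have "card (set (take (Suc j) w)) \<le> card (set (take (Suc i) w))" by (intro card_mono set_take_mono) auto
    then show False using xy(5) ij by (simp add: nth_word_cells)
  qed
  have "rgf (take (Suc i) w)" using assms(1) unfolding rgf_def by (auto simp: min_def)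
  then have s: "set (take (Suc i) w) = {..<card (set (take (Suc i) w))}" by (rule rgf_set)
  have "w ! j < card (set (take (Suc i) w))"
  proof -
    have "card (set (take (Suc i) w)) > 0" using ij by (auto simp: card_gt_0_iff)
    then show ?thesis using xy(4) ij by (simp add: nth_word_cells)
  qed
  then have "w ! j \<in> set (take (Suc i) w)" using s by blast
  from word_cells_occurs_before[OF assms \<open>i < j\<close> ij(2) this] show False using xy(3) ij by (simp add: nth_word_cells)
qed

lemma bij_betw_word_cells:
  "bij_betw (\<lambda>w. mset (word_cells w)) {w \<in> rgf_101 n. card (set w) = k} (cells_without crossed n k)"
  unfolding bij_betw_def
proof
  show "inj_on (\<lambda>w. mset (word_cells w)) {w \<in> rgf_101 n. card (set w) = k}"
  proof (rule inj_onI)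
    fix w w' assume a: "w \<in> {w \<in> rgf_101 n. card (set w) = k}" "w' \<in> {w \<in> rgf_101 n. card (set w) = k}"
      "mset (word_cells w) = mset (word_cells w')"
    then have "word_cells w = word_cells w'"
      by (intro sorted_map_mset_unique[OF _ _ _ inj_column_key]) (auto simp: rgf_101_def sorted_word_cells)
    moreover have "map fst (word_cells w) = w" for w by (simp add: word_cells_def comp_def map_nth)
    ultimately show "w = w'" by metis
  qed
  show "(\<lambda>w. mset (word_cells w)) ` {w \<in> rgf_101 n. card (set w) = k} = cells_without crossed n k"
  proof (intro equalityI subsetI)
    fix A assume "A \<in> (\<lambda>w. mset (word_cells w)) ` {w \<in> rgf_101 n. card (set w) = k}"
    then obtain w where w: "A = mset (word_cells w)" "length w = n" "rgf w" "avoids_101 w" "card (set w) = k"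
      by (auto simp: rgf_101_def)
    then show "A \<in> cells_without crossed n k"
      using set_word_cells[OF w(3)] not_crossed_word_cells[OF w(3,4)]
      by (simp add: cells_def) (simp add: word_cells_def)
  next
    fix A assume "A \<in> cells_without crossed n k"
    then have A: "A \<in> cells n k" "\<not> crossed (set_mset A)" by auto
    then have A': "size A = n" "\<And>l u. (l, u) \<in># A \<Longrightarrow> l \<le> u" "fst ` set_mset A = {..<k}" "snd ` set_mset A = {..<k}"
      by (auto simp: cells_def)
    obtain xs where xs: "mset xs = A" "sorted (map column_key xs)" using ex_sorted_map_mset by blast
    have len: "length xs = n" using A'(1) xs(1) by auto
    have mem: "x \<in># A \<longleftrightarrow> x \<in> set xs" for x using xs(1) by auto
    define w where "w = map fst xs"
    have lw: "length w = n" by (simp add: w_def len)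
    have key: "column_key (xs ! i) \<le> column_key (xs ! j)" if "i \<le> j" "j < n" for i j
      using sorted_nth_mono[OF xs(2), of i j] that len by simp
    have le: "fst (xs ! i) \<le> snd (xs ! i)" if "i < n" for i
      using A'(2)[of "fst (xs ! i)" "snd (xs ! i)"] that len mem by simp
    \<comment> \<open>The letters used up to position \<open>p\<close> are exactly those up to its
      column, because every column up to that one contains its diagonal cell, listed before all
      other cells of the column.\<close>
    have st: "set (take (Suc p) w) = {..snd (xs ! p)}" if p: "p < n" for p
    proof (intro equalityI subsetI)
      fix v assume "v \<in> set (take (Suc p) w)"
      then obtain q where q: "q \<le> p" "v = fst (xs ! q)"
        using p len by (auto simp: in_set_conv_nth w_def less_Suc_eq_le intro: that)
      then have "v \<le> snd (xs ! q)" using le p by simp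
      also have "\<dots> \<le> snd (xs ! p)" using key[of q p] q p
        by (auto simp: column_key_def less_eq_prod_def case_prod_unfold split: if_splits)
      finally show "v \<in> {..snd (xs ! p)}" by simp
    next
      fix v assume v: "v \<in> {..snd (xs ! p)}"
      have "xs ! p \<in># A" using p len mem by simp
      then have "snd (xs ! p) < k" using A'(4) by blast
      then have "(v, v) \<in># A" using v diagonal_cell[OF A] by simp
      then obtain q where q: "q < n" "xs ! q = (v, v)" using mem len by (auto simp: in_set_conv_nth)
      show "v \<in> set (take (Suc p) w)"
      proof (cases "q \<le> p")
        case True
        then show ?thesis using q p len by (auto simp: in_set_conv_nth w_def intro!: exI[of _ q])
      next
        case False
        \<comment> \<open>Standing in column at least \<open>v\<close> but not after the diagonal
          cell \<open>(v, v)\<close>, the cell at \<open>p\<close> must be another copy of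
          it.\<close>
        then have "column_key (xs ! p) \<le> column_key (v, v)" using key[of p q] q by simp
        then have "snd (xs ! p) = v" "fst (xs ! p) \<ge> v"
          using v by (auto simp: column_key_def less_eq_prod_def case_prod_unfold)
        then have "fst (xs ! p) = v" using le[OF p] by simp
        then show ?thesis using p len by (auto simp: in_set_conv_nth w_def intro!: exI[of _ p])
      qed
    qed
    have wc: "word_cells w = xs"
    proof (rule nth_equalityI)
      show "length (word_cells w) = length xs" by (simp add: word_cells_def w_def)
      fix i assume "i < length (word_cells w)"
      then have i: "i < n" using lw by (simp add: word_cells_def)
      then show "word_cells w ! i = xs ! i" using st[OF i] lw len by (simp add: nth_word_cells) (simp add: w_def)
    qed
    have "rgf w" unfolding rgf_def
    proof (intro allI impI subsetI)
      fix i v assume i: "i < length w" "v \<in> {..<w ! i}"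
      then have "w ! i \<le> snd (xs ! i)" using le lw len by (simp add: w_def)
      then have "v \<in> set (take (Suc i) w)" using st i lw by simp
      then show "v \<in> set (take i w)" using i by (simp add: take_Suc_conv_app_nth)
    qed
    moreover have "avoids_101 w" unfolding avoids_101_def
    proof (intro allI impI, rule ccontr)
      fix i j m assume "m < length w" "j < m" "i < j" "w ! i = w ! m" "\<not> w ! m \<le> w ! j"
      then have ij: "i < j" "j < m" "m < length w" "w ! i = w ! m" "w ! j < w ! m" by auto
      then have n: "i < n" "j < n" "m < n" using lw by auto
      have w: "w ! p = fst (xs ! p)" if "p < n" for p using that len by (simp add: w_def)
      \<comment> \<open>Within a column the rows weakly decrease, so the larger letter at
        \<open>m\<close> belongs to a later column than the one at \<open>j\<close>. Its value is at
        most the column of \<open>i\<close>, hence of \<open>j\<close>, and the two cells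
        cross.\<close>
      have "snd (xs ! j) < snd (xs ! m)"
        using key[of j m] ij n w by (auto simp: column_key_def less_eq_prod_def case_prod_unfold split: if_splits)
      moreover have "snd (xs ! i) \<le> snd (xs ! j)"
        using key[of i j] ij n w by (auto simp: column_key_def less_eq_prod_def case_prod_unfold split: if_splits)
      moreover have "xs ! j \<in># A" "xs ! m \<in># A" using n len mem by auto
      moreover have "fst (xs ! m) \<le> snd (xs ! i)" using le[OF n(1)] ij w n by simp
      ultimately have "crossed (set_mset A)"
        using ij w n unfolding crossed_def
        by (intro bexI[of _ "xs ! j"]) (auto simp: case_prod_unfold intro!: bexI[of _ "xs ! m"])
      then show False using A by simp
    qed
    moreover have "card (set w) = k"
    proof -
      have "set w = fst ` set_mset A" using xs(1) by (auto simp: w_def)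
      then show ?thesis using A'(3) by simp
    qed
    ultimately show "A \<in> (\<lambda>w. mset (word_cells w)) ` {w \<in> rgf_101 n. card (set w) = k}"
      using wc xs(1) lw by (intro image_eqI[of _ _ w]) (auto simp: rgf_101_def)
  qed
qed

lemma card_uncrossed_cells:
  assumes "1 \<le> n"
  shows "int (card (cells_without crossed n k)) = narayana n k"
  using rgf_101_card[OF assms] unfolding bij_betw_same_card[OF bij_betw_word_cells[of n k], symmetric] by blast

text \<open>The common last step for posets and matchings. As the statistic returns
  \<open>k\<close>, its fibre over \<open>k\<close> is the image under \<open>G\<close> of the
  admissible cells of magnitude \<open>k\<close>.\<close>

lemma sum_via_cells:
  assumes fin: "finite T" and n: "1 \<le> n"
    and card: "\<And>k. int (card (cells_without bad n k)) = narayana n k"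
    and into: "\<And>A k. A \<in> cells n k \<Longrightarrow> \<not> bad (set_mset A) \<Longrightarrow> G A \<in> T"
    and stat: "\<And>A k. A \<in> cells n k \<Longrightarrow> \<not> bad (set_mset A) \<Longrightarrow> stat (G A) = k"
    and onto: "\<And>x. x \<in> T \<Longrightarrow> \<exists>A k. A \<in> cells n k \<and> \<not> bad (set_mset A) \<and> x = G A"
    and inj: "\<And>A B k m. A \<in> cells n k \<Longrightarrow> B \<in> cells n m \<Longrightarrow> G A = G B \<Longrightarrow> A = B"
  shows "(\<Sum>x\<in>T. monom 1 (stat x)) = narayana_poly n"
proof (rule sum_monom_eq_narayana_poly[OF n fin])
  fix k
  have "{x \<in> T. stat x = k} = G ` cells_without bad n k" (is "?L = G ` ?R")
  proof (intro equalityI subsetI)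
    fix x assume x: "x \<in> ?L"
    then obtain A m where A: "A \<in> cells n m" "\<not> bad (set_mset A)" "x = G A" using onto by blast
    then have "m = k" using x stat by auto
    then show "x \<in> G ` ?R" using A by blast
  qed (use into stat in auto)
  moreover have "inj_on G ?R" using inj by (auto intro!: inj_onI)
  ultimately show "int (card ?L) = narayana n k" using card[of k] by (simp add: card_image)
qed

section \<open>Interval representations\<close>

locale interval_rep =
  fixes F :: "'a set" and l u :: "'a \<Rightarrow> nat" and k :: nat
  assumes finite_F: "finite F" and l_le_u: "x \<in> F \<Longrightarrow> l x \<le> u x"
    and l_image: "l ` F = {..<k}" and u_image: "u ` F = {..<k}"
begin

definition cell :: "'a \<Rightarrow> nat \<times> nat" where
  "cell x = (l x, u x)"

definition cell_mset :: "(nat \<times> nat) multiset" where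
  "cell_mset = image_mset cell (mset_set F)"

definition below :: "'a \<Rightarrow> 'a set" where
  "below y = {x \<in> F. u x < l y}"

lemma set_cell_mset: "set_mset cell_mset = cell ` F"
  using finite_F by (simp add: cell_mset_def)

lemma cell_mset_in_cells: "cell_mset \<in> cells (card F) k"
proof -
  have "fst ` cell ` F = l ` F" "snd ` cell ` F = u ` F" by (auto simp: cell_def image_image)
  then show ?thesis
    using l_image u_image l_le_u finite_F
    by (simp add: cells_def set_cell_mset) (auto simp: cell_mset_def cell_def)
qed

lemma l_less: "x \<in> F \<Longrightarrow> l x < k" and u_less: "x \<in> F \<Longrightarrow> u x < k"
  using l_image u_image by blast+

lemma obtain_l: assumes "i < k" obtains x where "x \<in> F" "l x = i"
  using assms l_image by (metis imageE lessThan_iff)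

lemma obtain_u: assumes "i < k" obtains x where "x \<in> F" "u x = i"
  using assms u_image by (metis imageE lessThan_iff)

text \<open>If \<open>l z < l y\<close>, surjectivity of \<open>u\<close> yields an element ending
  at \<open>l z\<close>; it lies below \<open>y\<close> but not below \<open>z\<close>.\<close>

lemma below_subset_iff:
  assumes "y \<in> F" "z \<in> F" shows "below y \<subseteq> below z \<longleftrightarrow> l y \<le> l z"
proof
  assume s: "below y \<subseteq> below z"
  show "l y \<le> l z"
  proof (rule ccontr)
    assume n: "\<not> l y \<le> l z"
    obtain x where "x \<in> F" "u x = l z" using obtain_u l_less assms(2) by metis
    then have "x \<in> below y" "x \<notin> below z" using n by (auto simp: below_def)
    then show False using s by blast
  qed
qed (auto simp: below_def)

lemma below_psubset_iff:
  "y \<in> F \<Longrightarrow> z \<in> F \<Longrightarrow> below y \<subset> below z \<longleftrightarrow> l y < l z"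
  using below_subset_iff[of y z] below_subset_iff[of z y] by auto

lemma card_below: "S \<subseteq> F \<Longrightarrow> card (below ` S) = card (l ` S)"
proof -
  assume S: "S \<subseteq> F"
  define E where "E i = {x \<in> F. u x < i}" for i
  have "below ` S = E ` l ` S" by (auto simp: below_def E_def image_image)
  moreover have "inj_on E (l ` S)"
  proof (rule inj_onI)
    fix i j assume "i \<in> l ` S" "j \<in> l ` S" "E i = E j"
    then obtain y z where yz: "y \<in> S" "z \<in> S" "i = l y" "j = l z" "below y = below z"
      by (auto simp: E_def below_def)
    then have "y \<in> F" "z \<in> F" using S by auto
    then have "l y \<le> l z" "l z \<le> l y" using below_subset_iff[of y z] below_subset_iff[of z y] yz(5) by auto
    then show "i = j" using yz by simp
  qed
  ultimately show ?thesis by (simp add: card_image)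
qed

lemma card_below_image: "card (below ` F) = k"
  using card_below[of F] l_image by simp

text \<open>Down-sets are ordered by inclusion as the lower endpoints are by size, and those
  endpoints have no gaps, so the rank of the down-set is the endpoint.\<close>

lemma l_eq_card: assumes "y \<in> F" shows "l y = card {Z \<in> below ` F. Z \<subset> below y}"
proof -
  have "{Z \<in> below ` F. Z \<subset> below y} = below ` {z \<in> F. l z < l y}"
    using below_psubset_iff assms by blast
  moreover have "l ` {z \<in> F. l z < l y} = {..<l y}"
    using l_less[OF assms] l_image by (auto simp: set_eq_iff image_iff) (metis less_trans)
  ultimately show ?thesis using card_below[of "{z \<in> F. l z < l y}"] by auto
qed

text \<open>The down-sets that miss \<open>x\<close> belong to the lower endpoints from 0 to
  \<open>u x\<close>. These are \<open>u x + 1\<close> many, hence the correction by 1.\<close>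

lemma u_eq_card: assumes "x \<in> F" shows "u x = card {Z \<in> below ` F. x \<notin> Z} - 1"
proof -
  have "{Z \<in> below ` F. x \<notin> Z} = below ` {z \<in> F. l z \<le> u x}"
    using assms by (auto simp: below_def)
  moreover have "l ` {z \<in> F. l z \<le> u x} = {..u x}"
    using u_less[OF assms] l_image by (auto simp: set_eq_iff image_iff) (metis le_less_trans)
  ultimately show ?thesis using card_below[of "{z \<in> F. l z \<le> u x}"] by auto
qed

end

text \<open>Both endpoints have been expressed through the sets \<open>below\<close>, which depend
  only on the relation \<open>u x < l y\<close>. This will also identify the runs of a constructed
  matching with the prescribed cells.\<close>

lemma interval_rep_unique:
  assumes "interval_rep F l u k" "interval_rep F l' u' k'"
    and eq: "\<And>x y. x \<in> F \<Longrightarrow> y \<in> F \<Longrightarrow> u x < l y \<longleftrightarrow> u' x < l' y"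
  shows "k = k' \<and> (\<forall>x \<in> F. l x = l' x \<and> u x = u' x)"
proof -
  interpret A: interval_rep F l u k by fact
  interpret B: interval_rep F l' u' k' by fact
  have b: "A.below y = B.below y" if "y \<in> F" for y using eq that by (auto simp: A.below_def B.below_def)
  then have i: "A.below ` F = B.below ` F" by auto
  show ?thesis
    using A.card_below_image B.card_below_image A.l_eq_card B.l_eq_card A.u_eq_card B.u_eq_card b i by simp
qed

subsection \<open>Interval orders\<close>

locale interval_order = interval_rep +
  fixes r :: "'a rel"
  assumes r_subset: "r \<subseteq> F \<times> F"
    and r_iff: "x \<in> F \<Longrightarrow> y \<in> F \<Longrightarrow> (x, y) \<in> r \<longleftrightarrow> x = y \<or> u x < l y"
begin

lemma Field_r: "Field r = F"
  using r_subset r_iff by (auto simp: Field_def)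

lemma underS_r: "y \<in> F \<Longrightarrow> underS r y = below y"
  using r_subset r_iff l_le_u[of y] by (fastforce simp: underS_def below_def)

lemma underS_image: "underS r ` F = below ` F"
  using underS_r by auto

lemma labelled_mag_r: "labelled_mag r = k"
  by (simp add: labelled_mag_def Field_r underS_image card_below_image)

end

section \<open>Induced copies of posets with four elements\<close>

lemma contains_poset_iff:
  assumes refl: "\<forall>x\<in>Field r. (x, x) \<in> r" "\<forall>x\<in>Field s. (x, x) \<in> s"
  shows "contains_poset r s \<longleftrightarrow> (\<exists>g. inj_on g (Field s) \<and> g ` Field s \<subseteq> Field r \<and>
    (\<forall>i \<in> Field s. \<forall>j \<in> Field s. (g i, g j) \<in> r \<longleftrightarrow> (i, j) \<in> s))"
proof -
  have FB: "Field (r \<inter> B \<times> B) = B" if "B \<subseteq> Field r" for B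
  proof
    have "(x, x) \<in> r \<inter> B \<times> B" if "x \<in> B" for x using that \<open>B \<subseteq> Field r\<close> refl(1) by blast
    then show "B \<subseteq> Field (r \<inter> B \<times> B)" by (auto intro: FieldI1)
  qed (auto simp: Field_def)
  show ?thesis
  proof
    assume "contains_poset r s"
    then obtain B f where B: "B \<subseteq> Field r" "bij_betw f B (Field s)"
      "\<And>x y. x \<in> B \<Longrightarrow> y \<in> B \<Longrightarrow> (x, y) \<in> r \<longleftrightarrow> (f x, f y) \<in> s"
      unfolding contains_poset_def poset_iso_def using FB by fastforce
    let ?g = "inv_into B f"
    have g: "bij_betw ?g (Field s) B" by (rule bij_betw_inv_into[OF B(2)])
    have "(?g i, ?g j) \<in> r \<longleftrightarrow> (i, j) \<in> s" if "i \<in> Field s" "j \<in> Field s" for i j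
    proof -
      have "?g i \<in> B" "?g j \<in> B" using g that by (auto dest: bij_betwE)
      then show ?thesis using B(3) bij_betw_inv_into_right[OF B(2)] that by simp
    qed
    then show "\<exists>g. inj_on g (Field s) \<and> g ` Field s \<subseteq> Field r \<and>
      (\<forall>i \<in> Field s. \<forall>j \<in> Field s. (g i, g j) \<in> r \<longleftrightarrow> (i, j) \<in> s)"
      using g B(1) by (intro exI[of _ ?g]) (auto simp: bij_betw_def)
  next
    assume "\<exists>g. inj_on g (Field s) \<and> g ` Field s \<subseteq> Field r \<and>
      (\<forall>i \<in> Field s. \<forall>j \<in> Field s. (g i, g j) \<in> r \<longleftrightarrow> (i, j) \<in> s)"
    then obtain g where g: "inj_on g (Field s)" "g ` Field s \<subseteq> Field r"
      "\<And>i j. i \<in> Field s \<Longrightarrow> j \<in> Field s \<Longrightarrow> (g i, g j) \<in> r \<longleftrightarrow> (i, j) \<in> s" by blast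
    let ?B = "g ` Field s" and ?f = "inv_into (Field s) g"
    have "bij_betw ?f ?B (Field s)" using g(1) by (intro bij_betw_inv_into) (simp add: bij_betw_def)
    moreover have "(x, y) \<in> r \<inter> ?B \<times> ?B \<longleftrightarrow> (?f x, ?f y) \<in> s" if "x \<in> ?B" "y \<in> ?B" for x y
      using that g by auto
    ultimately show "contains_poset r s"
      unfolding contains_poset_def poset_iso_def using g(2) FB[OF g(2)] by (intro exI[of _ ?B]) auto
  qed
qed

lemma Fields:
  "Field two_plus_two = {1, 2, 3, 4}" "Field three_plus_one = {1, 2, 3, 4}" "Field poset_N = {1, 2, 3, 4}"
  by (auto simp: two_plus_two_def three_plus_one_def poset_N_def Field_def Id_on_def)

lemma refl_patterns:
  "\<forall>x\<in>Field two_plus_two. (x, x) \<in> two_plus_two"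
  "\<forall>x\<in>Field three_plus_one. (x, x) \<in> three_plus_one"
  "\<forall>x\<in>Field poset_N. (x, x) \<in> poset_N"
  unfolding Fields by (auto simp: two_plus_two_def three_plus_one_def poset_N_def)

lemma ex_fun_4:
  "(\<exists>g. P (g 1) (g 2) (g 3) (g (4::nat))) \<longleftrightarrow> (\<exists>a b c d. P a b c d)"
proof
  assume "\<exists>a b c d. P a b c d"
  then obtain a b c d where "P a b c d" by blast
  then show "\<exists>g. P (g 1) (g 2) (g 3) (g (4::nat))"
    by (intro exI[of _ "\<lambda>i. if i = 1 then a else if i = 2 then b else if i = 3 then c else d"]) simp
qed blast

text \<open>An embedding of a pattern on \<open>{1, 2, 3, 4}\<close>, unfolded into the twelve
  off-diagonal comparisons; these suffice between reflexive relations.\<close>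

definition copy_of :: "'a rel \<Rightarrow> nat rel \<Rightarrow> 'a \<Rightarrow> 'a \<Rightarrow> 'a \<Rightarrow> 'a \<Rightarrow> bool" where
  "copy_of r s a b c d \<longleftrightarrow> a \<in> Field r \<and> b \<in> Field r \<and> c \<in> Field r \<and> d \<in> Field r \<and> distinct [a, b, c, d] \<and>
    ((a, b) \<in> r \<longleftrightarrow> (1, 2) \<in> s) \<and> ((a, c) \<in> r \<longleftrightarrow> (1, 3) \<in> s) \<and> ((a, d) \<in> r \<longleftrightarrow> (1, 4) \<in> s) \<and>
    ((b, a) \<in> r \<longleftrightarrow> (2, 1) \<in> s) \<and> ((b, c) \<in> r \<longleftrightarrow> (2, 3) \<in> s) \<and> ((b, d) \<in> r \<longleftrightarrow> (2, 4) \<in> s) \<and>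
    ((c, a) \<in> r \<longleftrightarrow> (3, 1) \<in> s) \<and> ((c, b) \<in> r \<longleftrightarrow> (3, 2) \<in> s) \<and> ((c, d) \<in> r \<longleftrightarrow> (3, 4) \<in> s) \<and>
    ((d, a) \<in> r \<longleftrightarrow> (4, 1) \<in> s) \<and> ((d, b) \<in> r \<longleftrightarrow> (4, 2) \<in> s) \<and> ((d, c) \<in> r \<longleftrightarrow> (4, 3) \<in> s)"

lemma contains_poset_iff_copy:
  assumes refl: "\<forall>x\<in>Field r. (x, x) \<in> r"
    and s: "Field s = {1, 2, 3, 4 :: nat}" "\<forall>x\<in>Field s. (x, x) \<in> s"
  shows "contains_poset r s \<longleftrightarrow> (\<exists>a b c d. copy_of r s a b c d)"
proof -
  have "inj_on g {1, 2, 3, 4} \<and> g ` {1, 2, 3, 4} \<subseteq> Field r \<and>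
    (\<forall>i \<in> {1, 2, 3, 4}. \<forall>j \<in> {1, 2, 3, 4}. (g i, g j) \<in> r \<longleftrightarrow> (i, j) \<in> s) \<longleftrightarrow>
    copy_of r s (g 1) (g 2) (g 3) (g 4)" (is "?I \<and> ?F \<and> ?R \<longleftrightarrow> _") for g
  proof -
    have I: "?I \<longleftrightarrow> distinct [g 1, g 2, g 3, g 4]" by (auto simp: inj_on_def)
    have F: "?F \<longleftrightarrow> g 1 \<in> Field r \<and> g 2 \<in> Field r \<and> g 3 \<in> Field r \<and> g 4 \<in> Field r" by simp
    have s': "(1, 1) \<in> s" "(2, 2) \<in> s" "(3, 3) \<in> s" "(4, 4) \<in> s" using s by auto
    show ?thesis
    proof
      assume a: "?I \<and> ?F \<and> ?R"
      then have "(g i, g j) \<in> r \<longleftrightarrow> (i, j) \<in> s" if "i \<in> {1, 2, 3, 4}" "j \<in> {1, 2, 3, 4}" for i j using that by blast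
      then show "copy_of r s (g 1) (g 2) (g 3) (g 4)" unfolding copy_of_def using a I F by simp
    next
      assume c: "copy_of r s (g 1) (g 2) (g 3) (g 4)"
      then have IF: "?I" "?F" using I F by (simp_all add: copy_of_def)
      then have "(g 1, g 1) \<in> r" "(g 2, g 2) \<in> r" "(g 3, g 3) \<in> r" "(g 4, g 4) \<in> r" using refl by auto
      then have ?R using c s' by (simp add: copy_of_def)
      with IF show "?I \<and> ?F \<and> ?R" by blast
    qed
  qed
  then have "contains_poset r s \<longleftrightarrow> (\<exists>g. copy_of r s (g 1) (g 2) (g 3) (g (4 :: nat)))"
    unfolding contains_poset_iff[OF refl s(2)] s(1) by (simp only:)
  then show ?thesis unfolding ex_fun_4 .
qed

context interval_order
begin

lemma refl_r: "\<forall>x\<in>Field r. (x, x) \<in> r"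
  by (simp add: Field_r r_iff)

text \<open>Whichever of \<open>l b\<close> and \<open>l d\<close> is larger exceeds both
  \<open>u a\<close> and \<open>u c\<close>, so the two chains cannot be unrelated.\<close>

lemma not_contains_two_plus_two: "\<not> contains_poset r two_plus_two"
proof
  assume "contains_poset r two_plus_two"
  then obtain a b c d where "copy_of r two_plus_two a b c d"
    unfolding contains_poset_iff_copy[OF refl_r Fields(1) refl_patterns(1)] by blast
  then have "a \<in> F" "b \<in> F" "c \<in> F" "d \<in> F" "u a < l b" "u c < l d" "\<not> u a < l d" "\<not> u c < l b"
    by (auto simp: copy_of_def two_plus_two_def Field_r r_iff Id_on_def)
  then show False by linarith
qed

text \<open>The inner interval is the middle of the chain. Its ends are an element ending where the
  outer interval begins and one beginning where the outer interval ends; both exist because every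
  endpoint occurs.\<close>

lemma contains_three_plus_one: "contains_poset r three_plus_one \<longleftrightarrow> nested (cell ` F)"
proof
  assume "contains_poset r three_plus_one"
  then obtain a b c d where "copy_of r three_plus_one a b c d"
    unfolding contains_poset_iff_copy[OF refl_r Fields(2) refl_patterns(2)] by blast
  then have "a \<in> F" "b \<in> F" "c \<in> F" "d \<in> F" "u a < l b" "u b < l c" "\<not> u a < l d" "\<not> u d < l c"
    by (auto simp: copy_of_def three_plus_one_def Field_r r_iff Id_on_def)
  moreover from this have "l d < l b" "u b < u d" by linarith+
  ultimately show "nested (cell ` F)" unfolding nested_def by (force simp: cell_def)
next
  assume "nested (cell ` F)"
  then obtain b d where bd: "b \<in> F" "d \<in> F" "l d < l b" "u b < u d"
    unfolding nested_def by (auto simp: cell_def)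
  obtain a where a: "a \<in> F" "u a = l d" using obtain_u l_less bd by metis
  obtain c where c: "c \<in> F" "l c = u d" using obtain_l u_less bd by metis
  have "l a \<le> u a" "l b \<le> u b" "l c \<le> u c" "l d \<le> u d"
    using a bd c l_le_u[of a] l_le_u[of b] l_le_u[of c] l_le_u[of d] by auto
  then show "contains_poset r three_plus_one"
    using a bd c
    unfolding contains_poset_iff_copy[OF refl_r Fields(2) refl_patterns(2)]
    by - (rule exI[of _ a], rule exI[of _ b], rule exI[of _ c], rule exI[of _ d], auto simp: copy_of_def Field_r three_plus_one_def r_iff)
qed

text \<open>A copy satisfies \<open>l b \<le> u a < l c \<le> u b < l d \<le> u c\<close>, so
  \<open>b\<close> and \<open>c\<close> cross. A crossed pair is completed by an \<open>a\<close>
  that ends where \<open>b\<close> begins and a \<open>d\<close> that begins where \<open>c\<close>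
  ends.\<close>

lemma contains_poset_N: "contains_poset r poset_N \<longleftrightarrow> crossed (cell ` F)"
proof
  assume "contains_poset r poset_N"
  then obtain a b c d where "copy_of r poset_N a b c d"
    unfolding contains_poset_iff_copy[OF refl_r Fields(3) refl_patterns(3)] by blast
  then have abcd: "a \<in> F" "b \<in> F" "c \<in> F" "d \<in> F" "u a < l c" "u b < l d" "\<not> u a < l b" "\<not> u b < l c" "\<not> u c < l d"
    by (auto simp: copy_of_def poset_N_def Field_r r_iff Id_on_def)
  then have "l b < l c \<and> l c \<le> u b \<and> u b < u c" by linarith
  then show "crossed (cell ` F)" using abcd unfolding crossed_def by (force simp: cell_def)
next
  assume "crossed (cell ` F)"
  then obtain b c where bc: "b \<in> F" "c \<in> F" "l b < l c" "l c \<le> u b" "u b < u c"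
    unfolding crossed_def by (auto simp: cell_def)
  obtain a where a: "a \<in> F" "u a = l b" using obtain_u l_less bc by metis
  obtain d where d: "d \<in> F" "l d = u c" using obtain_l u_less bc by metis
  have "l a \<le> u a" "l b \<le> u b" "l c \<le> u c" "l d \<le> u d"
    using a bc d l_le_u[of a] l_le_u[of b] l_le_u[of c] l_le_u[of d] by auto
  then show "contains_poset r poset_N"
    using a bc d
    unfolding contains_poset_iff_copy[OF refl_r Fields(3) refl_patterns(3)]
    by - (rule exI[of _ a], rule exI[of _ b], rule exI[of _ c], rule exI[of _ d], auto simp: copy_of_def Field_r poset_N_def r_iff)
qed

end

context interval_rep
begin

lemma obtain_diagonal:
  assumes "\<not> crossed (cell ` F)"
  obtains e where "\<And>i. i < k \<Longrightarrow> e i \<in> F \<and> l (e i) = i \<and> u (e i) = i"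
proof -
  have "\<exists>x. x \<in> F \<and> l x = i \<and> u x = i" if "i < k" for i
    using diagonal_cell[OF cell_mset_in_cells _ that] assms unfolding set_cell_mset by (auto simp: cell_def)
  then show ?thesis using that by metis
qed

end

context interval_order
begin

text \<open>Comparable distinct elements have different lower endpoints, which bounds every chain by
  \<open>k\<close>; the diagonal elements form a chain of that size.\<close>

lemma labelled_height_r:
  assumes "\<not> crossed (cell ` F)"
  shows "labelled_height r = k"
  unfolding labelled_height_def
proof (rule Max_eqI)
  have sub: "C \<subseteq> F" if "C \<in> Chains r" for C
    using that r_subset unfolding Chains_def by blast
  have "Chains r \<subseteq> Pow F" using sub by blast
  then show "finite (card ` Chains r)" using finite_F finite_subset by blast
  fix m assume "m \<in> card ` Chains r"
  then obtain C where C: "C \<in> Chains r" "m = card C" by blast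
  have "inj_on l C"
  proof (rule inj_onI)
    fix x y assume xy: "x \<in> C" "y \<in> C" "l x = l y"
    then have F: "x \<in> F" "y \<in> F" using sub C by auto
    have "(x, y) \<in> r \<or> (y, x) \<in> r" using C xy by (auto simp: Chains_def)
    then show "x = y" using r_iff[of x y] r_iff[of y x] F xy(3) l_le_u[of x] l_le_u[of y] by auto
  qed
  then have "card C = card (l ` C)" by (simp add: card_image)
  also have "\<dots> \<le> card {..<k}" using l_image sub[OF C(1)] by (intro card_mono) auto
  finally show "m \<le> k" using C by simp
next
  obtain e where e: "\<And>i. i < k \<Longrightarrow> e i \<in> F \<and> l (e i) = i \<and> u (e i) = i"
    using obtain_diagonal[OF assms] by metis
  have "(e i, e j) \<in> r" if "i < k" "j < k" "i \<le> j" for i j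
    using e[OF that(1)] e[OF that(2)] that(3) r_iff by (cases "i = j") auto
  then have "e ` {..<k} \<in> Chains r" unfolding Chains_def by (auto simp: all_conj_distrib) (metis nat_le_linear)
  moreover have "card (e ` {..<k}) = k"
    by (subst card_image) (auto intro: inj_onI dest: e intro!: inj_on_inverseI[of _ l] simp: e)
  ultimately show "k \<in> card ` Chains r" by force
qed

end

text \<open>Without 2+2 the strict down-sets form a chain under inclusion. The endpoint
  \<open>l y\<close> is the rank of the down-set of \<open>y\<close> in this chain, and
  \<open>u x\<close> the rank of the last down-set that misses \<open>x\<close>; the counting
  formulas for interval representations force these choices.\<close>

lemma ex_interval_order:
  assumes po: "partial_order_on A r" and fin: "finite A" and free: "\<not> contains_poset r two_plus_two"
  shows "\<exists>l u k. interval_order A l u k r"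
proof -
  have sub: "r \<subseteq> A \<times> A" and refl: "\<And>x. x \<in> A \<Longrightarrow> (x, x) \<in> r"
    and tr: "\<And>x y z. (x, y) \<in> r \<Longrightarrow> (y, z) \<in> r \<Longrightarrow> (x, z) \<in> r"
    and anti: "\<And>x y. (x, y) \<in> r \<Longrightarrow> (y, x) \<in> r \<Longrightarrow> x = y"
    using po unfolding partial_order_on_def preorder_on_def refl_on_def by (auto dest: transD antisymD)
  have FA: "Field r = A" using sub refl by (auto simp: Field_def)
  have rr: "\<forall>x\<in>Field r. (x, x) \<in> r" using refl FA by simp
  let ?D = "underS r"
  have chain: "?D y \<subseteq> ?D z \<or> ?D z \<subseteq> ?D y" if "y \<in> A" "z \<in> A" for y z
  proof (rule ccontr)
    assume "\<not> (?D y \<subseteq> ?D z \<or> ?D z \<subseteq> ?D y)"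
    then obtain a c where ac: "(a, y) \<in> r" "a \<noteq> y" "\<not> ((a, z) \<in> r \<and> a \<noteq> z)" "(c, z) \<in> r" "c \<noteq> z" "\<not> ((c, y) \<in> r \<and> c \<noteq> y)"
      unfolding underS_def by blast
    have az: "a \<noteq> z" using ac tr[of c a y] anti[of c a] by blast
    have cy: "c \<noteq> y" using ac tr[of a c z] anti[of a c] by blast
    have n: "(a, z) \<notin> r" "(c, y) \<notin> r" using ac az cy by auto
    have F: "a \<in> A" "y \<in> A" "c \<in> A" "z \<in> A" using sub ac by auto
    have n': "(a, c) \<notin> r" "(c, a) \<notin> r" "(y, z) \<notin> r" "(z, y) \<notin> r" "(y, a) \<notin> r" "(z, c) \<notin> r" "(y, c) \<notin> r" "(z, a) \<notin> r"
      using n ac(1,2,4,5) tr anti by blast+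
    have d: "distinct [a, y, c, z]" using n n' refl F ac(2,5) by auto
    have "contains_poset r two_plus_two"
      unfolding contains_poset_iff_copy[OF rr Fields(1) refl_patterns(1)]
      using d F ac(1,4) n n'
      by - (rule exI[of _ a], rule exI[of _ y], rule exI[of _ c], rule exI[of _ z], auto simp: copy_of_def FA two_plus_two_def)
    then show False using free by simp
  qed
  define DD where "DD = ?D ` A"
  define l where "l y = card {Z \<in> DD. Z \<subset> ?D y}" for y
  define u where "u x = card {Z \<in> DD. x \<notin> Z} - 1" for x
  define k where "k = card DD"
  have finD: "finite DD" using fin by (simp add: DD_def)
  have self: "x \<notin> ?D x" for x by (simp add: underS_def)
  have less: "x \<in> ?D y \<longleftrightarrow> u x < l y" if "x \<in> A" "y \<in> A" for x y
  proof
    assume x: "x \<in> ?D y"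
    have "Z \<subset> ?D y" if "Z \<in> DD" "x \<notin> Z" for Z
      using chain[OF _ \<open>y \<in> A\<close>] that x unfolding DD_def by blast
    then have "card {Z \<in> DD. x \<notin> Z} \<le> l y" unfolding l_def using finD by (intro card_mono) auto
    moreover have "card {Z \<in> DD. x \<notin> Z} > 0" using finD self \<open>x \<in> A\<close> by (auto simp: card_gt_0_iff DD_def)
    ultimately show "u x < l y" by (simp add: u_def)
  next
    assume ul: "u x < l y"
    show "x \<in> ?D y"
    proof (rule ccontr)
      assume x: "x \<notin> ?D y"
      \<comment> \<open>If the down-set of \<open>y\<close> misses \<open>x\<close>, so does
        everything inside it: already \<open>l y + 1\<close> sets.\<close>
      have "insert (?D y) {Z \<in> DD. Z \<subset> ?D y} \<subseteq> {Z \<in> DD. x \<notin> Z}" using x that by (auto simp: DD_def)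
      then have "card (insert (?D y) {Z \<in> DD. Z \<subset> ?D y}) \<le> card {Z \<in> DD. x \<notin> Z}" using finD by (intro card_mono) auto
      then have "Suc (l y) \<le> card {Z \<in> DD. x \<notin> Z}" using finD by (simp add: l_def)
      then show False using ul by (simp add: u_def)
    qed
  qed
  have lu: "l x \<le> u x" if "x \<in> A" for x using less[OF that that] self by auto
  have uk: "u x < k" if "x \<in> A" for x
  proof -
    have "card {Z \<in> DD. x \<notin> Z} \<le> k" unfolding k_def using finD by (intro card_mono) auto
    moreover have "k > 0" unfolding k_def DD_def using that fin by (auto simp: card_gt_0_iff)
    ultimately show ?thesis by (simp add: u_def)
  qed
  have lA: "l ` A = {..<k}"
  proof -
    let ?c = "\<lambda>W. card {Z \<in> DD. Z \<subset> W}"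
    have "l ` A = ?c ` DD" by (auto simp: l_def DD_def)
    moreover have "inj_on ?c DD"
    proof (rule inj_onI)
      fix V W assume VW: "V \<in> DD" "W \<in> DD" "?c V = ?c W"
      have mono: "?c V < ?c W" if "V \<in> DD" "V \<subset> W" for V W
        using that finD by (intro psubset_card_mono) auto
      have "V \<subseteq> W \<or> W \<subseteq> V" using VW chain by (auto simp: DD_def)
      moreover have "\<not> V \<subset> W"
      proof
        assume "V \<subset> W"
        from mono[OF VW(1) this] VW(3) show False by simp
      qed
      moreover have "\<not> W \<subset> V"
      proof
        assume "W \<subset> V"
        from mono[OF VW(2) this] VW(3) show False by simp
      qed
      ultimately show "V = W" by blast
    qed
    ultimately have "card (l ` A) = card {..<k}" by (simp add: card_image k_def)
    moreover have "l ` A \<subseteq> {..<k}" using lu uk by (auto intro: le_less_trans)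
    ultimately show ?thesis by (intro card_subset_eq) auto
  qed
  have uA: "u ` A = {..<k}"
  proof (intro equalityI subsetI)
    fix i assume "i \<in> {..<k}"
    then obtain y where y: "y \<in> A" "l y = i" using lA by (metis imageE)
    \<comment> \<open>An element that separates the down-set of rank \<open>i\<close> from the one
      of rank \<open>i + 1\<close> has \<open>u x = i\<close>. For the last \<open>i\<close> the
      bounds \<open>l y \<le> u y < k\<close> leave no other value.\<close>
    show "i \<in> u ` A"
    proof (cases "Suc i < k")
      case True
      then obtain z where z: "z \<in> A" "l z = Suc i" using lA by (metis imageE lessThan_iff)
      have "\<not> ?D z \<subseteq> ?D y"
      proof
        assume "?D z \<subseteq> ?D y"
        then have "l z \<le> l y" unfolding l_def using finD by (intro card_mono) auto
        then show False using y z by simp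
      qed
      then obtain x where x: "x \<in> ?D z" "x \<notin> ?D y" by blast
      then have "x \<in> A" using sub by (auto simp: underS_def)
      then have "u x = i" using less[of x z] less[of x y] x y z by simp
      then show ?thesis using \<open>x \<in> A\<close> by blast
    next
      case False
      then have "u y = i" using lu[OF y(1)] uk[OF y(1)] y by simp
      then show ?thesis using y by blast
    qed
  qed (use uk in auto)
  have "interval_order A l u k r"
  proof
    fix x y assume "x \<in> A" "y \<in> A"
    then show "(x, y) \<in> r \<longleftrightarrow> x = y \<or> u x < l y" using less[of x y] refl by (auto simp: underS_def)
  qed (use fin lu lA uA sub in auto)
  then show ?thesis by blast
qed

section \<open>Unlabelled posets\<close>

text \<open>The counting formulas for \<open>l\<close> and \<open>u\<close>, applied to the bare
  relation. This gives an isomorphism invariant that refers to no chosen representation.\<close>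

definition poset_cells :: "'a rel \<Rightarrow> (nat \<times> nat) multiset" where
  "poset_cells r = image_mset (\<lambda>x. (card {Z \<in> underS r ` Field r. Z \<subset> underS r x},
     card {Z \<in> underS r ` Field r. x \<notin> Z} - 1)) (mset_set (Field r))"

lemma (in interval_order) poset_cells_r: "poset_cells r = cell_mset"
  unfolding poset_cells_def cell_mset_def Field_r underS_image
  using finite_F by (intro image_mset_cong) (simp add: cell_def l_eq_card u_eq_card underS_r)

text \<open>The source of isomorphisms: posets with equal multisets of cells are linked by a
  bijection that preserves cells.\<close>

lemma image_mset_eq_imp_bij_betw:
  assumes "finite A" "finite B" "image_mset f (mset_set A) = image_mset g (mset_set B)"
  shows "\<exists>h. bij_betw h A B \<and> (\<forall>x\<in>A. f x = g (h x))"
  using assms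
proof (induction A arbitrary: B rule: finite_induct)
  case empty
  then have "B = {}" by (metis image_mset_empty image_mset_is_empty_iff mset_set_empty_iff mset_set.empty)
  then show ?case by (auto simp: bij_betw_def)
next
  case (insert a A)
  have "f a \<in># image_mset g (mset_set B)" using insert.hyps insert.prems(2)[symmetric] by simp
  then obtain b where b: "b \<in> B" "g b = f a" using insert.prems(1) by auto
  have "mset_set B = add_mset b (mset_set (B - {b}))" using b insert.prems(1) by (simp add: mset_set.remove)
  then have "image_mset f (mset_set A) = image_mset g (mset_set (B - {b}))"
    using insert.prems(2) insert.hyps b by simp
  then obtain h where h: "bij_betw h A (B - {b})" "\<forall>x\<in>A. f x = g (h x)"
    using insert.IH[of "B - {b}"] insert.prems(1) by auto
  have "bij_betw (h(a := b)) A (B - {b})" using h(1) insert.hyps by (subst bij_betw_cong[of _ _ h]) auto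
  then have "bij_betw (h(a := b)) (insert a A) (insert b (B - {b}))"
    using notIn_Un_bij_betw[of a A "h(a := b)" "B - {b}"] insert.hyps by simp
  moreover have "insert b (B - {b}) = B" using b by blast
  moreover have "\<forall>x\<in>insert a A. f x = g ((h(a := b)) x)" using h(2) insert.hyps b by auto
  ultimately show ?case by metis
qed

lemma interval_order_iso:
  assumes "interval_order A l u k r" "partial_order_on B s" "poset_iso r s"
  shows "\<exists>l' u'. interval_order B l' u' k s \<and> poset_cells s = poset_cells r"
proof -
  interpret R: interval_order A l u k r by fact
  have sub: "s \<subseteq> B \<times> B" and refl: "\<And>x. x \<in> B \<Longrightarrow> (x, x) \<in> s"
    using assms(2) unfolding partial_order_on_def preorder_on_def refl_on_def by auto
  have FB: "Field s = B" using sub refl by (auto simp: Field_def)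
  obtain f where f: "bij_betw f A B" "\<And>x y. x \<in> A \<Longrightarrow> y \<in> A \<Longrightarrow> (x, y) \<in> r \<longleftrightarrow> (f x, f y) \<in> s"
    using assms(3) unfolding poset_iso_def R.Field_r FB by blast
  let ?g = "inv_into A f"
  have g: "bij_betw ?g B A" by (rule bij_betw_inv_into[OF f(1)])
  have gB: "?g ` B = A" "\<And>x. x \<in> B \<Longrightarrow> ?g x \<in> A" using g by (auto simp: bij_betw_def)
  have fg: "f (?g x) = x" if "x \<in> B" for x using bij_betw_inv_into_right[OF f(1) that] .
  have S: "interval_order B (l \<circ> ?g) (u \<circ> ?g) k s"
  proof
    show "finite B" using f(1) R.finite_F bij_betw_finite by blast
    show "(l \<circ> ?g) ` B = {..<k}" "(u \<circ> ?g) ` B = {..<k}"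
      unfolding image_comp[symmetric] gB(1) by (rule R.l_image R.u_image)+
    show "s \<subseteq> B \<times> B" by (rule sub)
    fix x assume x: "x \<in> B"
    show "(l \<circ> ?g) x \<le> (u \<circ> ?g) x" using R.l_le_u gB(2)[OF x] by simp
    fix y assume y: "y \<in> B"
    have "(x, y) \<in> s \<longleftrightarrow> (?g x, ?g y) \<in> r" using f(2) gB(2) x y fg by simp
    also have "\<dots> \<longleftrightarrow> ?g x = ?g y \<or> u (?g x) < l (?g y)" using R.r_iff gB(2) x y by simp
    also have "?g x = ?g y \<longleftrightarrow> x = y" using x y fg by metis
    finally show "(x, y) \<in> s \<longleftrightarrow> x = y \<or> (u \<circ> ?g) x < (l \<circ> ?g) y" by simp
  qed
  interpret S: interval_order B "l \<circ> ?g" "u \<circ> ?g" k s by fact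
  have "S.cell_mset = image_mset R.cell (image_mset ?g (mset_set B))"
  proof -
    have "S.cell = R.cell \<circ> ?g" by (rule ext) (simp only: S.cell_def R.cell_def comp_apply)
    then show ?thesis unfolding S.cell_mset_def by (simp only: multiset.map_comp)
  qed
  also have "image_mset ?g (mset_set B) = mset_set A"
    using g gB(1) by (subst image_mset_mset_set) (auto simp: bij_betw_def)
  finally have "poset_cells s = poset_cells r" unfolding S.poset_cells_r R.poset_cells_r R.cell_mset_def .
  then show ?thesis using S by blast
qed

text \<open>Comparability of distinct elements can be read off their cells, so a bijection
  preserving cells preserves the order; elements with equal cells cause no trouble, since
  injectivity takes care of the reflexive part.\<close>

lemma poset_iso_iff:
  assumes r: "partial_order_on A r" "\<not> contains_poset r two_plus_two"
    and s: "partial_order_on A s" and fin: "finite A"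
  shows "poset_iso r s \<longleftrightarrow> \<not> contains_poset s two_plus_two \<and> poset_cells s = poset_cells r"
proof
  obtain l u k where R: "interval_order A l u k r" using ex_interval_order[OF r(1) fin r(2)] by blast
  then interpret R: interval_order A l u k r .
  show "\<not> contains_poset s two_plus_two \<and> poset_cells s = poset_cells r" if "poset_iso r s"
    using interval_order_iso[OF R s that] interval_order.not_contains_two_plus_two by blast
  assume "\<not> contains_poset s two_plus_two \<and> poset_cells s = poset_cells r"
  then have s2: "\<not> contains_poset s two_plus_two" and eq: "poset_cells s = poset_cells r" by auto
  obtain l' u' k' where "interval_order A l' u' k' s" using ex_interval_order[OF s fin s2] by blast
  then interpret S: interval_order A l' u' k' s .
  have "image_mset R.cell (mset_set A) = image_mset S.cell (mset_set A)"
    using eq unfolding R.poset_cells_r S.poset_cells_r R.cell_mset_def S.cell_mset_def by simp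
  then obtain h where h: "bij_betw h A A" "\<forall>x\<in>A. R.cell x = S.cell (h x)"
    using image_mset_eq_imp_bij_betw[OF fin fin] by blast
  have "(x, y) \<in> r \<longleftrightarrow> (h x, h y) \<in> s" if "x \<in> A" "y \<in> A" for x y
  proof -
    have "h x \<in> A" "h y \<in> A" "h x = h y \<longleftrightarrow> x = y" using h(1) that by (auto simp: bij_betw_def inj_on_eq_iff)
    then show ?thesis using R.r_iff S.r_iff h(2) that by (auto simp: R.cell_def S.cell_def)
  qed
  then show "poset_iso r s" unfolding poset_iso_def R.Field_r S.Field_r using h(1) by blast
qed

lemma ex_interval_order_of_cells:
  assumes "A \<in> cells n k"
  shows "\<exists>l u r. interval_order {1..n} l u k r \<and> partial_order_on {1..n} r \<and> poset_cells r = A"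
proof -
  have A: "size A = n" "\<And>a b. (a, b) \<in># A \<Longrightarrow> a \<le> b" "fst ` set_mset A = {..<k}" "snd ` set_mset A = {..<k}"
    using assms by (auto simp: cells_def)
  obtain xs where xs: "mset xs = A" using ex_mset by blast
  then have len: "length xs = n" using A(1) by auto
  have img: "(\<lambda>i. xs ! (i - 1)) ` {1..n} = set_mset A"
  proof -
    have "{1..n} = Suc ` {..<n}" by (simp add: image_Suc_lessThan)
    then have "(\<lambda>i. xs ! (i - 1)) ` {1..n} = (!) xs ` {..<n}" by (simp add: image_image)
    also have "\<dots> = set xs" using len by (auto simp: set_conv_nth)
    finally show ?thesis using xs by auto
  qed
  define l where "l i = fst (xs ! (i - 1))" for i
  define u where "u i = snd (xs ! (i - 1))" for i
  define r where "r = {(i, j). i \<in> {1..n} \<and> j \<in> {1..n} \<and> (i = j \<or> u i < l j)}"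
  have lu: "l i \<le> u i" if "i \<in> {1..n}" for i
  proof -
    have "(l i, u i) \<in># A" using img that by (force simp: l_def u_def)
    then show ?thesis by (rule A(2))
  qed
  interpret interval_order "{1..n}" l u k r
  proof
    have "l ` {1..n} = fst ` (\<lambda>i. xs ! (i - 1)) ` {1..n}" "u ` {1..n} = snd ` (\<lambda>i. xs ! (i - 1)) ` {1..n}"
      by (simp_all add: l_def u_def image_image)
    then show "l ` {1..n} = {..<k}" "u ` {1..n} = {..<k}" unfolding img using A by auto
  qed (use lu in \<open>auto simp: r_def\<close>)
  have "partial_order_on {1..n} r"
    unfolding partial_order_on_def preorder_on_def
  proof (intro conjI)
    show "trans r"
    proof (rule transI)
      fix x y z assume "(x, y) \<in> r" "(y, z) \<in> r"
      then show "(x, z) \<in> r" using lu[of y] unfolding r_def by fastforce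
    qed
    show "antisym r"
    proof (rule antisymI)
      fix x y assume "(x, y) \<in> r" "(y, x) \<in> r"
      then show "x = y" using lu[of y] lu[of x] unfolding r_def by fastforce
    qed
  qed (auto simp: r_def refl_on_def)
  moreover have "cell_mset = A"
  proof -
    have "mset_set {1..n} = image_mset Suc (mset_set {..<n})"
      by (subst image_mset_mset_set) (simp_all add: image_Suc_lessThan)
    then have "cell_mset = image_mset ((!) xs) (mset_set {..<n})"
      unfolding cell_mset_def by (simp add: multiset.map_comp comp_def cell_def[abs_def] l_def u_def)
    also have "\<dots> = mset (map ((!) xs) [0..<n])" by (simp add: lessThan_atLeast0)
    also have "\<dots> = A" using xs len map_nth[of xs] by simp
    finally show ?thesis .
  qed
  ultimately show ?thesis using interval_order_axioms poset_cells_r by metis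
qed

section \<open>Isomorphism classes indexed by cells\<close>

lemma partial_orders_finite: "finite (labelled_posets n)"
proof -
  have "labelled_posets n \<subseteq> Pow ({1..n} \<times> {1..n})"
    by (auto simp: labelled_posets_def partial_order_on_def preorder_on_def)
  then show ?thesis by (rule finite_subset) simp
qed

text \<open>For a multiset in \<open>cells n k\<close> this is a single isomorphism class, that is,
  an element of the quotient; on classes it inverts \<open>poset_cells\<close>.\<close>

definition cells_class :: "nat \<Rightarrow> (nat \<times> nat) multiset \<Rightarrow> nat rel set" where
  "cells_class n A = {r \<in> labelled_posets n. \<not> contains_poset r two_plus_two \<and> poset_cells r = A}"

lemma cells_class_interval_order:
  assumes "A \<in> cells n k" "r \<in> cells_class n A"
  obtains l u where "interval_order {1..n} l u k r" "interval_rep.cell_mset {1..n} l u = A"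
proof -
  have r: "partial_order_on {1..n} r" "\<not> contains_poset r two_plus_two" "poset_cells r = A"
    using assms(2) by (auto simp: cells_class_def labelled_posets_def)
  obtain l u k' where "interval_order {1..n} l u k' r" using ex_interval_order[OF r(1) _ r(2)] by auto
  then interpret interval_order "{1..n}" l u k' r .
  have c: "cell_mset = A" using poset_cells_r r by simp
  then have "{..<k} = {..<k'}" using assms(1) cell_mset_in_cells by (auto simp: cells_def)
  then have "k' = k" by (metis card_lessThan)
  then show ?thesis using that interval_order_axioms c by blast
qed

lemma sum_posets_avoiding:
  fixes stat :: "nat rel set \<Rightarrow> nat" and lstat :: "nat rel \<Rightarrow> nat" and bad :: "(nat \<times> nat) set \<Rightarrow> bool"
  assumes n: "1 \<le> n"
    and bad: "\<And>l u k r. interval_order {1..n} l u k r \<Longrightarrow>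
      contains_poset r X \<longleftrightarrow> bad (interval_rep.cell l u ` {1..n})"
    and stat: "\<And>P. stat P = the_elem (lstat ` P)"
    and lstat: "\<And>l u k r. interval_order {1..n} l u k r \<Longrightarrow> \<not> bad (interval_rep.cell l u ` {1..n}) \<Longrightarrow> lstat r = k"
    and card: "\<And>k. int (card (cells_without bad n k)) = narayana n k"
  shows "(\<Sum>P \<in> two_plus_two_free_posets_avoiding n X. monom 1 (stat P)) = narayana_poly n"
proof -
  let ?G = "cells_class n" and ?T = "two_plus_two_free_posets_avoiding n X"
  let ?R = "{(r, s) \<in> labelled_posets n \<times> labelled_posets n. poset_iso r s}"
  have cls: "?R `` {r} = ?G (poset_cells r)" if "r \<in> labelled_posets n" "\<not> contains_poset r two_plus_two" for r
    using poset_iso_iff[of "{1..n}" r] that by (auto simp: cells_class_def labelled_posets_def)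
  have props: "\<exists>r. r \<in> ?G A" "r \<in> ?G A \<Longrightarrow> r \<in> labelled_posets n" "r \<in> ?G A \<Longrightarrow> \<not> contains_poset r two_plus_two"
     "r \<in> ?G A \<Longrightarrow> poset_cells r = A"
     "r \<in> ?G A \<Longrightarrow> contains_poset r X \<longleftrightarrow> bad (set_mset A)" "r \<in> ?G A \<Longrightarrow> \<not> bad (set_mset A) \<Longrightarrow> lstat r = k"
    if A: "A \<in> cells n k" for A k r
  proof -
    show "\<exists>r. r \<in> ?G A"
      using ex_interval_order_of_cells[OF A] interval_order.not_contains_two_plus_two
      unfolding cells_class_def labelled_posets_def by blast
    show "r \<in> ?G A \<Longrightarrow> r \<in> labelled_posets n" "r \<in> ?G A \<Longrightarrow> \<not> contains_poset r two_plus_two" "r \<in> ?G A \<Longrightarrow> poset_cells r = A"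
      by (auto simp: cells_class_def)
    assume r: "r \<in> ?G A"
    obtain l u where lu: "interval_order {1..n} l u k r" "interval_rep.cell_mset {1..n} l u = A"
      using cells_class_interval_order[OF A r] .
    interpret interval_order "{1..n}" l u k r by (rule lu(1))
    have "set_mset A = cell ` {1..n}" using set_cell_mset lu(2) by simp
    then show "contains_poset r X \<longleftrightarrow> bad (set_mset A)" "\<not> bad (set_mset A) \<Longrightarrow> lstat r = k"
      using bad[OF lu(1)] lstat[OF lu(1)] by simp_all
  qed
  have stat_G: "stat (?G A) = k" if "A \<in> cells n k" "\<not> bad (set_mset A)" for A k
  proof -
    \<comment> \<open>The labelled statistic is constant on the class, which is nonempty, so
      \<open>the_elem\<close> has a definite value.\<close>
    have "lstat ` ?G A = {k}" using props(1,6)[OF that(1)] that(2) by auto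
    then show ?thesis by (simp add: stat)
  qed
  have into: "?G A \<in> ?T" if A: "A \<in> cells n k" "\<not> bad (set_mset A)" for A k
  proof -
    obtain r where r: "r \<in> ?G A" using props(1)[OF A(1)] by blast
    have "?R `` {r} = ?G A" using cls props(2-4)[OF A(1) r] by simp
    moreover have "?R `` {r} \<in> unlabelled_posets n"
      unfolding unlabelled_posets_def by (rule quotientI[OF props(2)[OF A(1) r]])
    ultimately have "?G A \<in> unlabelled_posets n" by simp
    then show ?thesis
      unfolding two_plus_two_free_posets_avoiding_def two_plus_two_free_posets_def
      using props(3,5)[OF A(1)] A(2) by blast
  qed
  have onto: "\<exists>A k. A \<in> cells n k \<and> \<not> bad (set_mset A) \<and> P = ?G A" if P: "P \<in> ?T" for P
  proof -
    obtain r where r: "r \<in> labelled_posets n" "P = ?R `` {r}"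
      using P unfolding two_plus_two_free_posets_avoiding_def two_plus_two_free_posets_def unlabelled_posets_def
      by (auto elim!: quotientE)
    have "poset_iso r r" unfolding poset_iso_def by (intro exI[of _ id]) auto
    then have rP: "r \<in> P" using r by auto
    then have av: "\<not> contains_poset r two_plus_two" "\<not> contains_poset r X"
      using P unfolding two_plus_two_free_posets_avoiding_def two_plus_two_free_posets_def by auto
    then have PG: "P = ?G (poset_cells r)" using cls r by simp
    obtain l u k where "interval_order {1..n} l u k r"
      using ex_interval_order[of "{1..n}" r] r(1) av(1) by (auto simp: labelled_posets_def)
    then interpret interval_order "{1..n}" l u k r .
    have "poset_cells r \<in> cells n k" using poset_cells_r cell_mset_in_cells by simp
    moreover from this have "\<not> bad (set_mset (poset_cells r))" using props(5) rP PG av(2) by metis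
    ultimately show ?thesis using PG by blast
  qed
  have G_inj: "A = B" if "A \<in> cells n k" "B \<in> cells n m" "?G A = ?G B" for A B k m
    using props(1)[OF that(1)] props(4)[OF that(1)] props(4)[OF that(2)] that(3) by metis
  have "?T \<subseteq> Pow (labelled_posets n)"
  proof
    fix P assume "P \<in> ?T"
    then obtain A k where "A \<in> cells n k" "P = ?G A" using onto by blast
    then show "P \<in> Pow (labelled_posets n)" using props(2) by blast
  qed
  then have "finite ?T" using partial_orders_finite by (meson finite_Pow_iff finite_subset)
  then show ?thesis using n card into stat_G onto G_inj by (rule sum_via_cells[where G = ?G]) blast+
qed

lemma three_plus_one_free_narayana:
  "1 \<le> n \<Longrightarrow> (\<Sum>P \<in> two_plus_two_free_posets_avoiding n three_plus_one. monom 1 (mag P)) = narayana_poly n"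
  by (rule sum_posets_avoiding[where bad = nested and lstat = labelled_mag])
    (auto simp: interval_order.contains_three_plus_one interval_order.labelled_mag_r mag_def card_nonnested_cells)

lemma N_free_mag_narayana:
  "1 \<le> n \<Longrightarrow> (\<Sum>P \<in> two_plus_two_free_posets_avoiding n poset_N. monom 1 (mag P)) = narayana_poly n"
  by (rule sum_posets_avoiding[where bad = crossed and lstat = labelled_mag])
    (auto simp: interval_order.contains_poset_N interval_order.labelled_mag_r mag_def card_uncrossed_cells)

lemma N_free_height_narayana:
  "1 \<le> n \<Longrightarrow> (\<Sum>P \<in> two_plus_two_free_posets_avoiding n poset_N. monom 1 (height P)) = narayana_poly n"
  by (rule sum_posets_avoiding[where bad = crossed and lstat = labelled_height])
    (auto simp: interval_order.contains_poset_N interval_order.labelled_height_r height_def card_uncrossed_cells)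

section \<open>Stoimenow matchings\<close>

text \<open>Disjointness of the blocks in terms of coordinates. The remaining clash
  \<open>fst f = snd e\<close> is covered by exchanging \<open>e\<close> and
  \<open>f\<close>.\<close>

lemma matching_iff:
  "matching n M \<longleftrightarrow> (\<forall>e \<in> M. fst e < snd e) \<and> fst ` M \<union> snd ` M = {1..2 * n} \<and>
    (\<forall>e \<in> M. \<forall>f \<in> M. e \<noteq> f \<longrightarrow> fst e \<noteq> fst f \<and> snd e \<noteq> snd f \<and> fst e \<noteq> snd f)"
proof (cases "\<forall>e \<in> M. fst e < snd e")
  case True
  let ?B = "\<lambda>(a, b). {a, b :: nat}"
  have U: "\<Union> (?B ` M) = fst ` M \<union> snd ` M" by force
  have inj: "?B e = ?B f \<Longrightarrow> e = f" if "e \<in> M" "f \<in> M" for e f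
  proof -
    have "fst e < snd e" "fst f < snd f" using True that by auto
    moreover assume "?B e = ?B f"
    then have "{fst e, snd e} = {fst f, snd f}" by (simp add: case_prod_unfold)
    ultimately show "e = f" unfolding doubleton_eq_iff prod_eq_iff by linarith
  qed
  have "disjoint (?B ` M) \<longleftrightarrow> (\<forall>e \<in> M. \<forall>f \<in> M. ?B e \<noteq> ?B f \<longrightarrow> ?B e \<inter> ?B f = {})"
    by (simp only: disjoint_def ball_simps)
  also have "\<dots> \<longleftrightarrow> (\<forall>e \<in> M. \<forall>f \<in> M. e \<noteq> f \<longrightarrow> ?B e \<inter> ?B f = {})"
  proof (intro ball_cong refl)
    fix e f assume "e \<in> M" "f \<in> M"
    then have "?B e \<noteq> ?B f \<longleftrightarrow> e \<noteq> f" using inj[of e f] by blast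
    then show "(?B e \<noteq> ?B f \<longrightarrow> ?B e \<inter> ?B f = {}) \<longleftrightarrow> (e \<noteq> f \<longrightarrow> ?B e \<inter> ?B f = {})" by simp
  qed
  also have "\<dots> \<longleftrightarrow> (\<forall>e \<in> M. \<forall>f \<in> M. e \<noteq> f \<longrightarrow> fst e \<noteq> fst f \<and> snd e \<noteq> snd f \<and> fst e \<noteq> snd f)"
  proof -
    have I: "?B e \<inter> ?B f = {} \<longleftrightarrow> fst e \<noteq> fst f \<and> snd e \<noteq> snd f \<and> fst e \<noteq> snd f \<and> fst f \<noteq> snd e" for e f
      by (auto simp: case_prod_unfold)
    show ?thesis unfolding I
    proof (intro iffI ballI impI)
      fix e f
      assume "\<forall>e\<in>M. \<forall>f\<in>M. e \<noteq> f \<longrightarrow> fst e \<noteq> fst f \<and> snd e \<noteq> snd f \<and> fst e \<noteq> snd f" "e \<in> M" "f \<in> M" "e \<noteq> f"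
      then have "fst e \<noteq> fst f \<and> snd e \<noteq> snd f \<and> fst e \<noteq> snd f" "fst f \<noteq> snd e" by simp_all
      then show "fst e \<noteq> fst f \<and> snd e \<noteq> snd f \<and> fst e \<noteq> snd f \<and> fst f \<noteq> snd e" by simp
    qed simp
  qed
  finally have D: "disjoint (?B ` M) \<longleftrightarrow> (\<forall>e \<in> M. \<forall>f \<in> M. e \<noteq> f \<longrightarrow> fst e \<noteq> fst f \<and> snd e \<noteq> snd f \<and> fst e \<noteq> snd f)" .
  have "{} \<notin> ?B ` M" by auto
  then show ?thesis unfolding matching_def partition_on_def U D using True by (auto simp: case_prod_unfold)
next
  case False
  then show ?thesis unfolding matching_def by (auto simp: case_prod_unfold)
qed

section \<open>Runs of openers and closers as an interval representation\<close>

lemma chain_less: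
  fixes h :: "nat \<Rightarrow> nat"
  assumes "\<And>p. a \<le> p \<Longrightarrow> p < b \<Longrightarrow> h p < h (Suc p)" "a < b"
  shows "h a < h b"
  using assms
proof (induction b)
  case (Suc b)
  then show ?case by (cases "a = b") (auto intro: less_trans[of _ "h b"])
qed simp

text \<open>From left to right the points form blocks, each a run of openers followed by a run of
  closers; every block but the last ends at a turn.\<close>

definition turns :: "arc set \<Rightarrow> nat set" where
  "turns M = {i \<in> snd ` M. Suc i \<in> fst ` M}"

definition run :: "arc set \<Rightarrow> nat \<Rightarrow> nat" where
  "run M p = card {i \<in> turns M. i < p}"

locale stoimenow_matching =
  fixes n :: nat and M :: "arc set"
  assumes n_pos: "1 \<le> n" and matching_M: "matching n M" and stoimenow_M: "stoimenow M"
begin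

lemma arc_less: "e \<in> M \<Longrightarrow> fst e < snd e"
  and points: "fst ` M \<union> snd ` M = {1..2 * n}"
  and arcs_distinct: "e \<in> M \<Longrightarrow> f \<in> M \<Longrightarrow> e \<noteq> f \<Longrightarrow> fst e \<noteq> fst f \<and> snd e \<noteq> snd f \<and> fst e \<noteq> snd f"
  using matching_M unfolding matching_iff by blast+

lemma inj_fst: "inj_on fst M" and inj_snd: "inj_on snd M"
  using arcs_distinct by (meson inj_onI)+

lemma fst_neq_snd: "e \<in> M \<Longrightarrow> f \<in> M \<Longrightarrow> fst e \<noteq> snd f"
  using arcs_distinct arc_less by (metis less_irrefl)

lemma finite_M: "finite M"
proof -
  have "finite (fst ` M)" by (rule finite_subset[of _ "{1..2 * n}"]) (use points in auto)
  then show ?thesis using inj_fst finite_imageD by blast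
qed

lemma card_M: "card M = n"
proof -
  have "fst ` M \<inter> snd ` M = {}" using fst_neq_snd by auto
  then have "card (fst ` M \<union> snd ` M) = card (fst ` M) + card (snd ` M)" using finite_M by (intro card_Un_disjoint) auto
  then show ?thesis using points inj_fst inj_snd by (simp add: card_image)
qed

lemma finite_turns: "finite (turns M)"
  using finite_M by (simp add: turns_def)

lemma run_mono: "p \<le> q \<Longrightarrow> run M p \<le> run M q"
  unfolding run_def using finite_turns by (intro card_mono) auto

text \<open>The last closer before \<open>fst f\<close> is a turn: the point after it is at most
  \<open>fst f\<close> and can only be an opener.\<close>

lemma run_less:
  assumes "e \<in> M" "f \<in> M" "snd e < fst f"
  shows "run M (snd e) < run M (fst f)"
proof -
  let ?S = "{i \<in> snd ` M. i < fst f}"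
  define i where "i = Max ?S"
  have fS: "finite ?S" "?S \<noteq> {}" using finite_M assms by auto
  then have i: "i \<in> ?S" unfolding i_def by (rule Max_in)
  have mx: "\<And>j. j \<in> ?S \<Longrightarrow> j \<le> i" unfolding i_def using fS by simp
  have ge: "snd e \<le> i" using mx assms by auto
  have "Suc i \<in> fst ` M"
  proof (cases "Suc i = fst f")
    case True
    then show ?thesis using assms by simp
  next
    case False
    then have l: "Suc i < fst f" using i by simp
    have "fst f \<in> {1..2 * n}" using points assms by blast
    then have "Suc i \<in> fst ` M \<union> snd ` M" unfolding points using l by simp
    moreover have "Suc i \<notin> snd ` M"
    proof
      assume "Suc i \<in> snd ` M"
      then show False using mx[of "Suc i"] l by simp
    qed
    ultimately show ?thesis by blast
  qed
  then have "i \<in> turns M" using i by (auto simp: turns_def)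
  then have "i \<in> {i \<in> turns M. i < fst f}" "i \<notin> {i \<in> turns M. i < snd e}" using i ge by auto
  moreover have "{i \<in> turns M. i < snd e} \<subseteq> {i \<in> turns M. i < fst f}" using assms by auto
  ultimately have "{i \<in> turns M. i < snd e} \<subset> {i \<in> turns M. i < fst f}" by blast
  then show ?thesis unfolding run_def using finite_turns by (intro psubset_card_mono) auto
qed

definition row :: "arc \<Rightarrow> nat" where "row e = run M (fst e)"
definition col :: "arc \<Rightarrow> nat" where "col e = run M (snd e)"
definition runs :: nat where "runs = Suc (card (turns M))"

text \<open>Through this equivalence, closer before opener takes the part that the strict order has
  for posets.\<close>

lemma col_less_row_iff: "e \<in> M \<Longrightarrow> f \<in> M \<Longrightarrow> col e < row f \<longleftrightarrow> snd e < fst f"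
  unfolding row_def col_def using run_less[of e f] run_mono[of "fst f" "snd e"] by linarith

lemma run_bound: "run M p < runs"
  unfolding run_def runs_def less_Suc_eq_le using finite_turns by (intro card_mono) auto

sublocale interval_rep M row col runs
proof
  show "finite M" by (rule finite_M)
  show "row e \<le> col e" if "e \<in> M" for e
    unfolding row_def col_def using arc_less[OF that] by (intro run_mono) simp
  have M_ne: "M \<noteq> {}" using card_M n_pos by auto
  \<comment> \<open>This is the \<open>j\<close>-th turn: the opener right after it lies in row
    \<open>j\<close>, while the turn itself is a closer in column \<open>j - 1\<close>.\<close>
  have pos: "\<exists>i \<in> turns M. run M (Suc i) = j \<and> run M i = j - 1" if "j \<in> {1..card (turns M)}" for j
  proof -
    obtain i where i: "i \<in> turns M" "card {a \<in> turns M. a \<le> i} = j"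
      using bij_betw_rank[OF finite_turns] \<open>j \<in> _\<close> unfolding bij_betw_def by (metis (no_types, lifting) imageE)
    have "{a \<in> turns M. a < Suc i} = {a \<in> turns M. a \<le> i}" by auto
    moreover have "{a \<in> turns M. a < i} = {a \<in> turns M. a \<le> i} - {i}" by auto
    ultimately show ?thesis using i finite_turns by (intro bexI[of _ i]) (auto simp: run_def)
  qed
  show "row ` M = {..<runs}"
  proof (intro equalityI subsetI)
    fix j assume "j \<in> {..<runs}"
    then consider "j = 0" | "j \<in> {1..card (turns M)}" by (force simp: runs_def)
    then show "j \<in> row ` M"
    proof cases
      case 1
      obtain e where e: "e \<in> M" "\<And>f. f \<in> M \<Longrightarrow> fst e \<le> fst f"
        using ex_min_if_finite[of "fst ` M"] finite_M M_ne by (auto simp: not_less)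
      have "fst e < i" if "i \<in> turns M" for i
        using that arc_less e(2) by (force simp: turns_def)
      then have "{i \<in> turns M. i < fst e} = {}" by (auto dest: less_asym)
      then have "row e = j" using 1 by (simp add: row_def run_def)
      then show ?thesis using e(1) by blast
    next
      case 2
      then obtain i where i: "i \<in> turns M" "run M (Suc i) = j" using pos by blast
      then obtain e where "e \<in> M" "fst e = Suc i" by (auto simp: turns_def)
      then have "row e = j" using i by (simp add: row_def)
      then show ?thesis using \<open>e \<in> M\<close> by blast
    qed
  qed (use run_bound in \<open>auto simp: row_def\<close>)
  show "col ` M = {..<runs}"
  proof (intro equalityI subsetI)
    fix j assume "j \<in> {..<runs}"
    then consider "j = card (turns M)" | "Suc j \<in> {1..card (turns M)}" by (force simp: runs_def)
    then show "j \<in> col ` M"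
    proof cases
      case 1
      have "Max (snd ` M) \<in> snd ` M" using finite_M M_ne by simp
      then obtain e where e: "e \<in> M" "snd e = Max (snd ` M)" by (metis imageE)
      then have e: "e \<in> M" "\<And>f. f \<in> M \<Longrightarrow> snd f \<le> snd e" using finite_M by simp_all
      have "i < snd e" if "i \<in> turns M" for i
        using that arc_less e(2) by (force simp: turns_def)
      then have "{i \<in> turns M. i < snd e} = turns M" by auto
      then have "col e = j" using 1 by (simp add: col_def run_def)
      then show ?thesis using e(1) by blast
    next
      case 2
      then obtain i where i: "i \<in> turns M" "run M i = j" using pos by fastforce
      then obtain e where "e \<in> M" "snd e = i" by (auto simp: turns_def)
      then have "col e = j" using i by (simp add: col_def)
      then show ?thesis using \<open>e \<in> M\<close> by blast
    qed
  qed (use run_bound in \<open>auto simp: col_def\<close>)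
qed

text \<open>Between two openers of one row there are only openers, and the ban on nestings with
  adjacent openers makes the closer grow at every step.\<close>

lemma same_row_less:
  assumes "e \<in> M" "f \<in> M" "row e = row f" "fst e < fst f"
  shows "snd e < snd f"
proof -
  have op: "p \<in> fst ` M" if "fst e \<le> p" "p \<le> fst f" for p
  proof (rule ccontr)
    assume "p \<notin> fst ` M"
    moreover have "p \<in> {1..2 * n}"
    proof -
      have "fst e \<in> {1..2 * n}" "fst f \<in> {1..2 * n}" using points assms by blast+
      then show ?thesis using that by simp
    qed
    ultimately obtain g where g: "g \<in> M" "snd g = p" using points by blast
    then have "snd g < fst f" using that fst_neq_snd[OF assms(2) g(1)] by simp
    then have "col g < row f" using col_less_row_iff g assms by simp
    moreover have "row e \<le> col g" unfolding row_def col_def using that g by (intro run_mono) simp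
    ultimately show False using assms(3) by simp
  qed
  define h where "h p = snd (inv_into M fst p)" for p
  have h: "(p, h p) \<in> M" if "fst e \<le> p" "p \<le> fst f" for p
    using inv_into_into[OF op[OF that]] f_inv_into_f[OF op[OF that]] by (metis h_def prod.collapse)
  have "h p < h (Suc p)" if "fst e \<le> p" "p < fst f" for p
  proof -
    have *: "(p, h p) \<in> M" "(p + 1, h (Suc p)) \<in> M" using h that by simp_all
    then have "\<not> (p + 1 < h (Suc p) \<and> h (Suc p) < h p)" using stoimenow_M unfolding stoimenow_def by blast
    then have "\<not> h (Suc p) < h p" using arc_less[OF *(2)] by simp
    then show ?thesis using arcs_distinct[OF *] by simp
  qed
  then have "h (fst e) < h (fst f)" using assms(4) by (rule chain_less)
  moreover have "h (fst e) = snd e" "h (fst f) = snd f"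
    using arcs_distinct[OF h[of "fst e"] assms(1)] arcs_distinct[OF h[of "fst f"] assms(2)] assms(4)
    by (auto simp: prod_eq_iff)
  ultimately show ?thesis by simp
qed

text \<open>The mirror image: only closers lie in between, and the ban on nestings with adjacent
  closers makes the opener grow at every step.\<close>

lemma same_col_less:
  assumes "e \<in> M" "f \<in> M" "col e = col f" "snd e < snd f"
  shows "fst e < fst f"
proof -
  have cl: "p \<in> snd ` M" if "snd e \<le> p" "p \<le> snd f" for p
  proof (rule ccontr)
    assume "p \<notin> snd ` M"
    moreover have "p \<in> {1..2 * n}"
    proof -
      have "snd e \<in> {1..2 * n}" "snd f \<in> {1..2 * n}" using points assms by blast+
      then show ?thesis using that by simp
    qed
    ultimately have "p \<in> fst ` M" using points by (metis UnE)
    then obtain g where g: "g \<in> M" "fst g = p" by blast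
    then have "snd e < fst g" using that fst_neq_snd[OF g(1) assms(1)] by simp
    then have "col e < row g" using col_less_row_iff[OF assms(1) g(1)] by simp
    moreover have "row g \<le> col f" unfolding row_def col_def using that g by (intro run_mono) simp
    ultimately show False using assms(3) by simp
  qed
  define h where "h p = fst (inv_into M snd p)" for p
  have h: "(h p, p) \<in> M" if "snd e \<le> p" "p \<le> snd f" for p
    using inv_into_into[OF cl[OF that]] f_inv_into_f[OF cl[OF that]] by (metis h_def prod.collapse)
  have "h p < h (Suc p)" if "snd e \<le> p" "p < snd f" for p
  proof -
    have *: "(h p, p) \<in> M" "(h (Suc p), p + 1) \<in> M" using h that by simp_all
    then have "\<not> (h (Suc p) < h p \<and> h p < p)" using stoimenow_M unfolding stoimenow_def by blast
    then have "\<not> h (Suc p) < h p" using arc_less[OF *(1)] by simp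
    then show ?thesis using arcs_distinct[OF *] by simp
  qed
  then have "h (snd e) < h (snd f)" using assms(4) by (rule chain_less)
  moreover have "h (snd e) = fst e" "h (snd f) = fst f"
    using arcs_distinct[OF h[of "snd e"] assms(1)] arcs_distinct[OF h[of "snd f"] assms(2)] assms(4)
    by (auto simp: prod_eq_iff)
  ultimately show ?thesis by simp
qed

lemma fst_less_if_row: "e \<in> M \<Longrightarrow> f \<in> M \<Longrightarrow> row e < row f \<Longrightarrow> fst e < fst f"
  unfolding row_def using run_mono by (metis not_less)

lemma snd_less_if_col: "e \<in> M \<Longrightarrow> f \<in> M \<Longrightarrow> col e < col f \<Longrightarrow> snd e < snd f"
  unfolding col_def using run_mono by (metis not_less)

lemma fst_less_iff: "e \<in> M \<Longrightarrow> f \<in> M \<Longrightarrow> row e = row f \<Longrightarrow> fst e < fst f \<longleftrightarrow> snd e < snd f"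
  using same_row_less[of e f] same_row_less[of f e] arcs_distinct[of e f] by (cases "e = f") (auto, (metis linorder_neqE_nat)+)

lemma snd_less_iff: "e \<in> M \<Longrightarrow> f \<in> M \<Longrightarrow> col e = col f \<Longrightarrow> fst e < fst f \<longleftrightarrow> snd e < snd f"
  using same_col_less[of e f] same_col_less[of f e] arcs_distinct[of e f] by (cases "e = f") (auto, (metis linorder_neqE_nat)+)

end

subsection \<open>The matching with given cells\<close>

text \<open>A position is the number of points up to it. For cells in lexicographic order the
  openers follow the list, which accounts for \<open>Suc j\<close>; the closers passed are those
  whose column is below the row of the cell.\<close>

definition opener_at :: "(nat \<times> nat) list \<Rightarrow> nat \<Rightarrow> nat" where
  "opener_at zs j = Suc j + card {i. i < length zs \<and> snd (zs ! i) < fst (zs ! j)}"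

text \<open>The closer of a cell stands behind the openers of all rows up to its column. Closers are
  ordered by column and, inside a column, by list index: the order that the Stoimenow condition
  forces.\<close>

definition closer_at :: "(nat \<times> nat) list \<Rightarrow> nat \<Rightarrow> nat" where
  "closer_at zs j = card {i. i < length zs \<and> fst (zs ! i) \<le> snd (zs ! j)} +
     card {i. i < length zs \<and> (snd (zs ! i) < snd (zs ! j) \<or> snd (zs ! i) = snd (zs ! j) \<and> i \<le> j)}"

definition arcs_of :: "(nat \<times> nat) list \<Rightarrow> arc set" where
  "arcs_of zs = (\<lambda>j. (opener_at zs j, closer_at zs j)) ` {..<length zs}"

lemma card_filter_nth:
  assumes "distinct xs"
  shows "card {x \<in> set xs. P x} = card {i. i < length xs \<and> P (xs ! i)}"
proof -
  have "{x \<in> set xs. P x} = (!) xs ` {i. i < length xs \<and> P (xs ! i)}" by (auto simp: in_set_conv_nth)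
  moreover have "inj_on ((!) xs) {i. i < length xs \<and> P (xs ! i)}"
    using assms by (auto simp: inj_on_def nth_eq_iff_index_eq)
  ultimately show ?thesis by (simp add: card_image)
qed

context stoimenow_matching
begin

lemma sorted_arcs:
  assumes "S \<subseteq> M" "i < j" "j < length (sorted_list_of_set S)"
  shows "fst (sorted_list_of_set S ! i) < fst (sorted_list_of_set S ! j)"
proof -
  let ?xs = "sorted_list_of_set S"
  have xs: "set ?xs = S" "distinct ?xs" "sorted ?xs" using finite_subset[OF assms(1) finite_M] by simp_all
  have "?xs ! i \<le> ?xs ! j" using sorted_nth_mono[OF xs(3)] assms by simp
  moreover have "?xs ! i \<noteq> ?xs ! j" using xs(2) assms by (simp add: nth_eq_iff_index_eq)
  moreover have "?xs ! i \<in> set ?xs" "?xs ! j \<in> set ?xs" using assms by simp_all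
  then have "?xs ! i \<in> M" "?xs ! j \<in> M" using xs(1) assms(1) by auto
  ultimately show ?thesis using arcs_distinct[of "?xs ! i" "?xs ! j"] by (auto simp: less_eq_prod_def)
qed

text \<open>Arcs sorted by opener have lexicographically sorted cells, because inside a row the
  closers increase as well. Counting the points up to each endpoint then returns the arcs.\<close>

lemma arcs_of_cells:
  "sorted (map cell (sorted_list_of_set M)) \<and> arcs_of (map cell (sorted_list_of_set M)) = M"
proof -
  define xs where "xs = sorted_list_of_set M"
  have xs: "set xs = M" "distinct xs" "sorted xs" using finite_M by (simp_all add: xs_def)
  have len: "length xs = n" using distinct_card[OF xs(2)] xs(1) card_M by simp
  have mem: "xs ! i \<in> M" if "i < n" for i using xs(1) len that by auto
  have less: "fst (xs ! i) < fst (xs ! j)" if "i < j" "j < n" for i j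
    using sorted_arcs[of M] that len unfolding xs_def by blast
  have le_iff: "fst (xs ! i) \<le> fst (xs ! j) \<longleftrightarrow> i \<le> j" if "i < n" "j < n" for i j
    using less[of i j] less[of j i] that by (metis le_less linorder_neqE_nat not_less)
  have "cell (xs ! i) \<le> cell (xs ! j)" if "i < j" "j < n" for i j
  proof -
    have l: "fst (xs ! i) < fst (xs ! j)" using less that by simp
    have "row (xs ! i) \<le> row (xs ! j)" unfolding row_def using l by (intro run_mono) simp
    moreover have "col (xs ! i) \<le> col (xs ! j)" if "row (xs ! i) = row (xs ! j)"
    proof -
      have "snd (xs ! i) < snd (xs ! j)" using same_row_less[OF mem mem that l] \<open>i < j\<close> \<open>j < n\<close> by simp
      then show ?thesis unfolding col_def by (intro run_mono) simp
    qed
    ultimately show ?thesis unfolding cell_def less_eq_prod_def by (simp add: le_less) blast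
  qed
  then have srt: "sorted (map cell xs)" using len by (simp add: sorted_wrt_iff_nth_less)
  \<comment> \<open>Each point of \<open>1..2n\<close> is exactly one opener or closer, so a
    position is the number of openers plus the number of closers not beyond it.\<close>
  have split: "p = card {e \<in> M. fst e \<le> p} + card {e \<in> M. snd e \<le> p}" if "p \<in> {1..2 * n}" for p
  proof -
    have "{1..p} = fst ` {e \<in> M. fst e \<le> p} \<union> snd ` {e \<in> M. snd e \<le> p}" (is "?L = ?A \<union> ?B")
    proof -
      have "{1..p} = {q \<in> fst ` M \<union> snd ` M. q \<le> p}" unfolding points using that by auto
      also have "\<dots> = ?A \<union> ?B" by auto
      finally show ?thesis .
    qed
    moreover have "?A \<inter> ?B = {}" using fst_neq_snd by auto
    ultimately have "card {1..p} = card ?A + card ?B" using finite_M by (simp add: card_Un_disjoint)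
    moreover have "card ?A = card {e \<in> M. fst e \<le> p}" by (rule card_image) (rule inj_on_subset[OF inj_fst], auto)
    moreover have "card ?B = card {e \<in> M. snd e \<le> p}" by (rule card_image) (rule inj_on_subset[OF inj_snd], auto)
    ultimately show ?thesis by simp
  qed
  have cf: "card {e \<in> M. P e} = card {i. i < n \<and> P (xs ! i)}" for P
    using card_filter_nth[OF xs(2), of P] xs(1) len by simp
  have "opener_at (map cell xs) j = fst (xs ! j) \<and> closer_at (map cell xs) j = snd (xs ! j)" if j: "j < n" for j
  proof
    have p: "fst (xs ! j) \<in> {1..2 * n}" "snd (xs ! j) \<in> {1..2 * n}" using points mem[OF j] by blast+
    have "{i. i < n \<and> fst (xs ! i) \<le> fst (xs ! j)} = {..j}" using le_iff j by auto
    moreover have "{i. i < n \<and> snd (xs ! i) \<le> fst (xs ! j)} = {i. i < n \<and> col (xs ! i) < row (xs ! j)}"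
    proof -
      have "snd (xs ! i) \<le> fst (xs ! j) \<longleftrightarrow> col (xs ! i) < row (xs ! j)" if "i < n" for i
        using col_less_row_iff[OF mem[OF that] mem[OF j]] fst_neq_snd[OF mem[OF j] mem[OF that]] by linarith
      then show ?thesis by auto
    qed
    moreover have "{i. i < length (map cell xs) \<and> snd (map cell xs ! i) < fst (map cell xs ! j)} = {i. i < n \<and> col (xs ! i) < row (xs ! j)}"
      using j len by (auto simp: cell_def)
    ultimately show "opener_at (map cell xs) j = fst (xs ! j)"
      using split[OF p(1)] unfolding cf opener_at_def by simp
    have "{i. i < n \<and> fst (xs ! i) \<le> snd (xs ! j)} = {i. i < length (map cell xs) \<and> fst (map cell xs ! i) \<le> snd (map cell xs ! j)}"
    proof -
      have "fst (xs ! i) \<le> snd (xs ! j) \<longleftrightarrow> row (xs ! i) \<le> col (xs ! j)" if "i < n" for i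
        using col_less_row_iff[OF mem[OF j] mem[OF that]] by linarith
      then show ?thesis using j len by (auto simp: cell_def)
    qed
    moreover have "{i. i < n \<and> snd (xs ! i) \<le> snd (xs ! j)} = {i. i < length (map cell xs) \<and>
      (snd (map cell xs ! i) < snd (map cell xs ! j) \<or> snd (map cell xs ! i) = snd (map cell xs ! j) \<and> i \<le> j)}"
    proof -
      \<comment> \<open>Closers of one column come in the order of their openers, which is the order
        of the list.\<close>
      have "snd (xs ! i) \<le> snd (xs ! j) \<longleftrightarrow> col (xs ! i) < col (xs ! j) \<or> col (xs ! i) = col (xs ! j) \<and> i \<le> j" if i: "i < n" for i
      proof -
        consider "col (xs ! i) < col (xs ! j)" | "col (xs ! j) < col (xs ! i)" | "col (xs ! i) = col (xs ! j)" by linarith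
        then show ?thesis
        proof cases
          case 1
          then show ?thesis using snd_less_if_col[OF mem[OF i] mem[OF j]] by simp
        next
          case 2
          then show ?thesis using snd_less_if_col[OF mem[OF j] mem[OF i]] by simp
        next
          case 3
          have "snd (xs ! j) < snd (xs ! i) \<longleftrightarrow> fst (xs ! j) < fst (xs ! i)"
            using snd_less_iff[OF mem[OF j] mem[OF i]] 3 by simp
          then show ?thesis using le_iff[OF i j] 3 by (simp add: not_less[symmetric])
        qed
      qed
      then show ?thesis using j len by (auto simp: cell_def)
    qed
    ultimately show "closer_at (map cell xs) j = snd (xs ! j)"
      using split[OF p(2)] unfolding cf closer_at_def by simp
  qed
  then have "arcs_of (map cell xs) = (\<lambda>j. xs ! j) ` {..<n}"
    unfolding arcs_of_def using len by (intro image_cong) (simp_all add: prod_eq_iff)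
  also have "\<dots> = M" using xs(1) len by (auto simp: set_conv_nth)
  finally show ?thesis using srt unfolding xs_def by simp
qed

end

text \<open>The relative order of any two endpoints follows from monotonicity of the counts. Since
  \<open>CO_iff\<close> reproduces the relation \<open>u j < l i\<close> of the cells, uniqueness of
  interval representations shows that the runs of the new matching give back these cells.\<close>

lemma arcs_of_stoimenow:
  assumes n: "1 \<le> n" and A: "mset zs \<in> cells n k" and srt: "sorted zs"
  shows "stoimenow_matching n (arcs_of zs) \<and>
    image_mset (\<lambda>e. (run (arcs_of zs) (fst e), run (arcs_of zs) (snd e))) (mset_set (arcs_of zs)) = mset zs"
proof -
  define l where "l i = fst (zs ! i)" for i
  define u where "u i = snd (zs ! i)" for i
  have len: "length zs = n" using A by (auto simp: cells_def)
  have st: "set zs = (!) zs ` {..<n}" using len by (auto simp: set_conv_nth)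
  have lu: "l i \<le> u i" if "i < n" for i
  proof -
    have "(l i, u i) \<in> set zs" using that len by (simp add: l_def u_def)
    then show ?thesis using A by (auto simp: cells_def)
  qed
  have "l ` {..<n} = fst ` set zs" "u ` {..<n} = snd ` set zs"
    unfolding st by (simp_all add: l_def u_def image_image)
  then have img: "l ` {..<n} = {..<k}" "u ` {..<n} = {..<k}" using A by (auto simp: cells_def)
  interpret Z: interval_rep "{..<n}" l u k
    by unfold_locales (use lu img in auto)
  let ?O = "opener_at zs" and ?C = "closer_at zs" and ?M = "arcs_of zs"
  have M: "?M = (\<lambda>j. (?O j, ?C j)) ` {..<n}" by (simp add: arcs_of_def len)
  have lex: "l i < l j \<or> l i = l j \<and> u i \<le> u j" if "i \<le> j" "j < n" for i j
    using sorted_nth_mono[OF srt that(1)] that len by (auto simp: l_def u_def less_eq_prod_def)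
  define U where "U j = {a. a < n \<and> u a < l j}" for j
  define W where "W j = {a. a < n \<and> l a \<le> u j}" for j
  define Q where "Q j = {a. a < n \<and> (u a < u j \<or> u a = u j \<and> a \<le> j)}" for j
  have fin: "finite (U j)" "finite (W j)" "finite (Q j)" for j by (simp_all add: U_def W_def Q_def)
  have O: "?O j = Suc j + card (U j)" for j
    by (simp add: opener_at_def len l_def u_def U_def)
  have C: "?C j = card (W j) + card (Q j)" for j
    by (simp add: closer_at_def len l_def u_def W_def Q_def)
  have OO: "?O i < ?O j" if "i < j" "j < n" for i j
  proof -
    have "card (U i) \<le> card (U j)"
      using lex[of i j] that by (intro card_mono) (auto simp: U_def W_def Q_def)
    then show ?thesis using that unfolding O by simp
  qed
  have CC: "?C i < ?C j" if "u i < u j \<or> u i = u j \<and> i < j" "i < n" "j < n" for i j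
  proof -
    have "card (W i) \<le> card (W j)"
      using that by (intro card_mono) (auto simp: U_def W_def Q_def)
    moreover have "card (Q i) < card (Q j)"
    proof (rule psubset_card_mono)
      have "j \<notin> Q i" "j \<in> Q j"
        using that by (auto simp: U_def W_def Q_def)
      moreover have "Q i \<subseteq> Q j"
        using that by (auto simp: U_def W_def Q_def)
      ultimately show "Q i \<subset> Q j"
        by blast
    qed (rule fin)
    ultimately show ?thesis unfolding C by simp
  qed
  have OC: "?O i < ?C j" if "l i \<le> u j" "i < n" "j < n" for i j
  proof -
    have "{..i} \<subseteq> W j" using that lex[of _ i] by (fastforce simp: W_def)
    then have "card {..i} \<le> card (W j)" by (intro card_mono) (auto simp: U_def W_def Q_def)
    moreover have "card (U i) < card (Q j)"
    proof (rule psubset_card_mono)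
      have "j \<notin> U i" "j \<in> Q j" using that by (auto simp: U_def W_def Q_def)
      moreover have "U i \<subseteq> Q j" using that by (auto simp: U_def W_def Q_def)
      ultimately show "U i \<subset> Q j" by blast
    qed (rule fin)
    ultimately show ?thesis unfolding O C by simp
  qed
  have CO: "?C j < ?O i" if "u j < l i" "i < n" "j < n" for i j
  proof -
    have "W j \<subseteq> {..<i}"
    proof
      fix a assume "a \<in> W j"
      then have "l a < l i" "a < n" using that by (auto simp: W_def)
      then show "a \<in> {..<i}" using lex[of i a] by (cases "a < i") auto
    qed
    then have "card (W j) \<le> card {..<i}" by (intro card_mono) (auto simp: U_def W_def Q_def)
    moreover have "card (Q j) \<le> card (U i)"
      using that by (intro card_mono) (auto simp: U_def W_def Q_def)
    ultimately show ?thesis unfolding O C by simp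
  qed
  have OO_iff: "?O i < ?O j \<longleftrightarrow> i < j" if "i < n" "j < n" for i j
    using OO[of i j] OO[of j i] that by (metis less_asym linorder_neqE_nat less_irrefl)
  have CC_iff: "?C i < ?C j \<longleftrightarrow> u i < u j \<or> u i = u j \<and> i < j" if "i < n" "j < n" for i j
    using CC[of i j] CC[of j i] that by (metis less_asym linorder_neqE_nat less_irrefl)
  have CO_iff: "?C j < ?O i \<longleftrightarrow> u j < l i" if "i < n" "j < n" for i j
    using CO[of j i] OC[of i j] that by (metis less_asym not_less)
  have OC_neq: "?O i \<noteq> ?C j" if "i < n" "j < n" for i j
    using CO[of j i] OC[of i j] that by (metis less_irrefl not_less)
  have O_inj: "inj_on ?O {..<n}" using OO by (intro linorder_inj_onI) (auto simp: less_imp_neq)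
  have C_inj: "inj_on ?C {..<n}"
  proof (rule inj_onI)
    fix i j assume "i \<in> {..<n}" "j \<in> {..<n}" "?C i = ?C j"
    then show "i = j" using CC[of i j] CC[of j i] by (metis less_irrefl linorder_neqE_nat lessThan_iff)
  qed
  have f_M: "fst ` ?M = ?O ` {..<n}" and s_M: "snd ` ?M = ?C ` {..<n}" unfolding M by (simp_all add: image_image)
  have mat: "matching n ?M"
    unfolding matching_iff
  proof (intro conjI)
    show "\<forall>e\<in>?M. fst e < snd e" unfolding M using OC lu by auto
    show "fst ` ?M \<union> snd ` ?M = {1..2 * n}"
    \<comment> \<open>The \<open>2 * n\<close> endpoints are distinct and lie in
      \<open>{1..2 * n}\<close>, hence exhaust it.\<close>
    proof (rule card_subset_eq)
      have "card (fst ` ?M \<union> snd ` ?M) = card (?O ` {..<n}) + card (?C ` {..<n})"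
        unfolding f_M s_M using OC_neq by (intro card_Un_disjoint) auto
      then show "card (fst ` ?M \<union> snd ` ?M) = card {1..2 * n}" using O_inj C_inj by (simp add: card_image)
      show "fst ` ?M \<union> snd ` ?M \<subseteq> {1..2 * n}"
      proof -
        have "?C j \<le> 2 * n" for j
        proof -
          have "card (W j) \<le> card {..<n}" "card (Q j) \<le> card {..<n}"
            by (intro card_mono; auto simp: W_def Q_def)+
          then show ?thesis unfolding C by simp
        qed
        moreover have "?O j \<ge> 1" for j unfolding O by simp
        moreover have "?O j < ?C j" if "j < n" for j using OC lu that by simp
        ultimately have "?O j \<in> {1..2 * n} \<and> ?C j \<in> {1..2 * n}" if "j < n" for j
          using that by (metis atLeastAtMost_iff le_trans less_imp_le)
        then show ?thesis unfolding f_M s_M by auto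
      qed
    qed simp
    have "i = j" if "i < n" "j < n" "?O i = ?O j \<or> ?C i = ?C j" for i j
      using that O_inj C_inj by (auto dest: inj_onD)
    then show "\<forall>e\<in>?M. \<forall>f\<in>?M. e \<noteq> f \<longrightarrow> fst e \<noteq> fst f \<and> snd e \<noteq> snd f \<and> fst e \<noteq> snd f"
      unfolding M using OC_neq by auto
  qed
  have sto: "stoimenow ?M"
    unfolding stoimenow_def
  proof (intro conjI notI; elim exE conjE)
    fix i b c assume "(i, c) \<in> ?M" "(i + 1, b) \<in> ?M" "i + 1 < b" and bc: "b < c"
    then obtain p q where pq: "p < n" "q < n" "i = ?O p" "c = ?C p" "i + 1 = ?O q" "b = ?C q" unfolding M by auto
    have "p < q" using OO_iff[OF pq(1,2)] pq by simp
    have u: "u q \<le> u p" using CC_iff[OF pq(2,1)] bc pq by auto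
    have "l p < l q"
    proof (rule ccontr)
      assume "\<not> l p < l q"
      then have "u p \<le> u q" using lex[of p q] \<open>p < q\<close> pq by simp
      then have "u p = u q" using u by simp
      then show False using CC_iff[OF pq(2,1)] bc pq \<open>p < q\<close> by simp
    qed
    \<comment> \<open>No column is empty: a closer of column \<open>l q - 1\<close> falls between
      the openers of \<open>p\<close> and \<open>q\<close>, which were assumed adjacent.\<close>
    have "l q - 1 < k" using Z.l_less[of q] pq by simp
    then obtain r where r: "r < n" "u r = l q - 1" using Z.obtain_u by (metis lessThan_iff)
    have "l p \<le> u r" "u r < l q" using r \<open>l p < l q\<close> by linarith+
    then have "?O p < ?C r" "?C r < ?O q" using OC[of p r] CO[of r q] pq r by auto
    then show False using pq by simp
  next
    fix j a b assume "(a, j + 1) \<in> ?M" "(b, j) \<in> ?M" and ab: "a < b" "b < j"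
    then obtain p q where pq: "p < n" "q < n" "a = ?O p" "j + 1 = ?C p" "b = ?O q" "j = ?C q" unfolding M by auto
    have "p < q" using OO_iff[OF pq(1,2)] pq ab by simp
    have "?C q < ?C p" using pq by simp
    then have "u q < u p" using CC_iff[OF pq(2,1)] \<open>p < q\<close> by auto
    moreover have "u p < k" using Z.u_less[of p] pq by simp
    \<comment> \<open>Dually, no row is empty: an opener of row \<open>u q + 1\<close> falls between
      two closers that were assumed adjacent.\<close>
    ultimately have "Suc (u q) < k" by simp
    then obtain r where r: "r < n" "l r = Suc (u q)" using Z.obtain_l by (metis lessThan_iff)
    then have "?C q < ?O r" "?O r < ?C p" using CO[of q r] OC[of r p] pq \<open>u q < u p\<close> by auto
    then show False using pq by simp
  qed
  have loc: "stoimenow_matching n ?M" by unfold_locales (fact n mat sto)+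
  interpret stoimenow_matching n ?M by (rule loc)
  let ?e = "\<lambda>j. (?O j, ?C j)"
  have e_inj: "inj_on ?e {..<n}" using O_inj by (auto simp: inj_on_def)
  have R: "interval_rep {..<n} (\<lambda>j. row (?e j)) (\<lambda>j. col (?e j)) runs"
  proof
    have "row ` ?e ` {..<n} = {..<runs}" "col ` ?e ` {..<n} = {..<runs}" using l_image u_image unfolding M by auto
    then show "(\<lambda>j. row (?e j)) ` {..<n} = {..<runs}" "(\<lambda>j. col (?e j)) ` {..<n} = {..<runs}"
      unfolding image_image .
    fix x assume "x \<in> {..<n}"
    then have "?e x \<in> ?M" unfolding M by blast
    then show "row (?e x) \<le> col (?e x)" by (rule l_le_u)
  qed simp
  have "k = runs \<and> (\<forall>j\<in>{..<n}. l j = row (?e j) \<and> u j = col (?e j))"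
  proof (rule interval_rep_unique[OF Z.interval_rep_axioms R])
    fix x y assume xy: "x \<in> {..<n}" "y \<in> {..<n}"
    then have "?e x \<in> ?M" "?e y \<in> ?M" unfolding M by blast+
    then have "col (?e x) < row (?e y) \<longleftrightarrow> ?C x < ?O y" using col_less_row_iff by simp
    then show "u x < l y \<longleftrightarrow> col (?e x) < row (?e y)" using CO_iff xy by simp
  qed
  then have cl: "cell (?e j) = zs ! j" if "j < n" for j
    using that by (simp add: cell_def l_def u_def prod_eq_iff)
  have "mset_set ?M = image_mset ?e (mset_set {..<n})"
    unfolding M using e_inj by (simp add: image_mset_mset_set)
  then have "image_mset cell (mset_set ?M) = image_mset (\<lambda>j. cell (?e j)) (mset_set {..<n})"
    by (simp add: multiset.map_comp comp_def)
  also have "\<dots> = image_mset ((!) zs) (mset_set {..<n})"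
    using cl by (intro image_mset_cong) auto
  also have "\<dots> = mset (map ((!) zs) [0..<n])" by (simp add: lessThan_atLeast0)
  also have "\<dots> = mset zs" using len map_nth[of zs] by simp
  finally have "image_mset cell (mset_set ?M) = mset zs" .
  moreover have "cell = (\<lambda>e. (run ?M (fst e), run ?M (snd e)))" by (rule ext) (simp only: cell_def row_def col_def)
  ultimately show ?thesis using loc by (simp only: simp_thms)
qed

section \<open>Matchings indexed by cells\<close>

definition matching_cells :: "arc set \<Rightarrow> (nat \<times> nat) multiset" where
  "matching_cells M = image_mset (\<lambda>e. (run M (fst e), run M (snd e))) (mset_set M)"

lemma (in stoimenow_matching) matching_cells_M: "matching_cells M = cell_mset"
proof -
  have "cell = (\<lambda>e. (run M (fst e), run M (snd e)))" by (rule ext) (simp only: cell_def row_def col_def)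
  then show ?thesis unfolding matching_cells_def cell_mset_def by (simp only:)
qed

lemma sum_matchings_avoiding:
  fixes stat :: "arc set \<Rightarrow> nat" and bad :: "(nat \<times> nat) set \<Rightarrow> bool"
  assumes n: "1 \<le> n"
    and bad: "\<And>M. stoimenow_matching n M \<Longrightarrow> contains_matching M P \<longleftrightarrow> bad (set_mset (matching_cells M))"
    and stat: "\<And>M. stoimenow_matching n M \<Longrightarrow> \<not> bad (set_mset (matching_cells M)) \<Longrightarrow> stat M = stoimenow_matching.runs M"
    and card: "\<And>k. int (card (cells_without bad n k)) = narayana n k"
  shows "(\<Sum>M \<in> stoimenow_matchings_avoiding n P. monom 1 (stat M)) = narayana_poly n"
proof -
  let ?T = "stoimenow_matchings_avoiding n P"
  have T: "M \<in> ?T \<longleftrightarrow> stoimenow_matching n M \<and> \<not> bad (set_mset (matching_cells M))" for M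
    using n bad unfolding stoimenow_matchings_avoiding_def stoimenow_matchings_def stoimenow_matching_def by auto
  have in_cells: "matching_cells M \<in> cells n (stoimenow_matching.runs M)" if "stoimenow_matching n M" for M
  proof -
    interpret stoimenow_matching n M by fact
    show ?thesis using cell_mset_in_cells by (simp add: matching_cells_M card_M)
  qed
  have inj: "M = N" if "stoimenow_matching n M" "stoimenow_matching n N" "matching_cells M = matching_cells N" for M N
  proof -
    interpret M: stoimenow_matching n M by fact
    interpret N: stoimenow_matching n N by fact
    have m: "mset (map M.cell (sorted_list_of_set M)) = M.cell_mset"
      "mset (map N.cell (sorted_list_of_set N)) = N.cell_mset"
      unfolding M.cell_mset_def N.cell_mset_def
      using mset_set_set[of "sorted_list_of_set M"] mset_set_set[of "sorted_list_of_set N"] M.finite_M N.finite_M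
      by simp_all
    have "map M.cell (sorted_list_of_set M) = map N.cell (sorted_list_of_set N)"
      by (rule sorted_map_mset_unique[where f = id])
        (use M.arcs_of_cells N.arcs_of_cells m that(3) in \<open>simp_all add: M.matching_cells_M N.matching_cells_M\<close>)
    then show ?thesis using M.arcs_of_cells N.arcs_of_cells by metis
  qed
  have "M \<subseteq> {1..2 * n} \<times> {1..2 * n}" if "M \<in> ?T" for M
  proof -
    interpret stoimenow_matching n M using that T by blast
    show ?thesis using points by (force simp: set_eq_iff)
  qed
  then have "?T \<subseteq> Pow ({1..2 * n} \<times> {1..2 * n})" by blast
  then have fin: "finite ?T" by (rule finite_subset) simp
  \<comment> \<open>Sorting makes the result independent of the listing chosen.\<close>
  define G where "G A = arcs_of (sort (SOME zs. mset zs = A))" for A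
  have G: "stoimenow_matching n (G A)" "matching_cells (G A) = A" "stoimenow_matching.runs (G A) = k"
    if A: "A \<in> cells n k" for A k
  proof -
    have "mset (sort (SOME zs. mset zs = A)) = A" unfolding mset_sort by (rule someI_ex[OF ex_mset])
    then show G: "stoimenow_matching n (G A)" "matching_cells (G A) = A"
      using arcs_of_stoimenow[OF n, of _ k] A by (simp_all add: matching_cells_def G_def)
    then have "A \<in> cells n (stoimenow_matching.runs (G A))" using in_cells by metis
    then have "{..<k} = {..<stoimenow_matching.runs (G A)}" using A by (simp add: cells_def)
    then show "stoimenow_matching.runs (G A) = k" by (metis card_lessThan)
  qed
  show ?thesis
  proof (rule sum_via_cells[OF fin n card, where G = G])
    fix A k assume A: "A \<in> cells n k" "\<not> bad (set_mset A)"
    show "G A \<in> ?T" using G(1,2)[OF A(1)] A(2) by (simp add: T)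
    show "stat (G A) = k" using stat[OF G(1)[OF A(1)]] G(2,3)[OF A(1)] A(2) by simp
  next
    fix M assume "M \<in> ?T"
    then have M: "stoimenow_matching n M" "\<not> bad (set_mset (matching_cells M))" by (simp_all add: T)
    have "M = G (matching_cells M)" using inj[OF M(1) G(1)] G(2) in_cells[OF M(1)] by simp
    then show "\<exists>A k. A \<in> cells n k \<and> \<not> bad (set_mset A) \<and> M = G A" using in_cells[OF M(1)] M(2) by blast
  next
    fix A B k m assume "A \<in> cells n k" "B \<in> cells n m" "G A = G B"
    then show "A = B" using G(2) by metis
  qed
qed

section \<open>Patterns and crossings in matchings\<close>

subsection \<open>Patterns in matchings\<close>

text \<open>Relabelling by rank is inverse to an increasing embedding of the labels
  \<open>1..N\<close> into the endpoints of the chosen arcs.\<close>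

lemma contains_matching_iff:
  assumes fin: "finite M" and P: "endpoints P = {1..N}"
  shows "contains_matching M P \<longleftrightarrow> (\<exists>g. strict_mono_on {1..N} g \<and> (\<forall>(i, j) \<in> P. (g i, g j) \<in> M))"
proof
  assume "contains_matching M P"
  then obtain S where S: "S \<subseteq> M" "relabel S = P" unfolding contains_matching_def by blast
  let ?E = "endpoints S"
  define rk where "rk x = card {y \<in> ?E. y \<le> x}" for x
  have finE: "finite ?E" using S(1) fin finite_subset unfolding endpoints_def by blast
  have rP: "P = (\<lambda>(a, b). (rk a, rk b)) ` S" using S(2) unfolding relabel_def Let_def rk_def by simp
  have bij: "bij_betw rk ?E {1..card ?E}" unfolding rk_def by (rule bij_betw_rank[OF finE])
  have "endpoints P = rk ` ?E" unfolding rP endpoints_def by force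
  then have eq: "{1..N} = {1..card ?E}" using P bij by (simp add: bij_betw_def)
  have bij': "bij_betw rk ?E {1..N}" unfolding eq by (rule bij)
  let ?g = "inv_into ?E rk"
  have g: "?g i \<in> ?E" "rk (?g i) = i" if "i \<in> {1..N}" for i
    using bij' that by (auto simp: bij_betw_def intro: inv_into_into f_inv_into_f)
  have rk_mono: "x \<le> y \<Longrightarrow> rk x \<le> rk y" for x y unfolding rk_def using finE by (intro card_mono) auto
  have "strict_mono_on {1..N} ?g"
  proof (rule strict_mono_onI)
    fix i j assume "i \<in> {1..N}" "j \<in> {1..N}" "i < j"
    then show "?g i < ?g j" using rk_mono[of "?g j" "?g i"] g by (metis not_less)
  qed
  moreover have "(?g i, ?g j) \<in> M" if ij: "(i, j) \<in> P" for i j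
  proof -
    obtain a b where ab: "(a, b) \<in> S" "i = rk a" "j = rk b"
      using ij unfolding rP by auto
    then have "a \<in> ?E" "b \<in> ?E" by (force simp: endpoints_def)+
    then have "?g i = a" "?g j = b" using ab bij' by (simp_all add: bij_betw_def)
    then show ?thesis using ab S(1) by auto
  qed
  ultimately show "\<exists>g. strict_mono_on {1..N} g \<and> (\<forall>(i, j) \<in> P. (g i, g j) \<in> M)" by blast
next
  assume "\<exists>g. strict_mono_on {1..N} g \<and> (\<forall>(i, j) \<in> P. (g i, g j) \<in> M)"
  then obtain g where g: "strict_mono_on {1..N} g" "\<forall>(i, j) \<in> P. (g i, g j) \<in> M" by blast
  let ?S = "(\<lambda>(i, j). (g i, g j)) ` P"
  have E: "endpoints ?S = g ` {1..N}" unfolding P[symmetric] endpoints_def by force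
  have inj: "inj_on g {1..N}" using g(1) by (rule strict_mono_on_imp_inj_on)
  have rk: "card {y \<in> endpoints ?S. y \<le> g i} = i" if "i \<in> {1..N}" for i
  proof -
    have "g j \<le> g i \<longleftrightarrow> j \<le> i" if "j \<in> {1..N}" for j
      using strict_mono_onD[OF g(1), of i j] strict_mono_onD[OF g(1), of j i] that \<open>i \<in> {1..N}\<close>
      by (metis le_less linorder_neqE_nat not_less)
    then have "{y \<in> endpoints ?S. y \<le> g i} = g ` {1..i}" unfolding E using that by auto
    moreover have "inj_on g {1..i}" by (rule inj_on_subset[OF inj]) (use that in auto)
    ultimately show ?thesis by (simp add: card_image)
  qed
  have "relabel ?S = P"
  proof -
    have "relabel ?S = (\<lambda>(i, j). (card {y \<in> endpoints ?S. y \<le> g i}, card {y \<in> endpoints ?S. y \<le> g j})) ` P"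
      unfolding relabel_def Let_def by (simp add: image_image case_prod_unfold)
    also have "\<dots> = (\<lambda>e. e) ` P"
    proof (rule image_cong[OF refl])
      fix e assume "e \<in> P"
      then have "fst e \<in> {1..N}" "snd e \<in> {1..N}" unfolding P[symmetric] endpoints_def by auto
      then show "(\<lambda>(i, j). (card {y \<in> endpoints ?S. y \<le> g i}, card {y \<in> endpoints ?S. y \<le> g j})) e = e"
        using rk by (simp add: case_prod_unfold)
    qed
    finally show ?thesis by simp
  qed
  moreover have "?S \<subseteq> M" using g(2) by auto
  ultimately show "contains_matching M P" unfolding contains_matching_def by blast
qed

lemma endpoints_patterns: "endpoints pattern_P1 = {1..8}" "endpoints pattern_P2 = {1..8}"
  unfolding endpoints_def pattern_P1_def pattern_P2_def by (auto simp: numeral_eq_Suc le_Suc_eq)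

lemma strict_mono_on_8:
  fixes g :: "nat \<Rightarrow> nat"
  shows "strict_mono_on {1..8} g \<longleftrightarrow> g 1 < g 2 \<and> g 2 < g 3 \<and> g 3 < g 4 \<and> g 4 < g 5 \<and> g 5 < g 6 \<and> g 6 < g 7 \<and> g 7 < g 8"
proof
  assume "strict_mono_on {1..8} g"
  then show "g 1 < g 2 \<and> g 2 < g 3 \<and> g 3 < g 4 \<and> g 4 < g 5 \<and> g 5 < g 6 \<and> g 6 < g 7 \<and> g 7 < g 8"
    by (auto intro!: strict_mono_onD[of "{1..8}" g])
next
  assume a: "g 1 < g 2 \<and> g 2 < g 3 \<and> g 3 < g 4 \<and> g 4 < g 5 \<and> g 5 < g 6 \<and> g 6 < g 7 \<and> g 7 < g 8"
  show "strict_mono_on {1..8} g"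
  proof (rule strict_mono_onI)
    have s: "g i < g (Suc i)" if "i \<in> {1..7}" for i
    proof -
      have "i = 1 \<or> i = 2 \<or> i = 3 \<or> i = 4 \<or> i = 5 \<or> i = 6 \<or> i = 7" using that by auto
      then show ?thesis using a by (elim disjE) (simp_all add: numeral_eq_Suc)
    qed
    fix i j :: nat assume ij: "i \<in> {1..8}" "j \<in> {1..8}" "i < j"
    show "g i < g j" by (rule chain_less[where h = g]) (use s ij in auto)
  qed
qed

context stoimenow_matching
begin

text \<open>By \<open>col a = row e\<close> the closer of \<open>a\<close> lies in the block in
  which \<open>e\<close> opens, behind that opener. If both arcs open in this block,
  \<open>a\<close> closes in an earlier column than \<open>e\<close>, so it also opens earlier. An
  overlap of this kind is needed at the left end of both matching patterns.\<close>

lemma left_neighbour: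
  assumes "a \<in> M" "e \<in> M" "col a = row e" "row e < col e"
  shows "fst a < fst e \<and> fst e < snd a"
proof
  show "fst a < fst e"
  proof (cases "row a = row e")
    case True
    have "snd a < snd e" using snd_less_if_col[OF assms(1,2)] assms by simp
    then show ?thesis using fst_less_iff[OF assms(1,2) True] by simp
  next
    case False
    then show ?thesis using fst_less_if_row[OF assms(1,2)] l_le_u[OF assms(1)] assms(3) by simp
  qed
  show "fst e < snd a" using col_less_row_iff[OF assms(1,2)] assms(3) fst_neq_snd[OF assms(2,1)] by simp
qed

lemma right_neighbour:
  assumes "e \<in> M" "c \<in> M" "row c = col e" "row e < col e"
  shows "fst c < snd e \<and> snd e < snd c"
proof
  show "snd e < snd c"
  proof (cases "col c = col e")
    case True
    have "fst e < fst c" using fst_less_if_row[OF assms(1,2)] assms by simp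
    then show ?thesis using snd_less_iff[OF assms(1,2)] True by simp
  next
    case False
    then show ?thesis using snd_less_if_col[OF assms(1,2)] l_le_u[OF assms(2)] assms(3) by simp
  qed
  show "fst c < snd e" using col_less_row_iff[OF assms(1,2)] assms(3) fst_neq_snd[OF assms(2,1)] by simp
qed

text \<open>The nested cells come from \<open>(2, 7)\<close> and \<open>(4, 5)\<close>. The arc
  \<open>(1, 3)\<close> closes between their openers and \<open>(6, 8)\<close> opens between their
  closers, so they differ in row and in column. Conversely, arcs through the row and the column of
  the outer cell serve as these two.\<close>

lemma contains_P1: "contains_matching M pattern_P1 \<longleftrightarrow> nested (cell ` M)"
proof
  assume "contains_matching M pattern_P1"
  then obtain g :: "nat \<Rightarrow> nat" where g: "strict_mono_on {1..8} g" "(g 1, g 3) \<in> M" "(g 2, g 7) \<in> M" "(g 4, g 5) \<in> M" "(g 6, g 8) \<in> M"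
    unfolding contains_matching_iff[OF finite_M endpoints_patterns(1)] by (auto simp: pattern_P1_def)
  note s = g(1)[unfolded strict_mono_on_8]
  have "row (g 2, g 7) \<le> col (g 1, g 3)" "row (g 6, g 8) \<le> col (g 2, g 7)"
    using col_less_row_iff[OF g(2,3)] col_less_row_iff[OF g(3,5)] s by auto
  moreover have "col (g 1, g 3) < row (g 4, g 5)" "col (g 4, g 5) < row (g 6, g 8)"
    using col_less_row_iff[OF g(2,4)] col_less_row_iff[OF g(4,5)] s by auto
  ultimately have "row (g 2, g 7) < row (g 4, g 5) \<and> col (g 4, g 5) < col (g 2, g 7)" by linarith
  then show "nested (cell ` M)" using g(3,4) unfolding nested_def by (force simp: cell_def)
next
  assume "nested (cell ` M)"
  then obtain d b where bd: "d \<in> M" "b \<in> M" "row d < row b" "col b < col d"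
    unfolding nested_def by (auto simp: cell_def)
  obtain a where a: "a \<in> M" "col a = row d" using obtain_u l_less bd by metis
  obtain c where c: "c \<in> M" "row c = col d" using obtain_l u_less bd by metis
  have "row d < col d" using l_le_u[OF bd(2)] bd by simp
  then have "fst a < fst d" "fst d < snd a" "fst c < snd d" "snd d < snd c"
    using left_neighbour[OF a(1) bd(1) a(2)] right_neighbour[OF bd(1) c] by auto
  moreover have "snd a < fst b" using col_less_row_iff[OF a(1) bd(2)] a bd by simp
  moreover have "fst b < snd b" using arc_less[OF bd(2)] .
  moreover have "snd b < fst c" using col_less_row_iff[OF bd(2) c(1)] bd c by simp
  ultimately have *: "fst a < fst d" "fst d < snd a" "snd a < fst b" "fst b < snd b" "snd b < fst c" "fst c < snd d" "snd d < snd c" by auto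
  let ?g = "\<lambda>i. [fst a, fst d, snd a, fst b, snd b, fst c, snd d, snd c] ! (i - 1)"
  have "strict_mono_on {1..8} ?g" unfolding strict_mono_on_8 using * by (simp add: numeral_eq_Suc)
  moreover have "\<forall>(i, j)\<in>pattern_P1. (?g i, ?g j) \<in> M" using a bd c by (simp add: pattern_P1_def numeral_eq_Suc)
  ultimately show "contains_matching M pattern_P1"
    unfolding contains_matching_iff[OF finite_M endpoints_patterns(1)] by (intro exI[of _ ?g]) simp
qed

text \<open>The crossed cells come from \<open>(2, 5)\<close> and \<open>(4, 7)\<close>. Again
  \<open>(1, 3)\<close> separates the rows and \<open>(6, 8)\<close> the columns, but now the former
  is attached to the lower cell and the latter to the upper one.\<close>

lemma contains_P2: "contains_matching M pattern_P2 \<longleftrightarrow> crossed (cell ` M)"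
proof
  assume "contains_matching M pattern_P2"
  then obtain g :: "nat \<Rightarrow> nat" where g: "strict_mono_on {1..8} g" "(g 1, g 3) \<in> M" "(g 2, g 5) \<in> M" "(g 4, g 7) \<in> M" "(g 6, g 8) \<in> M"
    unfolding contains_matching_iff[OF finite_M endpoints_patterns(2)] by (auto simp: pattern_P2_def)
  note s = g(1)[unfolded strict_mono_on_8]
  have "row (g 2, g 5) \<le> col (g 1, g 3)" "row (g 4, g 7) \<le> col (g 2, g 5)" "row (g 6, g 8) \<le> col (g 4, g 7)"
    using col_less_row_iff[OF g(2,3)] col_less_row_iff[OF g(3,4)] col_less_row_iff[OF g(4,5)] s by auto
  moreover have "col (g 1, g 3) < row (g 4, g 7)" "col (g 2, g 5) < row (g 6, g 8)"
    using col_less_row_iff[OF g(2,4)] col_less_row_iff[OF g(3,5)] s by auto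
  ultimately have "row (g 2, g 5) < row (g 4, g 7) \<and> row (g 4, g 7) \<le> col (g 2, g 5) \<and> col (g 2, g 5) < col (g 4, g 7)" by linarith
  then show "crossed (cell ` M)" using g(3,4) unfolding crossed_def by (force simp: cell_def)
next
  assume "crossed (cell ` M)"
  then obtain b c where bc: "b \<in> M" "c \<in> M" "row b < row c" "row c \<le> col b" "col b < col c"
    unfolding crossed_def by (auto simp: cell_def)
  obtain a where a: "a \<in> M" "col a = row b" using obtain_u l_less bc by metis
  obtain d where d: "d \<in> M" "row d = col c" using obtain_l u_less bc by metis
  have "row b < col b" "row c < col c" using bc by auto
  then have "fst a < fst b" "fst b < snd a" "fst d < snd c" "snd c < snd d"
    using left_neighbour[OF a(1) bc(1) a(2)] right_neighbour[OF bc(2) d] by auto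
  moreover have "snd a < fst c" using col_less_row_iff[OF a(1) bc(2)] a bc by simp
  moreover have "fst c < snd b" using col_less_row_iff[OF bc(1,2)] bc fst_neq_snd[OF bc(2,1)] by simp
  moreover have "snd b < fst d" using col_less_row_iff[OF bc(1) d(1)] bc d by simp
  ultimately have *: "fst a < fst b" "fst b < snd a" "snd a < fst c" "fst c < snd b" "snd b < fst d" "fst d < snd c" "snd c < snd d" by auto
  let ?g = "\<lambda>i. [fst a, fst b, snd a, fst c, snd b, fst d, snd c, snd d] ! (i - 1)"
  have "strict_mono_on {1..8} ?g" unfolding strict_mono_on_8 using * by (simp add: numeral_eq_Suc)
  moreover have "\<forall>(i, j)\<in>pattern_P2. (?g i, ?g j) \<in> M" using a bc d by (simp add: pattern_P2_def numeral_eq_Suc)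
  ultimately show "contains_matching M pattern_P2"
    unfolding contains_matching_iff[OF finite_M endpoints_patterns(2)] by (intro exI[of _ ?g]) simp
qed

subsection \<open>Crossings and noncrossings\<close>

text \<open>The pairwise form, by which crossings can be examined through cells; sorting the set by
  openers returns the list.\<close>

lemma crossing_iff:
  "crossing M S \<longleftrightarrow> S \<subseteq> M \<and> S \<noteq> {} \<and>
    (\<forall>e \<in> S. \<forall>f \<in> S. fst e < snd f \<and> (fst e < fst f \<longrightarrow> snd e < snd f))"
proof
  assume "crossing M S"
  then have S: "S \<subseteq> M" "S \<noteq> {}" and "\<exists>xs. set xs = S \<and> sorted_wrt (<) (map fst xs @ map snd xs)"
    unfolding crossing_def by simp_all
  then obtain xs where xs: "set xs = S" "sorted_wrt (<) (map fst xs @ map snd xs)" by blast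
  have s: "sorted_wrt (<) (map fst xs)" "sorted_wrt (<) (map snd xs)" "\<forall>e\<in>S. \<forall>f\<in>S. fst e < snd f"
    using xs by (auto simp: sorted_wrt_append)
  have "snd e < snd f" if ef: "e \<in> S" "f \<in> S" "fst e < fst f" for e f
  proof -
    obtain i j where ij: "i < length xs" "j < length xs" "e = xs ! i" "f = xs ! j" using ef xs(1) by (metis in_set_conv_nth)
    have "i < j"
    proof (rule ccontr)
      assume "\<not> i < j"
      then have "fst f \<le> fst e"
        using sorted_wrt_nth_less[OF s(1), of j i] ij by (cases "i = j") auto
      then show False using ef by simp
    qed
    then show ?thesis using sorted_wrt_nth_less[OF s(2), of i j] ij by simp
  qed
  then show "S \<subseteq> M \<and> S \<noteq> {} \<and> (\<forall>e \<in> S. \<forall>f \<in> S. fst e < snd f \<and> (fst e < fst f \<longrightarrow> snd e < snd f))"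
    using S s by blast
next
  assume S: "S \<subseteq> M \<and> S \<noteq> {} \<and> (\<forall>e \<in> S. \<forall>f \<in> S. fst e < snd f \<and> (fst e < fst f \<longrightarrow> snd e < snd f))"
  define xs where "xs = sorted_list_of_set S"
  have fin: "finite S" using S finite_M finite_subset by blast
  have xs: "set xs = S" "distinct xs" "sorted xs" using fin by (simp_all add: xs_def)
  have l: "fst (xs ! i) < fst (xs ! j)" if "i < j" "j < length xs" for i j
    using sorted_arcs[of S] S that unfolding xs_def by blast
  moreover have "snd (xs ! i) < snd (xs ! j)" if "i < j" "j < length xs" for i j
  proof -
    have "xs ! i \<in> S" "xs ! j \<in> S" using xs(1) that by auto
    then show ?thesis using S l[OF that] by blast
  qed
  ultimately have "sorted_wrt (<) (map fst xs)" "sorted_wrt (<) (map snd xs)"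
    by (simp_all add: sorted_wrt_iff_nth_less)
  then have "sorted_wrt (<) (map fst xs @ map snd xs)"
    using S xs(1) by (auto simp: sorted_wrt_append)
  then show "crossing M S" unfolding crossing_def using S xs(1) by blast
qed

text \<open>Mutually incomparable crossings that together dominate all crossings are the maximal
  ones. The two avoidance classes call for different families \<open>G\<close>.\<close>

lemma mcr_eqI:
  fixes G :: "nat \<Rightarrow> arc set"
  assumes G: "\<And>i. i < m \<Longrightarrow> crossing M (G i)"
    and cover: "\<And>S. crossing M S \<Longrightarrow> \<exists>i<m. S \<subseteq> G i"
    and sub: "\<And>i j. i < m \<Longrightarrow> j < m \<Longrightarrow> G i \<subseteq> G j \<Longrightarrow> i = j"
  shows "mcr M = m"
proof -
  have "{S. crossing M S \<and> (\<forall>T. crossing M T \<and> S \<subseteq> T \<longrightarrow> T = S)} = G ` {..<m}" (is "?L = ?R")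
  proof (intro equalityI subsetI)
    fix S assume S: "S \<in> ?L"
    then obtain i where "i < m" "S \<subseteq> G i" using cover by blast
    then show "S \<in> ?R" using S G by blast
  next
    fix S assume "S \<in> ?R"
    then obtain i where i: "i < m" "S = G i" by blast
    have "T = G i" if T: "crossing M T" "G i \<subseteq> T" for T
    proof -
      obtain j where "j < m" "T \<subseteq> G j" using cover T by blast
      then have "i = j" using sub i T by blast
      then show ?thesis using T \<open>T \<subseteq> G j\<close> by blast
    qed
    then show "S \<in> ?L" using G i by blast
  qed
  moreover have "inj_on G {..<m}" using sub by (intro inj_onI) auto
  ultimately show ?thesis unfolding mcr_def by (simp add: card_image)
qed

lemma crossing_row:
  assumes "i < runs" shows "crossing M {e \<in> M. row e = i}"
proof -
  obtain x where "x \<in> M" "row x = i" using obtain_l[OF assms] .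
  moreover have "fst e < snd f" if "e \<in> M" "f \<in> M" "row e = i" "row f = i" for e f
    using col_less_row_iff[OF that(2,1)] fst_neq_snd[OF that(1,2)] l_le_u[OF that(2)] that by simp
  ultimately show ?thesis unfolding crossing_iff using same_row_less by blast
qed

lemma crossing_col:
  assumes "i < runs" shows "crossing M {e \<in> M. col e = i}"
proof -
  obtain x where "x \<in> M" "col x = i" using obtain_u[OF assms] .
  moreover have "fst e < snd f" if "e \<in> M" "f \<in> M" "col e = i" "col f = i" for e f
    using col_less_row_iff[OF that(2,1)] fst_neq_snd[OF that(1,2)] l_le_u[OF that(1)] that by simp
  moreover have "snd e < snd f" if "e \<in> M" "f \<in> M" "col e = i" "col f = i" "fst e < fst f" for e f
    using snd_less_iff[OF that(1,2)] that by simp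
  ultimately show ?thesis unfolding crossing_iff by blast
qed

lemma crossing_cells:
  assumes "crossing M S" "e \<in> S" "f \<in> S"
  shows "row e \<le> col f" "row e < row f \<Longrightarrow> col e \<le> col f"
proof -
  have ef: "e \<in> M" "f \<in> M" "fst e < snd f" "fst e < fst f \<Longrightarrow> snd e < snd f"
    using assms unfolding crossing_iff by auto
  show "row e \<le> col f" using col_less_row_iff[OF ef(2,1)] ef(3) by simp
  assume "row e < row f"
  then have "snd e < snd f" using fst_less_if_row[OF ef(1,2)] ef(4) by simp
  then show "col e \<le> col f" using snd_less_if_col[OF ef(2,1)] by (meson not_less less_asym)
qed

text \<open>A Helly argument: the intervals \<open>row e\<close> to \<open>col e\<close> of a
  crossing meet pairwise and so have a common point, their largest row. Conversely, without nesting
  all arcs over a given point cross each other.\<close>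

lemma mcr_unnested:
  assumes nn: "\<not> nested (cell ` M)"
  shows "mcr M = runs"
proof (rule mcr_eqI[where G = "\<lambda>i. {e \<in> M. row e \<le> i \<and> i \<le> col e}"])
  fix i assume i: "i < runs"
  have "fst e < snd f" if "e \<in> M" "f \<in> M" "row e \<le> i" "i \<le> col f" for e f
    using col_less_row_iff[OF that(2,1)] fst_neq_snd[OF that(1,2)] that by simp
  moreover have "snd e < snd f" if ef: "e \<in> M" "f \<in> M" "fst e < fst f" for e f
  proof (cases "row e = row f")
    case True
    then show ?thesis using same_row_less ef by blast
  next
    case False
    then have "row e < row f" using fst_less_if_row[OF ef(2,1)] ef(3) by (meson less_asym linorder_neqE_nat)
    then have "\<not> col f < col e" using nn ef unfolding nested_def by (force simp: cell_def)
    then show ?thesis using snd_less_if_col[OF ef(1,2)] snd_less_iff[OF ef(1,2)] ef(3) by linarith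
  qed
  moreover obtain x where "x \<in> M" "row x = i" using obtain_l[OF i] .
  moreover from this have "x \<in> {e \<in> M. row e \<le> i \<and> i \<le> col e}" using l_le_u[of x] by simp
  ultimately show "crossing M {e \<in> M. row e \<le> i \<and> i \<le> col e}" unfolding crossing_iff by blast
next
  fix S assume S: "crossing M S"
  then have SM: "S \<subseteq> M" "S \<noteq> {}" by (auto simp: crossing_iff)
  then have "finite (row ` S)" "row ` S \<noteq> {}" using finite_M finite_subset by auto
  then obtain f where f: "f \<in> S" "row f = Max (row ` S)" using Max_in by (metis imageE)
  have "row e \<le> row f" if "e \<in> S" for e using f(2) that \<open>finite (row ` S)\<close> by simp
  moreover have "row f \<le> col e" if "e \<in> S" for e using crossing_cells(1)[OF S f(1) that] .
  moreover have "row f < runs" using l_less f SM by blast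
  ultimately show "\<exists>i<runs. S \<subseteq> {e \<in> M. row e \<le> i \<and> i \<le> col e}" using SM by (intro exI[of _ "row f"]) auto
next
  fix i j assume ij: "i < runs" "j < runs" "{e \<in> M. row e \<le> i \<and> i \<le> col e} \<subseteq> {e \<in> M. row e \<le> j \<and> j \<le> col e}"
  \<comment> \<open>An arc that begins at \<open>i\<close> and one that ends at \<open>i\<close>
    leave \<open>i\<close> as the only common point.\<close>
  obtain x where x: "x \<in> M" "row x = i" using obtain_l[OF ij(1)] .
  obtain y where y: "y \<in> M" "col y = i" using obtain_u[OF ij(1)] .
  have "x \<in> {e \<in> M. row e \<le> i \<and> i \<le> col e}" "y \<in> {e \<in> M. row e \<le> i \<and> i \<le> col e}"
    using x y l_le_u[OF x(1)] l_le_u[OF y(1)] by auto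
  then have "row x \<le> j" "j \<le> col y" using ij(3) by auto
  then show "i = j" using x y by simp
qed

text \<open>Without crossing cells, row \<open>i\<close> and column \<open>i\<close> share the diagonal cell and at most one of them has
  other cells, so the larger of the two is the maximal crossing through the diagonal arcs.\<close>

lemma mcr_uncrossed:
  assumes nc: "\<not> crossed (cell ` M)"
  shows "mcr M = runs"
proof -
  obtain d where d: "\<And>i. i < runs \<Longrightarrow> d i \<in> M \<and> row (d i) = i \<and> col (d i) = i"
    using obtain_diagonal[OF nc] by metis
  have ncD: "\<not> (row e < row f \<and> row f \<le> col e \<and> col e < col f)" if "e \<in> M" "f \<in> M" for e f
    using nc that unfolding crossed_def by (force simp: cell_def)
  define R where "R i = {e \<in> M. row e = i}" for i
  define C where "C i = {e \<in> M. col e = i}" for i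
  define G where "G i = (if C i \<subseteq> R i then R i else C i)" for i
  have RC: "R i \<subseteq> G i \<and> C i \<subseteq> G i" for i
  proof (cases "C i \<subseteq> R i")
    case True
    then show ?thesis by (simp add: G_def)
  next
    case False
    then obtain e where e: "e \<in> M" "col e = i" "row e \<noteq> i" by (auto simp: R_def C_def)
    then have "row e < i" using l_le_u[OF e(1)] by simp
    then have "col f = i" if "f \<in> M" "row f = i" for f
      using ncD[OF e(1) that(1)] l_le_u[OF that(1)] that e by linarith
    then have "R i \<subseteq> C i" by (auto simp: R_def C_def)
    then show ?thesis using False by (simp add: G_def)
  qed
  show ?thesis
  proof (rule mcr_eqI[where G = G])
    fix i assume "i < runs"
    then show "crossing M (G i)" using crossing_row crossing_col by (simp add: G_def R_def C_def)
  next
    fix S assume S: "crossing M S"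
    then have SM: "S \<subseteq> M" "S \<noteq> {}" by (auto simp: crossing_iff)
    \<comment> \<open>In a crossing, a lower row is accompanied by a column that reaches the higher
      row and is at most the other column. Without crossed cells the two columns are then
      equal.\<close>
    have same: "row e = row f \<or> col e = col f" if "e \<in> S" "f \<in> S" for e f
    proof -
      have *: "col e = col f" if "e \<in> S" "f \<in> S" "row e < row f" for e f
        using crossing_cells[OF S that(1,2)] crossing_cells(1)[OF S that(2,1)] ncD[of e f] SM that by force
      consider "row e < row f" | "row f < row e" | "row e = row f" by linarith
      then show ?thesis using *[OF that] *[OF that(2,1)] by cases auto
    qed
    obtain e where e: "e \<in> S" using SM by blast
    \<comment> \<open>Two equivalence relations whose union relates everything: one of them alone
      already does.\<close>
    have "(\<forall>f\<in>S. row f = row e) \<or> (\<forall>f\<in>S. col f = col e)"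
    proof (rule ccontr)
      assume "\<not> ?thesis"
      then obtain f g where "f \<in> S" "row f \<noteq> row e" "g \<in> S" "col g \<noteq> col e" by blast
      then show False using same[of f e] same[of g e] same[of f g] e by auto
    qed
    then show "\<exists>i<runs. S \<subseteq> G i"
    proof
      assume "\<forall>f\<in>S. row f = row e"
      then have "S \<subseteq> R (row e)" using SM by (auto simp: R_def)
      moreover have "row e < runs" using l_less e SM by blast
      ultimately show ?thesis using RC by blast
    next
      assume "\<forall>f\<in>S. col f = col e"
      then have "S \<subseteq> C (col e)" using SM by (auto simp: C_def)
      moreover have "col e < runs" using u_less e SM by blast
      ultimately show ?thesis using RC by blast
    qed
  next
    fix i j assume ij: "i < runs" "j < runs" "G i \<subseteq> G j"
    \<comment> \<open>A diagonal arc has the same row and column, so whether \<open>G j\<close> is a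
      row or a column, containing \<open>d i\<close> means \<open>j = i\<close>.\<close>
    have "d i \<in> R i" using d[OF ij(1)] by (simp add: R_def)
    then have "d i \<in> G j" using RC ij(3) by blast
    then show "i = j" using d[OF ij(1)] by (auto simp: G_def R_def C_def split: if_splits)
  qed
qed

lemma noncrossing_less:
  assumes "noncrossing M S" "e \<in> S" "f \<in> S" "e \<noteq> f"
  shows "snd e < fst f \<or> snd f < fst e"
proof -
  obtain xs where xs: "set xs = S" "sorted_wrt (<) (concat (map (\<lambda>(a, b). [a, b]) xs))"
    using assms unfolding noncrossing_def by blast
  have "sorted_wrt (\<lambda>e f. snd e < fst f) xs" using xs(2)
    by (induction xs) (auto simp: case_prod_unfold)
  moreover obtain i j where "i < length xs" "j < length xs" "e = xs ! i" "f = xs ! j"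
    using assms xs(1) by (metis in_set_conv_nth)
  moreover have "i \<noteq> j" using assms calculation by auto
  ultimately show ?thesis by (metis linorder_neqE_nat sorted_wrt_nth_less)
qed

text \<open>Arcs of a noncrossing occupy different rows, which bounds their number; the diagonal
  arcs, one for each run, attain the bound.\<close>

lemma nr_uncrossed:
  assumes nc: "\<not> crossed (cell ` M)"
  shows "nr M = runs"
  unfolding nr_def
proof (rule Max_eqI)
  have "{card S |S. noncrossing M S} \<subseteq> card ` Pow M" unfolding noncrossing_def by blast
  then show "finite {card S |S. noncrossing M S}" by (rule finite_subset) (simp add: finite_M)
  fix m assume "m \<in> {card S |S. noncrossing M S}"
  then obtain S where S: "noncrossing M S" "m = card S" by blast
  then have SM: "S \<subseteq> M" by (simp add: noncrossing_def)
  have "inj_on row S"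
  proof (rule inj_onI)
    fix e f assume ef: "e \<in> S" "f \<in> S" "row e = row f"
    then have M: "e \<in> M" "f \<in> M" using SM by auto
    show "e = f"
    proof (rule ccontr)
      assume "e \<noteq> f"
      from noncrossing_less[OF S(1) ef(1,2) this] have "col e < row f \<or> col f < row e"
        using col_less_row_iff M by blast
      then show False using l_le_u[OF M(1)] l_le_u[OF M(2)] ef(3) by linarith
    qed
  qed
  then have "card S = card (row ` S)" by (simp add: card_image)
  also have "\<dots> \<le> card {..<runs}" using SM l_image by (intro card_mono) auto
  finally show "m \<le> runs" using S by simp
next
  obtain d where d: "\<And>i. i < runs \<Longrightarrow> d i \<in> M \<and> row (d i) = i \<and> col (d i) = i"
    using obtain_diagonal[OF nc] by metis
  \<comment> \<open>The bound by closers of earlier diagonal arcs strengthens the induction, so that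
    the next arc can be appended.\<close>
  have "sorted_wrt (<) (concat (map (\<lambda>(a, b). [a, b]) (map d [0..<m]))) \<and>
      (\<forall>p \<in> set (concat (map (\<lambda>(a, b). [a, b]) (map d [0..<m]))). \<exists>i<m. p \<le> snd (d i))" if "m \<le> runs" for m
    using that
  proof (induction m)
    case (Suc m)
    have dm: "d m \<in> M" "row (d m) = m" using d Suc.prems by auto
    have lt: "snd (d i) < fst (d m)" if "i < m" for i
    proof -
      have "d i \<in> M" "col (d i) = i" using d that Suc.prems by auto
      then show ?thesis using col_less_row_iff[of "d i" "d m"] dm that by simp
    qed
    define L where "L = concat (map (\<lambda>(a, b). [a, b]) (map d [0..<m]))"
    have IH: "sorted_wrt (<) L" "\<And>p. p \<in> set L \<Longrightarrow> \<exists>i<m. p \<le> snd (d i)"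
      using Suc.IH[OF Suc_leD[OF Suc.prems]] unfolding L_def by blast+
    have L_Suc: "concat (map (\<lambda>(a, b). [a, b]) (map d [0..<Suc m])) = L @ [fst (d m), snd (d m)]"
      by (simp add: L_def case_prod_unfold)
    have ltL: "p < fst (d m)" if "p \<in> set L" for p using IH(2)[OF that] lt by (auto intro: le_less_trans)
    have "sorted_wrt (<) (L @ [fst (d m), snd (d m)])"
      using IH(1) ltL arc_less[OF dm(1)] unfolding sorted_wrt_append by (auto intro: less_trans)
    moreover have "\<exists>i<Suc m. p \<le> snd (d i)" if "p \<in> set (L @ [fst (d m), snd (d m)])" for p
    proof (cases "p \<in> set L")
      case True
      then show ?thesis using IH(2) less_SucI by blast
    next
      case False
      then have "p \<le> snd (d m)" using that arc_less[OF dm(1)] by auto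
      then show ?thesis by blast
    qed
    ultimately show ?case unfolding L_Suc by blast
  qed simp
  then have "noncrossing M (d ` {..<runs})" unfolding noncrossing_def
    using d by (auto intro!: exI[of _ "map d [0..<runs]"] simp: atLeast0LessThan)
  moreover have "card (d ` {..<runs}) = runs"
    by (subst card_image) (auto intro!: inj_on_inverseI[of _ row] simp: d)
  ultimately show "runs \<in> {card S |S. noncrossing M S}" by force
qed

end

section \<open>Generating polynomials of the matchings\<close>

lemma (in stoimenow_matching) set_matching_cells: "set_mset (matching_cells M) = cell ` M"
  by (simp add: matching_cells_M set_cell_mset)

lemma matchings_P1_narayana:
  "1 \<le> n \<Longrightarrow> (\<Sum>M \<in> stoimenow_matchings_avoiding n pattern_P1. monom 1 (mcr M)) = narayana_poly n"
  by (rule sum_matchings_avoiding[where bad = nested])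
    (simp_all add: stoimenow_matching.contains_P1 stoimenow_matching.mcr_unnested card_nonnested_cells
      stoimenow_matching.set_matching_cells)

lemma matchings_P2_mcr_narayana:
  "1 \<le> n \<Longrightarrow> (\<Sum>M \<in> stoimenow_matchings_avoiding n pattern_P2. monom 1 (mcr M)) = narayana_poly n"
  by (rule sum_matchings_avoiding[where bad = crossed])
    (simp_all add: stoimenow_matching.contains_P2 stoimenow_matching.mcr_uncrossed card_uncrossed_cells
      stoimenow_matching.set_matching_cells)

lemma matchings_P2_nr_narayana:
  "1 \<le> n \<Longrightarrow> (\<Sum>M \<in> stoimenow_matchings_avoiding n pattern_P2. monom 1 (nr M)) = narayana_poly n"
  by (rule sum_matchings_avoiding[where bad = crossed])
    (simp_all add: stoimenow_matching.contains_P2 stoimenow_matching.nr_uncrossed card_uncrossed_cells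
      stoimenow_matching.set_matching_cells)

theorem theorem1p4:
  fixes n :: nat
  assumes "n \<ge> 1"
  shows
    "(\<Sum>M \<in> stoimenow_matchings_avoiding n pattern_P1. monom 1 (mcr M)) = narayana_poly n \<and>
     (\<Sum>M \<in> stoimenow_matchings_avoiding n pattern_P2. monom 1 (mcr M)) = narayana_poly n \<and>
     (\<Sum>M \<in> stoimenow_matchings_avoiding n pattern_P2. monom 1 (nr M)) = narayana_poly n \<and>
     (\<Sum>P \<in> two_plus_two_free_posets_avoiding n three_plus_one. monom 1 (mag P)) = narayana_poly n \<and>
     (\<Sum>P \<in> two_plus_two_free_posets_avoiding n poset_N. monom 1 (mag P)) = narayana_poly n \<and>
     (\<Sum>P \<in> two_plus_two_free_posets_avoiding n poset_N. monom 1 (height P)) = narayana_poly n \<and>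
     (\<Sum>\<alpha> \<in> ascent_sequences_avoiding_101 n. monom 1 (lmax \<alpha>)) = narayana_poly n \<and>
     (\<Sum>\<pi> \<in> fishburn_permutations_avoiding n [3, 1, 4, 2]. monom 1 (rmin \<pi>)) = narayana_poly n"
  using matchings_P1_narayana[OF assms] matchings_P2_mcr_narayana[OF assms] matchings_P2_nr_narayana[OF assms]
    three_plus_one_free_narayana[OF assms] N_free_mag_narayana[OF assms] N_free_height_narayana[OF assms]
    ascent_narayana[OF assms] fishburn_permutations_narayana[OF assms]
  by blast

end
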